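(* Let $(X,\mathcal{F},\mu)$ be a probability space with $L^2(X,\mu)$ infinite dimensional, and let $P$ be a reversible Markov operator on $L^2(X,\mu)$. Then \[ \overline{\lambda}_{\mathrm{ess}}(P)>-1 \iff \inf_{k\geq 1}\overline{h}_P(k)<1. \]
   Context: A Markov operator is a linear operator $P:L^2(X,\mu)\to L^2(X,\mu)$ with $P1=1$ and $Pf\geq 0$ whenever $f\geq 0$; it is reversible (with invariant measure $\mu$) if $\int_X gPf\,d\mu=\int_X fPg\,d\mu$ for all $f,g\in L^2(X,\mu)$. Write $(f,g)_\mu=\int_X fg\,d\mu$ and $1_A$ for the indicator of a measurable set $A$. $\overline{\lambda}_{\mathrm{ess}}(P):=\inf\sigma_{\mathrm{ess}}(P)$ is the infimum of the essential spectrum of $P$. The $k$-way dual Cheeger constant is \[ \overline{h}_P(k):=\sup\min_{1\leq i\leq k}\frac{2(1_{A_{2i-1}},P1_{A_{2i}})_\mu}{\mu(A_{2i-1}\cup A_{2i})}, \] the supremum over all collections of $k$ pairs of measurable sets $(A_1,A_2),\ldots,(A_{2k-1},A_{2k})$ with $A_p\cap A_q=\emptyset$ for all $1\leq p\neq q\leq 2k$ and $\mu(A_{2i-1}\cup A_{2i})>0$ for each $i$. *)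

theory Defs
  imports "HOL-Probability.Probability"
begin

text \<open>Elements of L^2(X,mu) are represented by real-valued functions; everything is
  understood modulo mu-almost-everywhere equality.\<close>

definition L2 :: "'a measure \<Rightarrow> ('a \<Rightarrow> real) set" where
  "L2 M = {f. f \<in> borel_measurable M \<and> integrable M (\<lambda>x. (f x)\<^sup>2)}"

definition L2_inner :: "'a measure \<Rightarrow> ('a \<Rightarrow> real) \<Rightarrow> ('a \<Rightarrow> real) \<Rightarrow> real" where
  "L2_inner M f g = (\<integral>x. f x * g x \<partial>M)"

definition L2_fin_dim :: "'a measure \<Rightarrow> ('a \<Rightarrow> real) set \<Rightarrow> bool" where
  "L2_fin_dim M E \<longleftrightarrow> (\<exists>B. finite B \<and> B \<subseteq> L2 M \<and>
      (\<forall>f\<in>E. \<exists>c. AE x in M. f x = (\<Sum>b\<in>B. c b * b x)))"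

definition L2_operator :: "'a measure \<Rightarrow> (('a \<Rightarrow> real) \<Rightarrow> ('a \<Rightarrow> real)) \<Rightarrow> bool" where
  "L2_operator M P \<longleftrightarrow>
     (\<forall>f\<in>L2 M. P f \<in> L2 M) \<and>
     (\<forall>f\<in>L2 M. \<forall>g\<in>L2 M. (AE x in M. f x = g x) \<longrightarrow> (AE x in M. P f x = P g x)) \<and>
     (\<forall>f\<in>L2 M. \<forall>g\<in>L2 M. \<forall>a b::real.
        AE x in M. P (\<lambda>y. a * f y + b * g y) x = a * P f x + b * P g x)"

definition markov_operator :: "'a measure \<Rightarrow> (('a \<Rightarrow> real) \<Rightarrow> ('a \<Rightarrow> real)) \<Rightarrow> bool" where
  "markov_operator M P \<longleftrightarrow> L2_operator M P \<and>
     (AE x in M. P (\<lambda>_. 1) x = 1) \<and>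
     (\<forall>f\<in>L2 M. (AE x in M. f x \<ge> 0) \<longrightarrow> (AE x in M. P f x \<ge> 0))"

definition reversible :: "'a measure \<Rightarrow> (('a \<Rightarrow> real) \<Rightarrow> ('a \<Rightarrow> real)) \<Rightarrow> bool" where
  "reversible M P \<longleftrightarrow> (\<forall>f\<in>L2 M. \<forall>g\<in>L2 M. L2_inner M g (P f) = L2_inner M f (P g))"

definition L2_spectrum :: "'a measure \<Rightarrow> (('a \<Rightarrow> real) \<Rightarrow> ('a \<Rightarrow> real)) \<Rightarrow> real set" where
  "L2_spectrum M P = {l. \<not> (
      (\<forall>f\<in>L2 M. (AE x in M. P f x - l * f x = 0) \<longrightarrow> (AE x in M. f x = 0)) \<and>
      (\<forall>g\<in>L2 M. \<exists>f\<in>L2 M. AE x in M. P f x - l * f x = g x))}"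

definition L2_eigenspace :: "'a measure \<Rightarrow> (('a \<Rightarrow> real) \<Rightarrow> ('a \<Rightarrow> real)) \<Rightarrow> real \<Rightarrow> ('a \<Rightarrow> real) set" where
  "L2_eigenspace M P l = {f\<in>L2 M. AE x in M. P f x = l * f x}"

definition L2_discrete_spectrum :: "'a measure \<Rightarrow> (('a \<Rightarrow> real) \<Rightarrow> ('a \<Rightarrow> real)) \<Rightarrow> real set" where
  "L2_discrete_spectrum M P = {l \<in> L2_spectrum M P.
      (\<exists>e>0. \<forall>m\<in>L2_spectrum M P. \<bar>m - l\<bar> < e \<longrightarrow> m = l) \<and>
      (\<exists>f\<in>L2_eigenspace M P l. \<not> (AE x in M. f x = 0)) \<and>
      L2_fin_dim M (L2_eigenspace M P l)}"

definition L2_ess_spectrum :: "'a measure \<Rightarrow> (('a \<Rightarrow> real) \<Rightarrow> ('a \<Rightarrow> real)) \<Rightarrow> real set" where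
  "L2_ess_spectrum M P = L2_spectrum M P - L2_discrete_spectrum M P"

definition lambda_ess_bot :: "'a measure \<Rightarrow> (('a \<Rightarrow> real) \<Rightarrow> ('a \<Rightarrow> real)) \<Rightarrow> real" where
  "lambda_ess_bot M P = Inf (L2_ess_spectrum M P)"

definition dual_cheeger :: "'a measure \<Rightarrow> (('a \<Rightarrow> real) \<Rightarrow> ('a \<Rightarrow> real)) \<Rightarrow> nat \<Rightarrow> real" where
  "dual_cheeger M P k = Sup {Min ((\<lambda>i. 2 * L2_inner M (indicator (A (2*i-1))) (P (indicator (A (2*i))))
                                      / measure M (A (2*i-1) \<union> A (2*i))) ` {1..k}) | A.
      (\<forall>p\<in>{1..2*k}. A p \<in> sets M) \<and>
      (\<forall>p\<in>{1..2*k}. \<forall>q\<in>{1..2*k}. p \<noteq> q \<longrightarrow> A p \<inter> A q = {}) \<and>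
      (\<forall>i\<in>{1..k}. measure M (A (2*i-1) \<union> A (2*i)) > 0)}"

end

theory Submission
  imports Defs "HOL-Library.Function_Algebras"
begin

text \<open>
  Let \<open>E f = (f, f) + (f, P f)\<close>. Both sides of the equivalence say that \<open>E\<close> is coercive on the orthogonal
  complement of a finite set of vectors. For the essential spectrum this is Weyl's criterion at the
  bottom \<open>- 1\<close> of the spectrum.

  If \<open>k\<close> disjoint pairs \<open>(A\<^sub>i, B\<^sub>i)\<close> have ratios close to 1, the functions \<open>1\<^bsub>A\<^sub>i\<^esub> - 1\<^bsub>B\<^sub>i\<^esub>\<close> are orthogonal
  with small energy, which excludes coercivity when \<open>k\<close> is large. Conversely, without coercivity the
  number of pairs can be increased one at a time. Take \<open>j + 1\<close> almost orthonormal simple functions of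
  small energy and only then \<open>j\<close> pairs whose defects are tiny compared with the sup norms of these
  functions. Some normalised combination \<open>f\<close> is orthogonal to every \<open>1\<^bsub>A\<^sub>i\<^esub> - 1\<^bsub>B\<^sub>i\<^esub>\<close>. Either \<open>f\<close> has mass
  outside all pairs, and its level sets there give a new pair, or it has mass on some \<open>A\<^sub>i \<union> B\<^sub>i\<close>, and
  cutting at a median-like level \<open>c\<close> the positive and negative parts of \<open>\<plusminus> f - c\<close> split that pair in two.
\<close>

section \<open>Elementary real and linear algebra\<close>

text \<open>\<open>P\<close> is given only as an operator: it need not have a kernel, and
  boundedness is not part of its definition. Positivity, \<open>P 1 = 1\<close> and symmetry still
  allow integration over pairs of values of a simple function, so each comparison of energies is
  reduced to a pointwise inequality between kernels, and functions are made simple before they are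
  cut. The contraction bound for \<open>P\<close> is obtained in the same way. On the spectral side
  there is no functional calculus: an isolated spectral point is separated from the rest through
  surjectivity of shifted operators, uniform boundedness and factorisations such as \<open>T\<^sup>2
  - \<theta> = (T - sqrt \<theta>) (T + sqrt \<theta>)\<close>. Defects have to be small relative to
  sup norms because a pair of points that a bipartition fails to separate is charged with the
  squared sup norm of the function being cut. The sup norm is known only after the tolerance of the
  new family is fixed, which is why the induction on the number of pairs carries all tolerances at
  once.\<close>

lemma discriminant_bound:
  fixes a b c :: real
  assumes q: "\<And>t. 0 \<le> a + 2 * t * b + t\<^sup>2 * c" and c: "0 \<le> c"
  shows "b\<^sup>2 \<le> a * c"
proof (cases "c = 0")
  case True
  have "b = 0"
  proof (rule ccontr)
    assume "b \<noteq> 0"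
    \<comment> \<open>This \<open>t\<close> gives the linear expression the value -1.\<close>
    then show False using q[of "- (a + 1) / (2 * b)"] True by (simp add: field_simps)
  qed
  then show ?thesis using True by simp
next
  case False
  with c have "c > 0" by simp
  have "a + 2 * (- b / c) * b + (- b / c)\<^sup>2 * c = a - b\<^sup>2 / c"
    using False by (simp add: field_simps power2_eq_square)
  then have "0 \<le> a - b\<^sup>2 / c" using q[of "- b / c"] by linarith
  then show ?thesis using \<open>c > 0\<close> by (simp add: field_simps)
qed

lemma mult_self_le_cancel: "0 \<le> x \<Longrightarrow> 0 \<le> b \<Longrightarrow> x * x \<le> b * x \<Longrightarrow> x \<le> b" for x b :: real
  by (cases "x = 0") (auto simp: mult_le_cancel_right)

text \<open>Gaussian elimination by induction on the equations: a nonzero coefficient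
  \<open>m i p\<close> removes the unknown \<open>p\<close> from the remaining equations, which
  lowers both cardinalities by one.\<close>

lemma homogeneous_system_nontrivial:
  fixes m :: "'i \<Rightarrow> 'l \<Rightarrow> real"
  assumes "finite I" "finite L" "card I < card L"
  shows "\<exists>a. (\<exists>l\<in>L. a l \<noteq> 0) \<and> (\<forall>i\<in>I. (\<Sum>l\<in>L. a l * m i l) = 0)"
  using assms
proof (induction I arbitrary: L m rule: finite_induct)
  case empty
  then obtain l where "l \<in> L" by (metis card.empty equals0I less_irrefl)
  then show ?case by (intro exI[of _ "\<lambda>_. 1"]) auto
next
  case (insert i I)
  show ?case
  proof (cases "\<forall>l\<in>L. m i l = 0")
    case True
    obtain a where "\<exists>l\<in>L. a l \<noteq> 0" "\<forall>i\<in>I. (\<Sum>l\<in>L. a l * m i l) = 0"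
      using insert.IH[of L m] insert.prems insert.hyps by auto
    then show ?thesis using True by (intro exI[of _ a]) auto
  next
    case False
    then obtain p where p: "p \<in> L" "m i p \<noteq> 0" by blast
    define L' where "L' = L - {p}"
    have L: "finite L'" "L = insert p L'" "p \<notin> L'" using p insert.prems by (auto simp: L'_def)
    define m' where "m' j l = m j l - m j p * m i l / m i p" for j l
    have "card I < card L'" using insert.prems insert.hyps L by simp
    then obtain a where a: "\<exists>l\<in>L'. a l \<noteq> 0" "\<forall>j\<in>I. (\<Sum>l\<in>L'. a l * m' j l) = 0"
      using insert.IH[of L' m'] L by blast
    \<comment> \<open>The value at \<open>p\<close> is the one that equation \<open>i\<close>
      forces.\<close>
    define b where "b = a(p := - (\<Sum>l\<in>L'. a l * m i l) / m i p)"
    have b_sum: "(\<Sum>l\<in>L. b l * m j l) = b p * m j p + (\<Sum>l\<in>L'. a l * m j l)" for j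
      using L by (simp add: b_def) (intro sum.cong; auto)
    have "(\<Sum>l\<in>L. b l * m j l) = 0" if "j \<in> insert i I" for j
    proof (cases "j = i")
      case True
      then show ?thesis using p b_sum[of i] by (simp add: b_def)
    next
      case False
      then have "j \<in> I" using that by simp
      then have "0 = (\<Sum>l\<in>L'. a l * m' j l)" using a(2) by simp
      also have "\<dots> = (\<Sum>l\<in>L'. a l * m j l - m j p / m i p * (a l * m i l))"
        by (intro sum.cong) (simp_all add: m'_def right_diff_distrib)
      also have "\<dots> = (\<Sum>l\<in>L'. a l * m j l) - m j p / m i p * (\<Sum>l\<in>L'. a l * m i l)"
        by (simp add: sum_subtractf sum_distrib_left)
      finally show ?thesis using b_sum[of j] by (simp add: b_def)
    qed
    moreover have "\<exists>l\<in>L. b l \<noteq> 0" using a(1) L by (auto simp: b_def)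
    ultimately show ?thesis by blast
  qed
qed

text \<open>Integrated over a level t, the event that both squares exceed t has length
  \<open>min (u\<^sup>2) (v\<^sup>2)\<close>; this is the resulting inequality between kernels. For
  opposite signs the left side is |u + v| |u - v|, which AM-GM splits with weight \<kappa>;
  otherwise the sum of squares is already at most \<open>(u + v)\<^sup>2\<close>.\<close>

lemma level_set_kernel_bound:
  fixes u v \<kappa> :: real
  assumes "\<kappa> > 0"
  shows "u\<^sup>2 + v\<^sup>2 - 2 * of_bool ((u > 0 \<and> v < 0) \<or> (v > 0 \<and> u < 0)) * min (u\<^sup>2) (v\<^sup>2)
      \<le> (u + v)\<^sup>2 / \<kappa> + \<kappa> / 2 * (u\<^sup>2 + v\<^sup>2)"
proof (cases "(u > 0 \<and> v < 0) \<or> (v > 0 \<and> u < 0)")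
  case True
  have amgm: "x * y \<le> x\<^sup>2 / \<kappa> + \<kappa> / 4 * y\<^sup>2" for x y
  proof -
    have "0 \<le> (x - \<kappa> / 2 * y)\<^sup>2 / \<kappa>" using assms by simp
    also have "\<dots> = x\<^sup>2 / \<kappa> + \<kappa> / 4 * y\<^sup>2 - x * y" using assms by (simp add: field_simps power2_eq_square)
    finally show ?thesis by simp
  qed
  have "u\<^sup>2 + v\<^sup>2 - 2 * min (u\<^sup>2) (v\<^sup>2) = max ((u + v) * (u - v)) ((u + v) * (v - u))"
    by (simp add: min_def max_def power2_eq_square algebra_simps)
  also have "\<dots> \<le> (u + v)\<^sup>2 / \<kappa> + \<kappa> / 4 * (u - v)\<^sup>2"
    using amgm[of "u + v" "u - v"] amgm[of "u + v" "v - u"] by (simp add: power2_commute)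
  also have "\<dots> \<le> (u + v)\<^sup>2 / \<kappa> + \<kappa> / 4 * (2 * (u\<^sup>2 + v\<^sup>2))"
  proof -
    have "(u - v)\<^sup>2 \<le> 2 * (u\<^sup>2 + v\<^sup>2)" using zero_le_power2[of "u + v"] by (simp add: power2_sum power2_diff)
    then show ?thesis using assms by (intro add_left_mono mult_left_mono) auto
  qed
  also have "\<dots> = (u + v)\<^sup>2 / \<kappa> + \<kappa> / 2 * (u\<^sup>2 + v\<^sup>2)" by (simp add: algebra_simps)
  finally show ?thesis unfolding of_bool_eq_1_iff[THEN iffD2, OF True] by simp
next
  case False
  then have "0 \<le> u * v" by (auto simp: zero_le_mult_iff not_less)
  then have uv: "u\<^sup>2 + v\<^sup>2 \<le> (u + v)\<^sup>2" by (simp add: power2_sum)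
  have "1 \<le> 1 / \<kappa> + \<kappa> / 2"
  proof -
    have "0 \<le> (\<kappa> - 1)\<^sup>2 + 1" by simp
    then have "2 * \<kappa> \<le> 2 + \<kappa>\<^sup>2" by (simp add: power2_diff)
    then show ?thesis using assms by (simp add: field_simps power2_eq_square)
  qed
  then have "1 * (u\<^sup>2 + v\<^sup>2) \<le> (1 / \<kappa> + \<kappa> / 2) * (u\<^sup>2 + v\<^sup>2)" by (intro mult_right_mono) auto
  also have "\<dots> \<le> (u + v)\<^sup>2 / \<kappa> + \<kappa> / 2 * (u\<^sup>2 + v\<^sup>2)"
    using divide_right_mono[OF uv, of \<kappa>] assms by (simp add: algebra_simps add_divide_distrib)
  finally show ?thesis unfolding of_bool_eq_0_iff[THEN iffD2, OF False] by simp
qed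

section \<open>Symmetric operators on complete semi-inner product spaces\<close>

text \<open>Only semi-definiteness is asked, so that square integrable functions can be used without
  passing to classes modulo null sets. Vectors with \<open>nrm x = 0\<close> take the place of
  zero.\<close>

locale semi_inner =
  fixes H :: "'v::real_vector set" and ip :: "'v \<Rightarrow> 'v \<Rightarrow> real"
  assumes subspace_H: "subspace H"
    and ip_sym: "x \<in> H \<Longrightarrow> y \<in> H \<Longrightarrow> ip x y = ip y x"
    and ip_add_left: "x \<in> H \<Longrightarrow> y \<in> H \<Longrightarrow> z \<in> H \<Longrightarrow> ip (x + y) z = ip x z + ip y z"
    and ip_scale_left: "x \<in> H \<Longrightarrow> y \<in> H \<Longrightarrow> ip (c *\<^sub>R x) y = c * ip x y"
    and ip_nonneg: "x \<in> H \<Longrightarrow> 0 \<le> ip x x"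
begin

definition nrm :: "'v \<Rightarrow> real" where "nrm x = sqrt (ip x x)"

lemma H_closed [simp, intro]:
  "0 \<in> H" "x \<in> H \<Longrightarrow> y \<in> H \<Longrightarrow> x + y \<in> H" "x \<in> H \<Longrightarrow> y \<in> H \<Longrightarrow> x - y \<in> H"
  "x \<in> H \<Longrightarrow> c *\<^sub>R x \<in> H" "x \<in> H \<Longrightarrow> - x \<in> H"
  using subspace_H by (auto intro: subspace_0 subspace_add subspace_diff subspace_scale subspace_neg)

lemma H_sum [simp, intro]: "(\<And>i. i \<in> I \<Longrightarrow> f i \<in> H) \<Longrightarrow> sum f I \<in> H"
  using subspace_H by (rule subspace_sum)

lemma ip_add_right: "x \<in> H \<Longrightarrow> y \<in> H \<Longrightarrow> z \<in> H \<Longrightarrow> ip x (y + z) = ip x y + ip x z"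
  by (metis H_closed(2) ip_add_left ip_sym)

lemma ip_scale_right: "x \<in> H \<Longrightarrow> y \<in> H \<Longrightarrow> ip x (c *\<^sub>R y) = c * ip x y"
  by (metis H_closed(4) ip_scale_left ip_sym)

lemma ip_minus_left: "x \<in> H \<Longrightarrow> y \<in> H \<Longrightarrow> ip (- x) y = - ip x y"
  using ip_scale_left[of x y "-1"] by simp

lemma ip_minus_right: "x \<in> H \<Longrightarrow> y \<in> H \<Longrightarrow> ip x (- y) = - ip x y"
  using ip_scale_right[of x y "-1"] by simp

lemma ip_diff_left: "x \<in> H \<Longrightarrow> y \<in> H \<Longrightarrow> z \<in> H \<Longrightarrow> ip (x - y) z = ip x z - ip y z"
  using ip_add_left[of x "- y" z] by (simp add: ip_minus_left)

lemma ip_diff_right: "x \<in> H \<Longrightarrow> y \<in> H \<Longrightarrow> z \<in> H \<Longrightarrow> ip x (y - z) = ip x y - ip x z"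
  using ip_add_right[of x y "- z"] by (simp add: ip_minus_right)

lemma ip_zero: "x \<in> H \<Longrightarrow> ip 0 x = 0" "x \<in> H \<Longrightarrow> ip x 0 = 0"
  using ip_scale_left[of 0 x 0] ip_scale_right[of x 0 0] by simp_all

lemmas ip_simps = ip_add_left ip_add_right ip_scale_left ip_scale_right ip_minus_left
  ip_minus_right ip_diff_left ip_diff_right ip_zero

lemma ip_sum_left:
  "(\<And>i. i \<in> I \<Longrightarrow> f i \<in> H) \<Longrightarrow> y \<in> H \<Longrightarrow> ip (sum f I) y = (\<Sum>i\<in>I. ip (f i) y)"
  by (induction I rule: infinite_finite_induct) (simp_all add: ip_simps)

lemma ip_sum_right:
  "(\<And>i. i \<in> I \<Longrightarrow> f i \<in> H) \<Longrightarrow> y \<in> H \<Longrightarrow> ip y (sum f I) = (\<Sum>i\<in>I. ip y (f i))"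
  by (induction I rule: infinite_finite_induct) (simp_all add: ip_simps)

lemma nrm_power2: "x \<in> H \<Longrightarrow> (nrm x)\<^sup>2 = ip x x"
  by (simp add: nrm_def ip_nonneg)

lemma nrm_mult_self: "x \<in> H \<Longrightarrow> nrm x * nrm x = ip x x"
  by (simp add: nrm_def ip_nonneg)

lemma nrm_nonneg [simp]: "x \<in> H \<Longrightarrow> 0 \<le> nrm x"
  by (simp add: nrm_def ip_nonneg)

lemma nrm_scale: "x \<in> H \<Longrightarrow> nrm (c *\<^sub>R x) = \<bar>c\<bar> * nrm x"
  by (simp add: nrm_def ip_simps real_sqrt_mult flip: mult.assoc)

lemma nrm_minus_commute: "x \<in> H \<Longrightarrow> y \<in> H \<Longrightarrow> nrm (x - y) = nrm (y - x)"
  using nrm_scale[of "x - y" "-1"] by simp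

lemma Cauchy_Schwarz:
  assumes "x \<in> H" "y \<in> H"
  shows "\<bar>ip x y\<bar> \<le> nrm x * nrm y"
proof -
  have "0 \<le> ip x x + 2 * t * ip x y + t\<^sup>2 * ip y y" for t
    using ip_nonneg[of "x + t *\<^sub>R y"] assms
    by (simp add: ip_simps ip_sym[of y x] power2_eq_square algebra_simps)
  then have "(ip x y)\<^sup>2 \<le> ip x x * ip y y"
    using ip_nonneg[OF assms(2)] by (rule discriminant_bound)
  then have "(ip x y)\<^sup>2 \<le> (nrm x * nrm y)\<^sup>2"
    using assms by (simp add: power_mult_distrib nrm_power2)
  then show ?thesis using assms by (metis abs_le_square_iff abs_of_nonneg mult_nonneg_nonneg nrm_nonneg)
qed

lemma nrm_triangle:
  assumes "x \<in> H" "y \<in> H"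
  shows "nrm (x + y) \<le> nrm x + nrm y"
proof (rule power2_le_imp_le)
  have "(nrm (x + y))\<^sup>2 = (nrm x)\<^sup>2 + 2 * ip x y + (nrm y)\<^sup>2"
    using assms by (simp add: nrm_power2 ip_simps ip_sym[of y x])
  also have "\<dots> \<le> (nrm x + nrm y)\<^sup>2"
    using Cauchy_Schwarz[OF assms] by (simp add: power2_sum)
  finally show "(nrm (x + y))\<^sup>2 \<le> (nrm x + nrm y)\<^sup>2" .
qed (use assms in simp)

lemma nrm_triangle_diff: "x \<in> H \<Longrightarrow> y \<in> H \<Longrightarrow> nrm (x - y) \<le> nrm x + nrm y"
  using nrm_triangle[of x "- y"] nrm_scale[of y "-1"] by simp

lemma nrm_triangle_mid: "x \<in> H \<Longrightarrow> y \<in> H \<Longrightarrow> z \<in> H \<Longrightarrow> nrm (x - z) \<le> nrm (x - y) + nrm (y - z)"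
  using nrm_triangle[of "x - y" "y - z"] by simp

lemma nrm_le_diff: "x \<in> H \<Longrightarrow> y \<in> H \<Longrightarrow> nrm x - nrm y \<le> nrm (x - y)"
  using nrm_triangle[of "x - y" y] by simp

end

text \<open>Completeness is asked for sequences with summable increments: every use of it below has
  geometrically decaying steps, and in L^2 this form leads directly to an almost surely convergent
  series.\<close>

locale semi_hilbert = semi_inner H ip for H :: "'v::real_vector set" and ip :: "'v \<Rightarrow> 'v \<Rightarrow> real" +
  assumes complete: "(\<And>n. X n \<in> H) \<Longrightarrow> summable (\<lambda>n. nrm (X (Suc n) - X n)) \<Longrightarrow>
        \<exists>x\<in>H. (\<lambda>n. nrm (X n - x)) \<longlonglongrightarrow> 0"
begin

lemma complete_nrm:
  assumes "\<And>n. X n \<in> H" "\<And>n. nrm (X (Suc n) - X n) \<le> a n" "summable a"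
  obtains x where "x \<in> H" "(\<lambda>n. nrm (X n - x)) \<longlonglongrightarrow> 0"
proof -
  have "summable (\<lambda>n. nrm (X (Suc n) - X n))"
    using assms by (intro summable_comparison_test'[OF assms(3)]) auto
  then show ?thesis using complete[of X] assms(1) that by blast
qed

lemma tendsto_ip:
  assumes "\<And>n. X n \<in> H" "x \<in> H" "(\<lambda>n. nrm (X n - x)) \<longlonglongrightarrow> 0"
    and "\<And>n. Y n \<in> H" "y \<in> H" "(\<lambda>n. nrm (Y n - y)) \<longlonglongrightarrow> 0"
  shows "(\<lambda>n. ip (X n) (Y n)) \<longlonglongrightarrow> ip x y"
proof -
  have "(\<lambda>n. ip (X n) (Y n) - ip x y) \<longlonglongrightarrow> 0"
  proof (rule Lim_null_comparison)
    show "\<forall>\<^sub>F n in sequentially. norm (ip (X n) (Y n) - ip x y) \<le>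
        nrm (X n - x) * nrm (Y n - y) + nrm (X n - x) * nrm y + nrm x * nrm (Y n - y)"
    proof (intro always_eventually allI)
      fix n
      have "ip (X n) (Y n) - ip x y = ip (X n - x) (Y n - y) + ip (X n - x) y + ip x (Y n - y)"
        using assms by (simp add: ip_simps)
      then show "norm (ip (X n) (Y n) - ip x y) \<le>
          nrm (X n - x) * nrm (Y n - y) + nrm (X n - x) * nrm y + nrm x * nrm (Y n - y)"
        using Cauchy_Schwarz[of "X n - x" "Y n - y"] Cauchy_Schwarz[of "X n - x" y]
          Cauchy_Schwarz[of x "Y n - y"] assms by simp
    qed
    have "(\<lambda>n. nrm (X n - x) * nrm (Y n - y) + nrm (X n - x) * nrm y + nrm x * nrm (Y n - y))
        \<longlonglongrightarrow> 0 * 0 + 0 * nrm y + nrm x * 0"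
      by (intro tendsto_intros assms)
    then show "(\<lambda>n. nrm (X n - x) * nrm (Y n - y) + nrm (X n - x) * nrm y + nrm x * nrm (Y n - y))
        \<longlonglongrightarrow> 0" by simp
  qed
  then show ?thesis by (simp add: LIM_zero_iff)
qed

lemma nrm_zero_const: "x \<in> H \<Longrightarrow> (\<lambda>n. nrm (x - x)) \<longlonglongrightarrow> 0"
  by (simp add: nrm_def ip_zero)

lemma null_ip: "x \<in> H \<Longrightarrow> nrm x = 0 \<Longrightarrow> y \<in> H \<Longrightarrow> ip x y = 0"
  using Cauchy_Schwarz[of x y] by simp

lemma null_iff: "x \<in> H \<Longrightarrow> nrm x = 0 \<longleftrightarrow> (\<forall>y\<in>H. ip x y = 0)"
  using null_ip nrm_def by auto

text \<open>Stands in for an equality of vectors, which is usually available only up to a null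
  vector: \<open>ip x x = ip y x = ip x y = ip y y\<close>.\<close>

lemma nrm_cong_ip: "x \<in> H \<Longrightarrow> y \<in> H \<Longrightarrow> (\<And>z. z \<in> H \<Longrightarrow> ip x z = ip y z) \<Longrightarrow> nrm x = nrm y"
  by (metis ip_sym nrm_def)

text \<open>Sokal's elementary argument: adding \<open>\<plusminus> 3\<^sup>-\<^sup>n\<close> times the normalised \<open>n\<close>-th vector, with
  the sign that does not decrease the pairing, the later corrections cannot undo its effect.\<close>

lemma uniform_boundedness:
  assumes y: "\<And>n::nat. y n \<in> H" and bdd: "\<And>x. x \<in> H \<Longrightarrow> \<exists>C. \<forall>n. \<bar>ip x (y n)\<bar> \<le> C"
  shows "\<exists>C. \<forall>n. nrm (y n) \<le> C"
proof (rule ccontr)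
  assume "\<not> ?thesis"
  then have "\<exists>k. 4 ^ n \<le> nrm (y k)" for n :: nat by (meson nle_le)
  then obtain k where k: "\<And>n::nat. 4 ^ n \<le> nrm (y (k n))" by metis
  define z where "z n = y (k n)" for n
  have zH [simp]: "z n \<in> H" for n by (simp add: z_def y)
  have z4: "4 ^ n \<le> nrm (z n)" for n by (simp add: z_def k)
  have z0: "0 < nrm (z n)" for n using z4[of n] by (smt (verit) zero_less_power)
  define X where "X = rec_nat 0 (\<lambda>n x. x + ((if ip x (z n) \<ge> 0 then 1 else - 1) * (1/3) ^ n / nrm (z n)) *\<^sub>R z n)"
  have X0: "X 0 = 0" and XS: "X (Suc n) = X n + ((if ip (X n) (z n) \<ge> 0 then 1 else - 1) * (1/3) ^ n / nrm (z n)) *\<^sub>R z n" for n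
    by (simp_all add: X_def)
  have XH [simp]: "X n \<in> H" for n by (induction n) (simp_all add: X0 XS)
  have step: "nrm (X (Suc n) - X n) = (1/3) ^ n" for n
    using z0[of n] by (simp add: XS nrm_scale abs_mult)
  have big: "(1/3) ^ n * nrm (z n) \<le> \<bar>ip (X (Suc n)) (z n)\<bar>" for n
  proof -
    have "ip (z n) (z n) = nrm (z n) * nrm (z n)" by (metis nrm_power2 power2_eq_square zH)
    then have "ip (X (Suc n)) (z n) = ip (X n) (z n) + (if ip (X n) (z n) \<ge> 0 then 1 else - 1) * ((1/3) ^ n * nrm (z n))"
      using z0[of n] by (simp add: XS ip_simps)
    moreover have "0 \<le> (1/3) ^ n * nrm (z n)" by simp
    ultimately show ?thesis by (simp split: if_splits)
  qed
  have "summable (\<lambda>n. (1/3::real) ^ n)" by (simp add: summable_geometric)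
  then obtain x where xH [simp]: "x \<in> H" and lim: "(\<lambda>n. nrm (X n - x)) \<longlonglongrightarrow> 0"
    using complete_nrm[of X "\<lambda>n. (1/3) ^ n"] step by (metis XH order_refl)
  \<comment> \<open>The exact partial geometric sum is kept on the right so that the induction
    closes.\<close>
  have tail: "nrm (X (n + m) - X n) \<le> 3/2 * (1/3) ^ n - 3/2 * (1/3) ^ (n + m)" for n m
  proof (induction m)
    case 0
    then show ?case by (simp add: nrm_def ip_zero)
  next
    case (Suc m)
    then show ?case
      using nrm_triangle_mid[of "X (n + Suc m)" "X (n + m)" "X n"] step[of "n + m"] by simp
  qed
  have dist: "nrm (X n - x) \<le> 3/2 * (1/3) ^ n" for n
  proof (rule LIMSEQ_le_const[of "\<lambda>m. nrm (X (m + n) - x) + 3/2 * (1/3) ^ n"])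
    have "(\<lambda>m. nrm (X (m + n) - x) + 3/2 * (1/3) ^ n) \<longlonglongrightarrow> 0 + 3/2 * (1/3) ^ n"
      by (intro tendsto_intros LIMSEQ_ignore_initial_segment[OF lim])
    then show "(\<lambda>m. nrm (X (m + n) - x) + 3/2 * (1/3) ^ n) \<longlonglongrightarrow> 3/2 * (1/3) ^ n" by simp
    show "\<exists>N. \<forall>m\<ge>N. nrm (X n - x) \<le> nrm (X (m + n) - x) + 3/2 * (1/3) ^ n"
    proof (intro exI[of _ 0] allI impI)
      fix m
      have "nrm (X (m + n) - X n) \<le> 3/2 * (1/3) ^ n"
        using tail[of n m] zero_le_power[of "1/3::real" "n + m"] unfolding add.commute[of n m] by linarith
      then show "nrm (X n - x) \<le> nrm (X (m + n) - x) + 3/2 * (1/3) ^ n"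
        using nrm_triangle_mid[of "X n" "X (m + n)" x] nrm_minus_commute[of "X n" "X (m + n)"] by simp
    qed
  qed
  \<comment> \<open>Step \<open>n\<close> secures a pairing of at least
    \<open>(1/3) ^ n * nrm (z n)\<close>, and all later steps together undo at most half of it. With
    \<open>4 ^ n \<le> nrm (z n)\<close> the remaining half still grows like
    \<open>(4/3) ^ n\<close>.\<close>
  have low: "(4/3) ^ n / 2 \<le> \<bar>ip x (z n)\<bar>" for n
  proof -
    have "ip x (z n) = ip (X (Suc n)) (z n) - ip (X (Suc n) - x) (z n)" by (simp add: ip_simps)
    moreover have "\<bar>ip (X (Suc n) - x) (z n)\<bar> \<le> nrm (X (Suc n) - x) * nrm (z n)"
      by (simp add: Cauchy_Schwarz)
    moreover have "nrm (X (Suc n) - x) * nrm (z n) \<le> (1/3) ^ n / 2 * nrm (z n)"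
      using dist[of "Suc n"] by (intro mult_right_mono) auto
    ultimately have "(1/3) ^ n / 2 * nrm (z n) \<le> \<bar>ip x (z n)\<bar>" using big[of n] by linarith
    moreover have "(1/3) ^ n / 2 * 4 ^ n \<le> (1/3) ^ n / 2 * nrm (z n)"
      using z4[of n] by (intro mult_left_mono) auto
    moreover have "(1/3) ^ n / 2 * 4 ^ n = (4/3::real) ^ n / 2" by (simp add: power_divide)
    ultimately show ?thesis by linarith
  qed
  obtain C where C: "\<bar>ip x (y n)\<bar> \<le> C" for n using bdd[OF xH] by blast
  obtain n where "2 * C < (4/3) ^ n" using real_arch_pow[of "4/3" "2 * C"] by auto
  then show False using low[of n] C[of "k n"] by (simp add: z_def)
qed

section \<open>Symmetric operators: surjectivity, lower bounds and coercivity\<close>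

definition symop :: "('v \<Rightarrow> 'v) \<Rightarrow> bool" where
  "symop A \<longleftrightarrow> (\<forall>x\<in>H. A x \<in> H) \<and> (\<forall>x\<in>H. \<forall>y\<in>H. ip (A x) y = ip x (A y))"

definition bound_op :: "('v \<Rightarrow> 'v) \<Rightarrow> real \<Rightarrow> bool" where
  "bound_op A L \<longleftrightarrow> 0 < L \<and> (\<forall>x\<in>H. nrm (A x) \<le> L * nrm x)"

definition surj_op :: "('v \<Rightarrow> 'v) \<Rightarrow> bool" where
  "surj_op A \<longleftrightarrow> (\<forall>g\<in>H. \<exists>f\<in>H. nrm (A f - g) = 0)"

definition shift :: "('v \<Rightarrow> 'v) \<Rightarrow> real \<Rightarrow> 'v \<Rightarrow> 'v" where
  "shift A c x = A x - c *\<^sub>R x"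

lemma symop_closed [simp]: "symop A \<Longrightarrow> x \<in> H \<Longrightarrow> A x \<in> H"
  by (simp add: symop_def)

lemma symopD: "symop A \<Longrightarrow> x \<in> H \<Longrightarrow> y \<in> H \<Longrightarrow> ip (A x) y = ip x (A y)"
  by (simp add: symop_def)

text \<open>A symmetric map is linear up to null vectors, so linearity is only ever used inside the
  inner product.\<close>

lemma symop_linear:
  assumes "symop A" "x \<in> H" "y \<in> H" "z \<in> H"
  shows "ip (A (x + y)) z = ip (A x) z + ip (A y) z"
    and "ip (A (x - y)) z = ip (A x) z - ip (A y) z"
    and "ip (A (c *\<^sub>R x)) z = c * ip (A x) z"
  using assms by (simp_all add: symopD ip_simps)

lemma symop_shift: "symop A \<Longrightarrow> symop (shift A c)"
  by (auto simp: symop_def shift_def ip_simps)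

lemma symop_comp: "symop A \<Longrightarrow> symop (\<lambda>x. A (A x))"
  by (auto simp: symop_def)

lemma ip_shift: "symop A \<Longrightarrow> x \<in> H \<Longrightarrow> y \<in> H \<Longrightarrow> ip (shift A c x) y = ip (A x) y - c * ip x y"
  by (simp add: shift_def ip_simps)

lemma nrm_symop_diff:
  assumes "symop A" "x \<in> H" "y \<in> H"
  shows "nrm (A (x - y)) = nrm (A x - A y)"
  using assms by (intro nrm_cong_ip) (simp_all add: ip_simps symop_linear)

lemma bound_opD: "bound_op A L \<Longrightarrow> x \<in> H \<Longrightarrow> nrm (A x) \<le> L * nrm x"
  by (simp add: bound_op_def)

lemma bound_op_shift:
  assumes "symop A" "bound_op A L"
  shows "bound_op (shift A c) (L + \<bar>c\<bar>)"
proof -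
  have "nrm (shift A c x) \<le> (L + \<bar>c\<bar>) * nrm x" if "x \<in> H" for x
    using nrm_triangle_diff[of "A x" "c *\<^sub>R x"] bound_opD[OF assms(2) that] that assms(1)
    by (simp add: shift_def nrm_scale algebra_simps)
  then show ?thesis using assms(2) by (auto simp: bound_op_def)
qed

lemma bound_op_comp:
  assumes "symop A" "bound_op A L"
  shows "bound_op (\<lambda>x. A (A x)) (L * L)"
proof -
  have L: "0 < L" using assms by (simp add: bound_op_def)
  have "nrm (A (A x)) \<le> L * L * nrm x" if "x \<in> H" for x
  proof -
    have "nrm (A (A x)) \<le> L * nrm (A x)" using assms that by (simp add: bound_opD)
    also have "\<dots> \<le> L * (L * nrm x)" using assms that L by (intro mult_left_mono) (auto simp: bound_opD)
    finally show ?thesis by (simp add: mult.assoc)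
  qed
  then show ?thesis using L by (simp add: bound_op_def)
qed

lemma form_bound:
  assumes "symop A" "bound_op A L" "x \<in> H"
  shows "\<bar>ip (A x) x\<bar> \<le> L * (nrm x)\<^sup>2"
proof -
  have "\<bar>ip (A x) x\<bar> \<le> nrm (A x) * nrm x" using assms by (simp add: Cauchy_Schwarz)
  also have "\<dots> \<le> L * nrm x * nrm x" using assms by (intro mult_right_mono) (auto simp: bound_opD)
  finally show ?thesis by (simp add: power2_eq_square)
qed

text \<open>Positivity is asked only along the line through \<open>x\<close> in direction
  \<open>y\<close>, because \<open>ess_nonempty\<close> applies this to a form that is nonnegative
  merely on an orthogonal complement.\<close>

lemma form_Cauchy_Schwarz:
  assumes A: "symop A" and x: "x \<in> H" "y \<in> H"
    and pos: "\<And>t. 0 \<le> ip (A (x + t *\<^sub>R y)) (x + t *\<^sub>R y)" "0 \<le> ip (A y) y"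
  shows "(ip (A x) y)\<^sup>2 \<le> ip (A x) x * ip (A y) y"
proof (rule discriminant_bound)
  fix t
  have "ip (A y) x = ip (A x) y" using A x by (metis symopD ip_sym symop_closed)
  then have "ip (A (x + t *\<^sub>R y)) (x + t *\<^sub>R y) = ip (A x) x + 2 * t * ip (A x) y + t\<^sup>2 * ip (A y) y"
    using A x by (simp add: ip_simps symop_linear power2_eq_square algebra_simps)
  then show "0 \<le> ip (A x) x + 2 * t * ip (A x) y + t\<^sup>2 * ip (A y) y" using pos(1)[of t] by simp
qed (use pos in simp)

text \<open>Cauchy-Schwarz for the form at \<open>x\<close> and \<open>A x\<close>, followed by the
  bound on \<open>ip (A (A x)) (A x)\<close>. It converts lower bounds on \<open>nrm (A x)\<close>
  into lower bounds on the form.\<close>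

lemma psd_nrm_bound:
  assumes A: "symop A" "bound_op A L" and psd: "\<And>x. x \<in> H \<Longrightarrow> 0 \<le> ip (A x) x" and x: "x \<in> H"
  shows "(nrm (A x))\<^sup>2 \<le> L * ip (A x) x"
proof (cases "nrm (A x) = 0")
  case True
  then show ?thesis using psd x A by (simp add: bound_op_def)
next
  case False
  have "(ip (A x) (A x))\<^sup>2 \<le> ip (A x) x * ip (A (A x)) (A x)"
    using A x by (intro form_Cauchy_Schwarz) (auto intro!: psd)
  also have "\<dots> \<le> ip (A x) x * (L * (nrm (A x))\<^sup>2)"
    using form_bound[OF A, of "A x"] A x psd by (intro mult_left_mono) auto
  finally have "(nrm (A x))\<^sup>2 * (nrm (A x))\<^sup>2 \<le> (L * ip (A x) x) * (nrm (A x))\<^sup>2"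
    using A x by (simp add: nrm_power2 nrm_mult_self power2_eq_square algebra_simps)
  moreover have "0 < (nrm (A x))\<^sup>2" using False by simp
  ultimately show ?thesis by (simp only: mult_le_cancel_right_pos)
qed

lemma tendsto_symop:
  assumes A: "symop A" "bound_op A L" and X: "\<And>n. X n \<in> H" "x \<in> H" "(\<lambda>n. nrm (X n - x)) \<longlonglongrightarrow> 0"
  shows "(\<lambda>n. nrm (A (X n) - A x)) \<longlonglongrightarrow> 0"
proof (rule Lim_null_comparison)
  show "\<forall>\<^sub>F n in sequentially. norm (nrm (A (X n) - A x)) \<le> L * nrm (X n - x)"
    using bound_opD[OF A(2)] A X nrm_symop_diff[OF A(1)] by (intro always_eventually allI) (metis H_closed(3) abs_of_nonneg nrm_nonneg real_norm_def symop_closed)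
  show "(\<lambda>n. L * nrm (X n - x)) \<longlonglongrightarrow> 0" using X(3) by (rule tendsto_mult_right_zero)
qed

text \<open>If it failed, suitably scaled vectors \<open>y n\<close> would have images of norm 1 and
  unbounded norms. Yet for \<open>x = A z\<close> the pairing
  \<open>ip x (y n) = ip z (A (y n))\<close> is at most \<open>nrm z\<close>, so surjectivity makes
  them weakly bounded.\<close>

lemma surj_op_imp_bounded_below:
  assumes A: "symop A" and surj: "surj_op A"
  obtains c where "c > 0" "\<And>x. x \<in> H \<Longrightarrow> c * nrm x \<le> nrm (A x)"
proof (rule ccontr)
  assume "\<not> thesis"
  then have "\<exists>x\<in>H. nrm (A x) < 1 / (real n + 1) * nrm x" for n :: nat
    using that[of "1 / (real n + 1)"] by (smt (verit) divide_pos_pos of_nat_0_le_iff)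
  then obtain f where f: "\<And>n::nat. f n \<in> H" and fA: "\<And>n. nrm (A (f n)) < 1 / (real n + 1) * nrm (f n)"
    by metis
  \<comment> \<open>A vector with null image is orthogonal to the range of \<open>A\<close>, hence
    to everything, hence null.\<close>
  have pos: "0 < nrm (A (f n))" for n
  proof (rule ccontr)
    assume "\<not> 0 < nrm (A (f n))"
    then have 0: "nrm (A (f n)) = 0" using A f[of n] by (metis nrm_nonneg order_le_less symop_closed)
    have "ip (f n) g = 0" if g: "g \<in> H" for g
    proof -
      obtain h where h: "h \<in> H" "nrm (A h - g) = 0" using surj g by (auto simp: surj_op_def)
      have "ip (f n) g = ip (f n) (A h) - ip (f n) (A h - g)" using f h g A by (simp add: ip_simps)
      also have "ip (f n) (A h - g) = 0" using null_ip[of "A h - g" "f n"] f g h A by (simp add: ip_sym)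
      also have "ip (f n) (A h) = 0" using null_ip[OF _ 0, of h] f h A by (simp add: symopD)
      finally show ?thesis by simp
    qed
    then have "nrm (f n) = 0" using null_iff f by blast
    then show False using fA[of n] 0 by simp
  qed
  define y where "y n = (1 / nrm (A (f n))) *\<^sub>R f n" for n
  have "\<exists>C. \<forall>n. nrm (y n) \<le> C"
  proof (rule uniform_boundedness)
    show "y n \<in> H" for n using f by (simp add: y_def)
    fix x assume x: "x \<in> H"
    then obtain z where z: "z \<in> H" "nrm (A z - x) = 0" using surj by (auto simp: surj_op_def)
    have "\<bar>ip x (y n)\<bar> \<le> nrm z" for n
    proof -
      have "ip (A z - x) (f n) = 0" using z x f A by (intro null_ip) auto
      then have "ip x (f n) = ip z (A (f n))" using z x f[of n] A by (simp add: ip_simps symopD)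
      then have "\<bar>ip x (f n)\<bar> \<le> nrm z * nrm (A (f n))" using Cauchy_Schwarz z f A by simp
      then show ?thesis using pos[of n] x f by (simp add: y_def ip_simps abs_mult field_simps)
    qed
    then show "\<exists>C. \<forall>n. \<bar>ip x (y n)\<bar> \<le> C" by blast
  qed
  then obtain C where C: "nrm (y n) \<le> C" for n by blast
  have "real n + 1 \<le> nrm (y n)" for n
    using fA[of n] pos[of n] f by (simp add: y_def nrm_scale field_simps)
  then have "real n + 1 \<le> C" for n using C order_trans by blast
  moreover obtain n :: nat where "C < real n" using reals_Archimedean2 by blast
  ultimately show False by (smt (verit))
qed

text \<open>The equation \<open>A x = g\<close> is solved by the iteration that subtracts \<tau>
  times the residual; coercivity makes one step a contraction.\<close>

lemma coercive_imp_surj: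
  assumes A: "symop A" "bound_op A L" and m: "m > 0" "\<And>x. x \<in> H \<Longrightarrow> m * (nrm x)\<^sup>2 \<le> ip (A x) x"
  shows "surj_op A"
  unfolding surj_op_def
proof
  fix g assume g: "g \<in> H"
  \<comment> \<open>Enlarging the bound ensures that \<open>m / L'\<close> is at most 1, so that
    \<open>q\<close> below is the root of a nonnegative number.\<close>
  define L' where "L' = max L m"
  have L': "0 < L'" "m \<le> L'" using m by (auto simp: L'_def)
  have AL: "nrm (A x) \<le> L' * nrm x" if "x \<in> H" for x
    using bound_opD[OF A(2) that] that by (smt (verit) L'_def max.cobounded1 mult_right_mono nrm_nonneg)
  \<comment> \<open>This value minimises
    \<open>1 - 2 * \<tau> * m + \<tau>\<^sup>2 * L'\<^sup>2\<close>, the squared contraction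
    factor.\<close>
  define \<tau> where "\<tau> = m / L'\<^sup>2"
  have \<tau>: "0 < \<tau>" using m L' by (simp add: \<tau>_def)
  define q where "q = sqrt (1 - (m / L')\<^sup>2)"
  have "(m / L')\<^sup>2 \<le> 1" using m L' by (simp add: power_le_one)
  moreover have "0 < (m / L')\<^sup>2" using m L' by simp
  ultimately have q: "0 \<le> q" "q < 1" "q\<^sup>2 = 1 - (m / L')\<^sup>2" unfolding q_def by auto
  have contr: "nrm (d - \<tau> *\<^sub>R A d) \<le> q * nrm d" if d: "d \<in> H" for d
  proof (rule power2_le_imp_le)
    have "(nrm (d - \<tau> *\<^sub>R A d))\<^sup>2 = (nrm d)\<^sup>2 - 2 * \<tau> * ip (A d) d + \<tau>\<^sup>2 * (nrm (A d))\<^sup>2"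
      using d A by (simp add: nrm_power2 nrm_mult_self ip_simps ip_sym[of d "A d"] power2_eq_square algebra_simps)
    also have "\<dots> \<le> (nrm d)\<^sup>2 - 2 * \<tau> * (m * (nrm d)\<^sup>2) + \<tau>\<^sup>2 * (L' * nrm d)\<^sup>2"
      using m(2)[OF d] \<tau> AL[OF d] A d
      by (intro add_mono diff_mono mult_left_mono power_mono) auto
    also have "\<dots> = q\<^sup>2 * (nrm d)\<^sup>2"
      using L' unfolding q \<tau>_def by (simp add: field_simps power2_eq_square)
    finally show "(nrm (d - \<tau> *\<^sub>R A d))\<^sup>2 \<le> (q * nrm d)\<^sup>2" by (simp add: power_mult_distrib)
  qed (use d q in simp)
  define X where "X = rec_nat 0 (\<lambda>n x. x - \<tau> *\<^sub>R (A x - g))"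
  have XS: "X (Suc n) = X n - \<tau> *\<^sub>R (A (X n) - g)" for n by (simp add: X_def)
  have XH [simp]: "X n \<in> H" for n by (induction n) (use A g in \<open>simp_all add: X_def\<close>)
  define d where "d n = X (Suc n) - X n" for n
  have dH [simp]: "d n \<in> H" for n by (simp add: d_def)
  have "nrm (d (Suc n)) \<le> q * nrm (d n)" for n
  proof -
    have "nrm (d (Suc n)) = nrm (d n - \<tau> *\<^sub>R A (d n))"
    proof (rule nrm_cong_ip)
      fix z assume z: "z \<in> H"
      have "d (Suc n) = d n - \<tau> *\<^sub>R (A (X (Suc n)) - A (X n))"
        unfolding d_def XS[of "Suc n"] using XS[of n] by (simp add: algebra_simps)
      then show "ip (d (Suc n)) z = ip (d n - \<tau> *\<^sub>R A (d n)) z"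
        using z A by (simp add: ip_simps symop_linear d_def[of n])
    qed (use A in auto)
    then show ?thesis using contr[of "d n"] by simp
  qed
  then have dq: "nrm (d n) \<le> nrm (d 0) * q ^ n" for n
  proof (induction n)
    case (Suc n)
    then show ?case using q mult_left_mono[OF Suc.IH[OF Suc.prems], of q]
      by (smt (verit) mult.left_commute power_Suc)
  qed simp
  have "summable (\<lambda>n. nrm (d 0) * q ^ n)" using q by (intro summable_mult summable_geometric) simp
  then obtain x where x: "x \<in> H" "(\<lambda>n. nrm (X n - x)) \<longlonglongrightarrow> 0"
    using complete_nrm[of X "\<lambda>n. nrm (d 0) * q ^ n"] dq unfolding d_def by (metis XH)
  have "nrm (A x - g) \<le> 0"
  proof (rule LIMSEQ_le_const)
    have "(\<lambda>n. nrm (d 0) * q ^ n / \<tau>) \<longlonglongrightarrow> nrm (d 0) * 0 / \<tau>"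
      using q \<tau> by (intro tendsto_intros LIMSEQ_realpow_zero) auto
    from tendsto_add[OF tendsto_symop[OF A _ x, of] this]
    show "(\<lambda>n. nrm (A (X n) - A x) + nrm (d 0) * q ^ n / \<tau>) \<longlonglongrightarrow> 0" by simp
    have "nrm (A x - g) \<le> nrm (A (X n) - A x) + nrm (d 0) * q ^ n / \<tau>" for n
    proof -
      \<comment> \<open>The residual is the step divided by \<tau>, so it tends to 0 with the
        steps.\<close>
      have "d n = (- \<tau>) *\<^sub>R (A (X n) - g)" by (simp add: d_def XS)
      then have "nrm (d n) = \<tau> * nrm (A (X n) - g)" using \<tau> A g by (metis nrm_scale abs_minus_cancel abs_of_pos H_closed(3) XH symop_closed)
      then have "nrm (A (X n) - g) \<le> nrm (d 0) * q ^ n / \<tau>" using dq[of n] \<tau> by (simp add: field_simps)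
      then show ?thesis using nrm_triangle_mid[of "A x" "A (X n)" g] nrm_minus_commute[of "A x" "A (X n)"] A x g by simp
    qed
    then show "\<exists>N. \<forall>n\<ge>N. nrm (A x - g) \<le> nrm (A (X n) - A x) + nrm (d 0) * q ^ n / \<tau>" by blast
  qed
  then show "\<exists>f\<in>H. nrm (A f - g) = 0" using x A g by (metis H_closed(3) nrm_nonneg order_antisym symop_closed)
qed

text \<open>\<open>C\<close> is a map of its own since the factorisations used below hold only when
  tested against vectors, that is, up to null vectors.\<close>

lemma surj_op_comp:
  assumes "symop A" "symop B" "bound_op A L" "surj_op A" "surj_op B"
    and C: "\<And>x. x \<in> H \<Longrightarrow> C x \<in> H" "\<And>x z. x \<in> H \<Longrightarrow> z \<in> H \<Longrightarrow> ip (C x) z = ip (A (B x)) z"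
  shows "surj_op C"
  unfolding surj_op_def
proof
  fix g assume g: "g \<in> H"
  obtain h where h: "h \<in> H" "nrm (A h - g) = 0" using assms g by (auto simp: surj_op_def)
  obtain f where f: "f \<in> H" "nrm (B f - h) = 0" using assms h by (auto simp: surj_op_def)
  have "nrm (A (B f) - A h) = 0"
    using bound_opD[OF assms(3), of "B f - h"] nrm_symop_diff[OF assms(1), of "B f" h] f h assms
    by (metis H_closed(3) mult_zero_right nrm_nonneg order_antisym symop_closed)
  moreover have "nrm (C f - g) = nrm (A (B f) - g)"
    using assms f g by (intro nrm_cong_ip) (auto simp: ip_simps)
  ultimately have "nrm (C f - g) \<le> 0"
    using nrm_triangle_mid[of "A (B f)" "A h" g] h f g assms by simp
  then show "\<exists>f\<in>H. nrm (C f - g) = 0" using f g C by (metis H_closed(3) nrm_nonneg order_antisym)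
qed

text \<open>If the best constant \<open>s\<close> in \<open>(nrm ((T - c) x))\<^sup>2 \<ge> s (nrm x)\<^sup>2\<close> were below \<open>r\<^sup>2\<close>, then
  \<open>(T - c)\<^sup>2 - s = (T - c - \<surd>s) (T - c + \<surd>s)\<close> would be bounded below and positive, hence coercive,
  contradicting the choice of \<open>s\<close>.\<close>

lemma resolvent_interval:
  assumes T: "symop T" "bound_op T L" and r: "r > 0"
    and surj: "\<And>\<theta>. c - r < \<theta> \<Longrightarrow> \<theta> < c + r \<Longrightarrow> surj_op (shift T \<theta>)" and x: "x \<in> H"
  shows "r * nrm x \<le> nrm (shift T c x)"
proof -
  let ?T = "shift T c"
  have T': "symop ?T" "bound_op ?T (L + \<bar>c\<bar>)" using T by (simp_all add: symop_shift bound_op_shift)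
  define S where "S = {s. \<forall>x\<in>H. s * (nrm x)\<^sup>2 \<le> (nrm (?T x))\<^sup>2}"
  have "r\<^sup>2 \<in> S"
  proof (rule ccontr)
    assume r2: "r\<^sup>2 \<notin> S"
    have S0: "0 \<in> S" by (simp add: S_def)
    have Sb: "s \<le> r\<^sup>2" if "s \<in> S" for s
    proof (rule ccontr)
      assume "\<not> s \<le> r\<^sup>2"
      then have "r\<^sup>2 * (nrm x)\<^sup>2 \<le> s * (nrm x)\<^sup>2" if "x \<in> H" for x by (intro mult_right_mono) auto
      then show False using r2 \<open>s \<in> S\<close> by (force simp: S_def)
    qed
    define s where "s = Sup S"
    have bdd: "bdd_above S" using Sb by (rule bdd_aboveI)
    have "s \<in> S"
    proof -
      have "s * (nrm x)\<^sup>2 \<le> (nrm (?T x))\<^sup>2" if x: "x \<in> H" for x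
      proof (cases "nrm x = 0")
        case False
        then have "0 < (nrm x)\<^sup>2" by simp
        have "s \<le> (nrm (?T x))\<^sup>2 / (nrm x)\<^sup>2"
          unfolding s_def
        proof (rule cSup_least)
          show "S \<noteq> {}" using S0 by blast
          show "s \<le> (nrm (?T x))\<^sup>2 / (nrm x)\<^sup>2" if "s \<in> S" for s
            using that x \<open>0 < (nrm x)\<^sup>2\<close> by (simp add: S_def field_simps)
        qed
        then show ?thesis using \<open>0 < (nrm x)\<^sup>2\<close> by (simp add: field_simps)
      qed simp
      then show ?thesis by (simp add: S_def)
    qed
    have s0: "0 \<le> s" unfolding s_def using S0 bdd by (rule cSup_upper)
    have "s < r\<^sup>2" using Sb[OF \<open>s \<in> S\<close>] r2 \<open>s \<in> S\<close> by (metis order_le_less)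
    then have sr: "sqrt s < r" using r by (metis real_sqrt_less_mono real_sqrt_abs abs_of_pos)
    \<comment> \<open>Both shifts lie strictly within \<open>r\<close> of \<open>c\<close>, where
      surjectivity is assumed.\<close>
    let ?B = "shift T (c - sqrt s)" and ?C = "shift T (c + sqrt s)"
    have BC: "symop ?B" "symop ?C" using T by (simp_all add: symop_shift)
    have "0 \<le> sqrt s" using s0 by simp
    then have "surj_op ?B" "surj_op ?C" using sr r by (intro surj; linarith)+
    from surj_op_imp_bounded_below[OF BC(1) this(1)] surj_op_imp_bounded_below[OF BC(2) this(2)]
    obtain a b where a: "a > 0" "\<And>x. x \<in> H \<Longrightarrow> a * nrm x \<le> nrm (?B x)"
      and b: "b > 0" "\<And>x. x \<in> H \<Longrightarrow> b * nrm x \<le> nrm (?C x)" by metis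
    define A where "A = shift (\<lambda>x. ?T (?T x)) s"
    have A: "symop A" "bound_op A ((L + \<bar>c\<bar>) * (L + \<bar>c\<bar>) + \<bar>s\<bar>)"
      using symop_shift[OF symop_comp[OF T'(1)]] bound_op_shift[OF symop_comp[OF T'(1)] bound_op_comp[OF T']]
      by (simp_all add: A_def)
    define L' where "L' = (L + \<bar>c\<bar>) * (L + \<bar>c\<bar>) + \<bar>s\<bar>"
    have L': "L' > 0" using A(2) by (simp add: L'_def bound_op_def)
    have ipA: "ip (A x) x = (nrm (?T x))\<^sup>2 - s * (nrm x)\<^sup>2" if "x \<in> H" for x
      using that T' by (simp add: A_def ip_shift symop_comp nrm_power2 symopD)
    have AB: "nrm (A x) = nrm (?B (?C x))" if x: "x \<in> H" for x
    proof (rule nrm_cong_ip)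
      fix z assume z: "z \<in> H"
      have "ip (?B (?C x)) z = ip (T (T x)) z - 2 * c * ip (T x) z + (c\<^sup>2 - (sqrt s)\<^sup>2) * ip x z"
        using x z T by (simp add: shift_def ip_simps symop_linear power2_eq_square algebra_simps)
      moreover have "ip (A x) z = ip (T (T x)) z - 2 * c * ip (T x) z + (c\<^sup>2 - s) * ip x z"
        using x z T by (simp add: A_def shift_def ip_simps symop_linear power2_eq_square algebra_simps)
      ultimately show "ip (A x) z = ip (?B (?C x)) z" using s0 by simp
    qed (use A BC x in auto)
    have Ab: "a * b * nrm x \<le> nrm (A x)" if x: "x \<in> H" for x
    proof -
      have "a * (b * nrm x) \<le> a * nrm (?C x)" using a b x by (intro mult_left_mono) auto
      also have "\<dots> \<le> nrm (?B (?C x))" using a BC x by simp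
      finally show ?thesis using AB[OF x] by (simp add: mult.assoc)
    qed
    have psd: "0 \<le> ip (A x) x" if "x \<in> H" for x using \<open>s \<in> S\<close> that by (simp add: ipA S_def)
    \<comment> \<open>\<open>psd_nrm_bound\<close> turns the lower bound on \<open>nrm (A x)\<close>
      into one on \<open>ip (A x) x\<close>, and this raises the constant beyond the
      supremum.\<close>
    have "s + (a * b)\<^sup>2 / L' \<in> S"
    proof -
      have "(s + (a * b)\<^sup>2 / L') * (nrm x)\<^sup>2 \<le> (nrm (?T x))\<^sup>2" if x: "x \<in> H" for x
      proof -
        have "(a * b * nrm x)\<^sup>2 \<le> (nrm (A x))\<^sup>2" using Ab[OF x] a b x by (intro power_mono) auto
        also have "\<dots> \<le> L' * ip (A x) x" unfolding L'_def by (rule psd_nrm_bound[OF A psd x])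
        finally have "(a * b)\<^sup>2 / L' * (nrm x)\<^sup>2 \<le> ip (A x) x" using L' by (simp add: field_simps power_mult_distrib)
        then show ?thesis using ipA[OF x] by (simp add: algebra_simps)
      qed
      then show ?thesis by (simp add: S_def)
    qed
    then have "s + (a * b)\<^sup>2 / L' \<le> s" unfolding s_def using bdd by (rule cSup_upper)
    moreover have "0 < (a * b)\<^sup>2 / L'" using a b L' by simp
    ultimately show False by simp
  qed
  then have "(r * nrm x)\<^sup>2 \<le> (nrm (?T x))\<^sup>2" using x by (simp add: S_def power_mult_distrib)
  then show ?thesis by (rule power2_le_imp_le) (use T' x in simp)
qed

section \<open>Isolated points of the spectrum and the essential spectrum\<close>

definition ker :: "('v \<Rightarrow> 'v) \<Rightarrow> 'v set" where
  "ker A = {x \<in> H. nrm (A x) = 0}"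

definition orth :: "'v set \<Rightarrow> 'v set" where
  "orth K = {x \<in> H. \<forall>k\<in>K. ip x k = 0}"

definition fin_dim :: "'v set \<Rightarrow> bool" where
  "fin_dim E \<longleftrightarrow> (\<exists>B. finite B \<and> B \<subseteq> H \<and> (\<forall>f\<in>E. \<exists>c. nrm (f - (\<Sum>b\<in>B. c b *\<^sub>R b)) = 0))"

definition spec :: "('v \<Rightarrow> 'v) \<Rightarrow> real set" where
  "spec P = {l. \<not> ((\<forall>f\<in>H. nrm (shift P l f) = 0 \<longrightarrow> nrm f = 0) \<and> surj_op (shift P l))}"

definition ess :: "('v \<Rightarrow> 'v) \<Rightarrow> real set" where
  "ess P = spec P - {l \<in> spec P. (\<exists>e>0. \<forall>m\<in>spec P. \<bar>m - l\<bar> < e \<longrightarrow> m = l) \<and>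
      (\<exists>f\<in>ker (shift P l). nrm f \<noteq> 0) \<and> fin_dim (ker (shift P l))}"

definition gap :: "('v \<Rightarrow> 'v) \<Rightarrow> 'v set \<Rightarrow> real \<Rightarrow> bool" where
  "gap T K \<epsilon> \<longleftrightarrow> (\<forall>f\<in>orth K. \<epsilon> * (nrm f)\<^sup>2 \<le> ip (T f) f)"

lemma orthD: "f \<in> orth K \<Longrightarrow> f \<in> H" "f \<in> orth K \<Longrightarrow> k \<in> K \<Longrightarrow> ip f k = 0"
  by (auto simp: orth_def)

lemma kerD: "f \<in> ker A \<Longrightarrow> f \<in> H" "f \<in> ker A \<Longrightarrow> symop A \<Longrightarrow> z \<in> H \<Longrightarrow> ip (A f) z = 0"
  by (auto simp: ker_def null_ip)

lemma ker_iff: "symop A \<Longrightarrow> f \<in> ker A \<longleftrightarrow> f \<in> H \<and> (\<forall>z\<in>H. ip (A f) z = 0)"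
  by (auto simp: ker_def null_iff)

lemma subspace_ker:
  assumes "symop A"
  shows "subspace (ker A)"
  using assms by (auto simp: subspace_def ker_iff symop_linear symopD ip_zero)

lemma subspace_orth: "K \<subseteq> H \<Longrightarrow> subspace (orth K)"
  by (auto simp: subspace_def orth_def ip_simps subset_iff)

lemma nrm_square_add_le:
  assumes "x \<in> H" "y \<in> H"
  shows "(nrm (x + y))\<^sup>2 \<le> 2 * (nrm x)\<^sup>2 + 2 * (nrm y)\<^sup>2"
proof -
  have "0 \<le> ip (x - y) (x - y)" using assms by (simp add: ip_nonneg)
  then show ?thesis using assms by (simp add: nrm_power2 ip_simps ip_sym[of y x])
qed

lemma psd_form_add_le:
  assumes "symop A" "x \<in> H" "y \<in> H" and psd: "\<And>x. x \<in> H \<Longrightarrow> 0 \<le> ip (A x) x"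
  shows "ip (A (x + y)) (x + y) \<le> 2 * ip (A x) x + 2 * ip (A y) y"
    and "ip (A (x - y)) (x - y) \<le> 2 * ip (A x) x + 2 * ip (A y) y"
proof -
  have "ip (A y) x = ip (A x) y" using assms by (metis symopD ip_sym symop_closed)
  then show "ip (A (x + y)) (x + y) \<le> 2 * ip (A x) x + 2 * ip (A y) y"
    "ip (A (x - y)) (x - y) \<le> 2 * ip (A x) x + 2 * ip (A y) y"
    using psd[of "x - y"] psd[of "x + y"] assms(1-3) by (simp_all add: ip_simps symop_linear)
qed

text \<open>The square \<open>A\<close> of \<open>T\<close> is positive and has no spectrum strictly
  between 0 and \<gamma>, which yields coercivity with constant \<gamma> on the range of
  \<open>A\<close>. It remains to reach a vector \<open>f\<close> orthogonal to the kernel from that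
  range: solving \<open>(A + \<eta> n) (h n) = f\<close>, the remainders \<open>f - A (h n)\<close>
  converge to the kernel component of \<open>f\<close>, which is null.\<close>

lemma isolated_kernel_gap:
  assumes T: "symop T" "bound_op T L" and e: "e > 0"
    and surj: "\<And>\<theta>. 0 < \<bar>\<theta>\<bar> \<Longrightarrow> \<bar>\<theta>\<bar> < e \<Longrightarrow> surj_op (shift T \<theta>)"
    and f: "f \<in> orth (ker T)"
  shows "e * nrm f \<le> nrm (T f)"
proof -
  have fH: "f \<in> H" using f by (simp add: orth_def)
  define A where "A x = T (T x)" for x
  have A: "symop A" "bound_op A (L * L)"
    unfolding A_def using T by (auto intro: symop_comp bound_op_comp)
  have ipA: "ip (A x) x = (nrm (T x))\<^sup>2" if "x \<in> H" for x
    using that T by (simp add: A_def nrm_power2 symopD)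
  have psd: "0 \<le> ip (A x) x" if "x \<in> H" for x using ipA[OF that] by simp
  define \<gamma> where "\<gamma> = e\<^sup>2"
  have \<gamma>: "0 < \<gamma>" using e by (simp add: \<gamma>_def)
  \<comment> \<open>The shifted square factors into \<open>T\<close> shifted by the two square roots
    of \<theta>.\<close>
  have "surj_op (shift A \<theta>)" if \<theta>: "0 < \<theta>" "\<theta> < \<gamma>" for \<theta>
  proof (rule surj_op_comp)
    have "sqrt \<theta> < e" using \<theta> e by (intro real_less_lsqrt) (auto simp: \<gamma>_def)
    then show "surj_op (shift T (sqrt \<theta>))" "surj_op (shift T (- sqrt \<theta>))"
      using \<theta> by (auto intro!: surj)
    fix x assume "x \<in> H"
    then show "shift A \<theta> x \<in> H" using A by (simp add: symop_shift)
    fix z assume "z \<in> H"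
    then show "ip (shift A \<theta> x) z = ip (shift T (sqrt \<theta>) (shift T (- sqrt \<theta>) x)) z"
      using \<open>x \<in> H\<close> T \<theta> by (simp add: A_def shift_def ip_simps symop_linear algebra_simps flip: mult.assoc)
  qed (use T in \<open>auto intro: symop_shift bound_op_shift\<close>)
  \<comment> \<open>The free interval from 0 to \<gamma> has midpoint and radius
    \<open>\<gamma> / 2\<close>. Squaring the resulting bound cancels the \<open>x\<close> terms and
    leaves the inequality \<open>lower\<close>.\<close>
  then have "\<gamma> / 2 * nrm x \<le> nrm (shift A (\<gamma> / 2) x)" if "x \<in> H" for x
    using \<gamma> A that by (intro resolvent_interval) auto
  then have lower: "\<gamma> * ip (A x) x \<le> (nrm (A x))\<^sup>2" if x: "x \<in> H" for x
  proof -
    have "(\<gamma> / 2 * nrm x)\<^sup>2 \<le> (nrm (shift A (\<gamma> / 2) x))\<^sup>2"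
      using \<gamma> x \<open>\<And>x. x \<in> H \<Longrightarrow> \<gamma> / 2 * nrm x \<le> nrm (shift A (\<gamma> / 2) x)\<close> by (intro power_mono) auto
    moreover have "(nrm (shift A (\<gamma> / 2) x))\<^sup>2 = (nrm (A x))\<^sup>2 - \<gamma> * ip (A x) x + (\<gamma> / 2 * nrm x)\<^sup>2"
      using x A symop_shift[OF A(1)]
      by (simp add: shift_def nrm_power2 power_mult_distrib ip_simps ip_sym[of x "A x"] power2_eq_square nrm_mult_self algebra_simps)
    ultimately show ?thesis by simp
  qed
  \<comment> \<open>Cauchy-Schwarz for the form at \<open>x\<close> and \<open>A x\<close>, combined
    with \<open>lower\<close>, moves the estimate onto vectors of the form
    \<open>A x\<close>.\<close>
  have range: "\<gamma> * (nrm (A x))\<^sup>2 \<le> ip (A (A x)) (A x)" if x: "x \<in> H" for x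
  proof (cases "nrm (A x) = 0")
    case False
    then have pos: "0 < (nrm (A x))\<^sup>2" by simp
    have "((nrm (A x))\<^sup>2)\<^sup>2 \<le> ip (A x) x * ip (A (A x)) (A x)"
      using form_Cauchy_Schwarz[of A x "A x"] A x psd by (simp add: nrm_power2)
    also have "\<dots> \<le> (nrm (A x))\<^sup>2 / \<gamma> * ip (A (A x)) (A x)"
      using lower[OF x] \<gamma> psd A x by (intro mult_right_mono) (auto simp: field_simps)
    finally have "(nrm (A x))\<^sup>2 * (\<gamma> * (nrm (A x))\<^sup>2) \<le> (nrm (A x))\<^sup>2 * ip (A (A x)) (A x)"
      using \<gamma> by (simp add: field_simps power2_eq_square)
    then show ?thesis using pos by (simp add: mult_le_cancel_left)
  qed (use psd A x in simp)
  define \<eta> where "\<eta> n = (1/2::real) ^ n" for n :: nat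
  have \<eta>: "0 < \<eta> n" for n by (simp add: \<eta>_def)
  have "surj_op (shift A (- \<eta> n))" for n
  proof (rule coercive_imp_surj)
    show "\<eta> n * (nrm x)\<^sup>2 \<le> ip (shift A (- \<eta> n) x) x" if "x \<in> H" for x
      using that A psd[OF that] by (simp add: ip_shift nrm_power2)
  qed (use A \<eta> in \<open>auto intro: symop_shift bound_op_shift\<close>)
  then have "\<exists>h\<in>H. nrm (shift A (- \<eta> n) h - f) = 0" for n using fH by (simp add: surj_op_def)
  then obtain h where h [simp]: "\<And>n. h n \<in> H" and hf: "\<And>n. nrm (shift A (- \<eta> n) (h n) - f) = 0" by metis
  \<comment> \<open>Up to null vectors \<open>k n\<close> is \<open>\<eta> n *\<^sub>R h n\<close>;
    this makes \<open>A (k n)\<close> of order \<open>\<eta> n\<close>.\<close>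
  define k where "k n = f - A (h n)" for n
  have kH [simp]: "k n \<in> H" for n using fH A by (simp add: k_def)
  have kz: "ip (k n) z = \<eta> n * ip (h n) z" if "z \<in> H" for n z
    using null_ip[OF _ hf[of n] that] that fH A symop_shift[OF A(1)]
    by (simp add: k_def ip_simps shift_def)
  have k_le: "nrm (k n) \<le> nrm f" for n
  proof -
    have "(nrm (k n))\<^sup>2 = ip f (k n) - \<eta> n * ip (A (h n)) (h n)"
      using kz[of "A (h n)" n] A fH by (simp add: nrm_power2 k_def[of n] ip_simps ip_sym[of f "A (h n)"] ip_sym[of "h n" "A (h n)"])
    also have "\<dots> \<le> ip f (k n)" using psd[of "h n"] \<eta>[of n] by simp
    also have "\<dots> \<le> nrm f * nrm (k n)" using Cauchy_Schwarz[of f "k n"] fH by simp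
    finally have "nrm (k n) * nrm (k n) \<le> nrm f * nrm (k n)" by (simp add: power2_eq_square)
    then show ?thesis using fH by (metis kH mult_le_cancel_right nrm_nonneg order_le_less)
  qed
  have Ak: "nrm (A (k n)) \<le> 2 * \<eta> n * nrm f" for n
  proof -
    have "nrm (A (k n)) = nrm (\<eta> n *\<^sub>R (f - k n))"
    proof (rule nrm_cong_ip)
      fix z assume z: "z \<in> H"
      show "ip (A (k n)) z = ip (\<eta> n *\<^sub>R (f - k n)) z"
        using kz[of "A z" n] A z fH by (simp add: symopD[of A "k n" z]) (simp add: symopD ip_simps k_def)
    qed (use A fH in auto)
    also have "\<dots> \<le> \<eta> n * (nrm f + nrm (k n))"
      using \<eta>[of n] nrm_triangle_diff[OF fH kH, of n] fH by (simp add: nrm_scale)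
    also have "\<dots> \<le> \<eta> n * (nrm f + nrm f)" using \<eta>[of n] k_le[of n] by simp
    finally show ?thesis by simp
  qed
  \<comment> \<open>A difference of two remainders lies in the range of \<open>A\<close> up to a
    null vector, so coercivity there bounds it by its image, which decays geometrically.\<close>
  have step: "nrm (k (Suc n) - k n) \<le> 3 * nrm f / \<gamma> * (1/2) ^ n" for n
  proof -
    define d where "d = k (Suc n) - k n"
    have dH: "d \<in> H" by (simp add: d_def)
    have eq: "ip d z = ip (A (h n - h (Suc n))) z" if "z \<in> H" for z
      using that A by (simp add: d_def k_def ip_simps symop_linear fH)
    have nd: "nrm d = nrm (A (h n - h (Suc n)))" using dH A by (intro nrm_cong_ip eq) auto
    have "ip (A d) d = ip (A (A (h n - h (Suc n)))) (A (h n - h (Suc n)))"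
      using eq[of "A d"] eq[of "A (A (h n - h (Suc n)))"] dH A
      by (metis h H_closed(3) ip_sym symopD symop_closed)
    then have "\<gamma> * (nrm d)\<^sup>2 \<le> ip (A d) d" using range[of "h n - h (Suc n)"] nd by simp
    also have "\<dots> \<le> nrm (A d) * nrm d" using Cauchy_Schwarz[of "A d" d] dH A by simp
    finally have "(\<gamma> * nrm d) * nrm d \<le> nrm (A d) * nrm d" by (simp add: power2_eq_square)
    then have "\<gamma> * nrm d \<le> nrm (A d)" using dH A nrm_nonneg[OF dH]
      by (metis mult_le_cancel_right mult_zero_right nrm_nonneg order_le_less symop_closed)
    also have "\<dots> = nrm (A (k (Suc n)) - A (k n))" unfolding d_def using A by (simp add: nrm_symop_diff)
    also have "\<dots> \<le> 2 * \<eta> (Suc n) * nrm f + 2 * \<eta> n * nrm f"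
      using nrm_triangle_diff[of "A (k (Suc n))" "A (k n)"] Ak[of n] Ak[of "Suc n"] A by simp
    also have "\<dots> = 3 * nrm f * (1/2) ^ n" by (simp add: \<eta>_def)
    finally show ?thesis using \<gamma> by (simp add: d_def field_simps)
  qed
  have "summable (\<lambda>n. 3 * nrm f / \<gamma> * (1/2) ^ n)" by (intro summable_mult summable_geometric) simp
  then obtain l where l: "l \<in> H" "(\<lambda>n. nrm (k n - l)) \<longlonglongrightarrow> 0"
    using complete_nrm[of k "\<lambda>n. 3 * nrm f / \<gamma> * (1/2) ^ n"] step by (metis kH)
  have "nrm (A l) \<le> 0"
  proof (rule LIMSEQ_le_const)
    have "(\<lambda>n. 2 * (1/2) ^ n * nrm f) \<longlonglongrightarrow> 2 * 0 * nrm f"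
      by (intro tendsto_intros LIMSEQ_realpow_zero) auto
    from tendsto_add[OF tendsto_symop[OF A kH l] this]
    show "(\<lambda>n. nrm (A (k n) - A l) + 2 * \<eta> n * nrm f) \<longlonglongrightarrow> 0" by (simp add: \<eta>_def)
    have "nrm (A l) \<le> nrm (A (k n) - A l) + 2 * \<eta> n * nrm f" for n
      using nrm_le_diff[of "A l" "A (k n)"] nrm_minus_commute[of "A l" "A (k n)"] Ak[of n] A l by simp
    then show "\<exists>N. \<forall>n\<ge>N. nrm (A l) \<le> nrm (A (k n) - A l) + 2 * \<eta> n * nrm f" by blast
  qed
  then have Al: "nrm (A l) = 0" using A l by (metis nrm_nonneg order_antisym symop_closed)
  then have "(nrm (T l))\<^sup>2 = 0" using ipA[OF l(1)] null_ip[OF _ Al l(1)] A l by simp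
  \<comment> \<open>Being in the kernel, \<open>l\<close> is orthogonal to \<open>f\<close> and to
    every \<open>A (h n)\<close>, hence to every \<open>k n\<close> and in the limit to
    itself.\<close>
  then have "l \<in> ker T" using l by (simp add: ker_def)
  then have fl: "ip f l = 0" using f by (simp add: orth_def)
  have kl: "ip (k n) l = 0" for n
    using null_ip[OF _ Al, of "h n"] fl A l fH by (simp add: k_def ip_simps symopD ip_sym)
  have "(\<lambda>n. ip (k n) l) \<longlonglongrightarrow> ip l l" using l by (intro tendsto_ip nrm_zero_const) auto
  then have "ip l l = 0" using kl by (simp add: LIMSEQ_const_iff)
  then have l0: "nrm l = 0" by (simp add: nrm_def)
  have lim: "(\<lambda>n. nrm (A (h n) - f)) \<longlonglongrightarrow> 0"
  proof (rule Lim_null_comparison[OF _ l(2)])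
    have "nrm (A (h n) - f) \<le> nrm (k n - l)" for n
      using nrm_triangle[of "k n - l" l] l l0 nrm_minus_commute[of "A (h n)" f] A fH by (simp add: k_def[symmetric])
    then show "\<forall>\<^sub>F n in sequentially. norm (nrm (A (h n) - f)) \<le> nrm (k n - l)" using A fH by simp
  qed
  have "\<gamma> * ip f f \<le> ip (A f) f"
  proof (rule LIMSEQ_le)
    show "(\<lambda>n. \<gamma> * ip (A (h n)) (A (h n))) \<longlonglongrightarrow> \<gamma> * ip f f"
      using lim A fH by (intro tendsto_intros tendsto_ip) auto
    show "(\<lambda>n. ip (A (A (h n))) (A (h n))) \<longlonglongrightarrow> ip (A f) f"
      using lim A fH by (intro tendsto_ip tendsto_symop[OF A]) auto
    show "\<exists>N. \<forall>n\<ge>N. \<gamma> * ip (A (h n)) (A (h n)) \<le> ip (A (A (h n))) (A (h n))"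
      using range[OF h] A by (simp add: nrm_power2)
  qed
  then have "(e * nrm f)\<^sup>2 \<le> (nrm (T f))\<^sup>2" using ipA[OF fH] fH by (simp add: \<gamma>_def power_mult_distrib nrm_power2)
  then show ?thesis by (rule power2_le_imp_le) (use T fH in simp)
qed

lemma shift_shift: "shift (shift P l) \<theta> = shift P (l + \<theta>)"
  by (rule ext) (simp add: shift_def algebra_simps)

text \<open>Off the spectrum no constraint is imposed. At a discrete point the constraints are a
  spanning set of the eigenspace, and \<open>isolated_kernel_gap\<close> gives the bound on its
  complement.\<close>

lemma not_ess_bounded_below:
  assumes P: "symop P" "bound_op P L" and l: "l \<notin> ess P"
  obtains K c where "finite K" "K \<subseteq> H" "c > 0" "\<And>f. f \<in> orth K \<Longrightarrow> c * nrm f \<le> nrm (shift P l f)"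
proof (cases "l \<in> spec P")
  case False
  then have "surj_op (shift P l)" by (simp add: spec_def)
  then obtain c where "c > 0" "\<And>x. x \<in> H \<Longrightarrow> c * nrm x \<le> nrm (shift P l x)"
    using surj_op_imp_bounded_below P symop_shift by metis
  then show ?thesis using that[of "{}" c] by (auto simp: orth_def)
next
  case True
  with l obtain e where e: "e > 0" "\<And>m. m \<in> spec P \<Longrightarrow> \<bar>m - l\<bar> < e \<Longrightarrow> m = l"
    and "fin_dim (ker (shift P l))" by (auto simp: ess_def)
  then obtain B where B: "finite B" "B \<subseteq> H"
    "\<And>f. f \<in> ker (shift P l) \<Longrightarrow> \<exists>c. nrm (f - (\<Sum>b\<in>B. c b *\<^sub>R b)) = 0" by (auto simp: fin_dim_def)
  have "e * nrm f \<le> nrm (shift P l f)" if f: "f \<in> orth B" for f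
  proof (rule isolated_kernel_gap)
    show "symop (shift P l)" "bound_op (shift P l) (L + \<bar>l\<bar>)"
      using P by (simp_all add: symop_shift bound_op_shift)
    show "surj_op (shift (shift P l) \<theta>)" if "0 < \<bar>\<theta>\<bar>" "\<bar>\<theta>\<bar> < e" for \<theta>
    proof -
      have "l + \<theta> \<notin> spec P" using e(2)[of "l + \<theta>"] that by auto
      then have "surj_op (shift P (l + \<theta>))" by (simp add: spec_def)
      then show ?thesis by (simp add: shift_shift)
    qed
    have fH: "f \<in> H" using f by (simp add: orth_def)
    have "ip f g = 0" if g: "g \<in> ker (shift P l)" for g
    proof -
      obtain c where c: "nrm (g - (\<Sum>b\<in>B. c b *\<^sub>R b)) = 0" using B(3)[OF g] by blast
      have BH: "b \<in> H" if "b \<in> B" for b using that B by blast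
      have gH: "g \<in> H" using g by (simp add: ker_def)
      have "ip f (\<Sum>b\<in>B. c b *\<^sub>R b) = (\<Sum>b\<in>B. ip f (c b *\<^sub>R b))" using BH fH by (intro ip_sum_right) auto
      also have "\<dots> = 0" using BH fH f by (intro sum.neutral) (auto simp: ip_simps orth_def)
      finally have "ip f (\<Sum>b\<in>B. c b *\<^sub>R b) = 0" .
      moreover have "ip (g - (\<Sum>b\<in>B. c b *\<^sub>R b)) f = 0" using c fH gH BH by (intro null_ip) auto
      moreover have "(\<Sum>b\<in>B. c b *\<^sub>R b) \<in> H" using BH by auto
      ultimately show ?thesis using fH gH by (simp add: ip_simps ip_sym)
    qed
    then show "f \<in> orth (ker (shift P l))" using fH by (simp add: orth_def)
  qed (rule e(1))
  then show ?thesis using that[of B e] B e by blast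
qed

text \<open>A constraint \<open>e\<close> that cannot be dropped is replaced by a kernel vector: normalised
  approximate minimisers \<open>u\<^sub>n\<close> with \<open>ip u\<^sub>n e = 1\<close> differ by vectors that satisfy all constraints,
  where the form is coercive, so they converge.\<close>

lemma gap_imp_kernel_gap:
  assumes T: "symop T" "bound_op T M" and psd: "\<And>x. x \<in> H \<Longrightarrow> 0 \<le> ip (T x) x"
    and K: "finite L" "L \<subseteq> H" "finite R" "R \<subseteq> ker T" "\<epsilon> > 0" "gap T (L \<union> R) \<epsilon>"
  shows "\<exists>K0 \<epsilon>'. finite K0 \<and> K0 \<subseteq> ker T \<and> \<epsilon>' > 0 \<and> gap T K0 \<epsilon>'"
  using K
\<comment> \<open>\<open>L\<close> holds the constraints still to be treated and \<open>R\<close>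
  the kernel vectors collected so far.\<close>
proof (induction L arbitrary: R \<epsilon> rule: finite_induct)
  case empty
  then show ?case by auto
next
  case (insert e L)
  let ?K' = "L \<union> R"
  note \<epsilon> = \<open>\<epsilon> > 0\<close>
  have eH: "e \<in> H" and LH: "L \<subseteq> H" using insert by auto
  have K'H: "?K' \<subseteq> H" using insert by (auto simp: ker_def)
  note sub = subspace_orth[OF K'H]
  show ?case
  proof (cases "\<exists>\<epsilon>'>0. gap T ?K' \<epsilon>'")
    case True
    then show ?thesis using insert.IH[of R] insert.prems LH by blast
  next
    case False
    then have small: "\<exists>f\<in>orth ?K'. ip (T f) f < \<epsilon>' * (nrm f)\<^sup>2" if "\<epsilon>' > 0" for \<epsilon>'
      using that by (force simp: gap_def not_le)
    have mem: "f \<in> orth (insert e L \<union> R)" if "f \<in> orth ?K'" "ip f e = 0" for f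
      using that by (auto simp: orth_def)
    have coer: "\<epsilon> * (nrm f)\<^sup>2 \<le> ip (T f) f" if "f \<in> orth ?K'" "ip f e = 0" for f
      using mem[OF that] insert.prems by (simp add: gap_def)
    obtain h1 where h1: "h1 \<in> orth ?K'" "ip h1 e \<noteq> 0" using small[OF \<epsilon>] coer by fastforce
    define h where "h = (1 / ip h1 e) *\<^sub>R h1"
    have h: "h \<in> orth ?K'" "ip h e = 1"
      using h1 eH sub orthD(1)[OF h1(1)] by (auto simp: h_def ip_simps subspace_scale)
    have hH: "h \<in> H" using h orthD by blast
    \<comment> \<open>The constant in \<open>(nrm f)\<^sup>2 \<le> 4 / \<epsilon> * ip (T f) f +
      a\<^sup>2 * D\<close> for \<open>f = g + a *\<^sub>R h\<close>, derived below from coercivity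
      at \<open>g\<close>.\<close>
    define D where "D = 4 * ip (T h) h / \<epsilon> + 2 * (nrm h)\<^sup>2"
    have D: "0 \<le> D" using psd[OF hH] \<epsilon> by (simp add: D_def)
    have approx: "\<exists>u\<in>orth ?K'. ip u e = 1 \<and> ip (T u) u < \<eta>" if \<eta>: "\<eta> > 0" for \<eta>
    proof -
      \<comment> \<open>The first bound lets half of \<open>(nrm f)\<^sup>2\<close> be absorbed,
        which forces \<open>ip f e \<noteq> 0\<close>; the second makes the energy of the rescaled
        vector smaller than \<eta>.\<close>
      define \<epsilon>' where "\<epsilon>' = min (\<epsilon> / 8) (\<eta> / (2 * D + 1))"
      have \<epsilon>': "\<epsilon>' > 0" using \<epsilon> \<eta> D by (simp add: \<epsilon>'_def)
      obtain f where f: "f \<in> orth ?K'" "ip (T f) f < \<epsilon>' * (nrm f)\<^sup>2" using small[OF \<epsilon>'] by blast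
      have fH: "f \<in> H" using f orthD by blast
      define a where "a = ip f e"
      define g where "g = f - a *\<^sub>R h"
      have gH: "g \<in> H" using fH hH by (simp add: g_def)
      have "g \<in> orth ?K'" using sub f h by (simp add: g_def subspace_diff subspace_scale)
      moreover have "ip g e = 0" using fH hH eH h by (simp add: g_def ip_simps a_def)
      ultimately have "\<epsilon> * (nrm g)\<^sup>2 \<le> ip (T g) g" by (rule coer)
      also have "\<dots> \<le> 2 * ip (T f) f + 2 * ip (T (a *\<^sub>R h)) (a *\<^sub>R h)"
        unfolding g_def using T fH hH psd by (intro psd_form_add_le) auto
      also have "ip (T (a *\<^sub>R h)) (a *\<^sub>R h) = a\<^sup>2 * ip (T h) h"
        using T hH by (simp add: symop_linear ip_simps power2_eq_square)
      finally have g2: "(nrm g)\<^sup>2 \<le> (2 * ip (T f) f + 2 * (a\<^sup>2 * ip (T h) h)) / \<epsilon>"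
        using \<epsilon> by (simp add: field_simps)
      have "f = g + a *\<^sub>R h" by (simp add: g_def)
      then have "(nrm f)\<^sup>2 \<le> 2 * (nrm g)\<^sup>2 + 2 * (a\<^sup>2 * (nrm h)\<^sup>2)"
        using nrm_square_add_le[of g "a *\<^sub>R h"] gH hH by (simp add: nrm_scale power_mult_distrib)
      also have "\<dots> \<le> 2 * ((2 * ip (T f) f + 2 * (a\<^sup>2 * ip (T h) h)) / \<epsilon>) + 2 * (a\<^sup>2 * (nrm h)\<^sup>2)"
        by (intro add_right_mono mult_left_mono g2) simp
      also have "\<dots> = 4 / \<epsilon> * ip (T f) f + a\<^sup>2 * D" using \<epsilon> by (simp add: D_def field_simps)
      also have "\<dots> \<le> 4 / \<epsilon> * (\<epsilon> / 8 * (nrm f)\<^sup>2) + a\<^sup>2 * D"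
      proof -
        have "\<epsilon>' * (nrm f)\<^sup>2 \<le> \<epsilon> / 8 * (nrm f)\<^sup>2" unfolding \<epsilon>'_def by (intro mult_right_mono min.cobounded1) simp
        then have "ip (T f) f \<le> \<epsilon> / 8 * (nrm f)\<^sup>2" using f by simp
        then show ?thesis using \<epsilon> by (intro add_right_mono mult_left_mono) auto
      qed
      finally have nf: "(nrm f)\<^sup>2 \<le> 2 * D * a\<^sup>2" using \<epsilon> by (simp add: algebra_simps)
      have a0: "a \<noteq> 0" using nf f(2) psd[OF fH] by (cases "a = 0") auto
      define u where "u = (1 / a) *\<^sub>R f"
      have "ip (T u) u = ip (T f) f / a\<^sup>2"
        using T fH by (simp add: u_def symop_linear ip_simps power2_eq_square)
      also have "\<dots> < \<epsilon>' * (nrm f)\<^sup>2 / a\<^sup>2" using f(2) a0 by (simp add: divide_strict_right_mono)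
      also have "\<dots> \<le> \<epsilon>' * (2 * D * a\<^sup>2) / a\<^sup>2"
        using nf \<epsilon>' by (intro divide_right_mono mult_left_mono) auto
      also have "\<dots> = \<epsilon>' * (2 * D)" using a0 by simp
      also have "\<dots> \<le> \<eta> / (2 * D + 1) * (2 * D + 1)"
        using \<epsilon>' D \<eta> by (intro mult_mono) (auto simp: \<epsilon>'_def)
      also have "\<dots> = \<eta>" using D by simp
      finally have "ip (T u) u < \<eta>" .
      moreover have "u \<in> orth ?K'" using sub f by (simp add: u_def subspace_scale)
      moreover have "ip u e = 1" using fH eH a0 by (simp add: u_def ip_simps a_def)
      ultimately show ?thesis by blast
    qed
    \<comment> \<open>Energies of order \<open>(1/4) ^ n\<close> give increments of order
      \<open>(1/2) ^ n\<close>, hence a convergent sequence.\<close>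
    have "\<exists>u\<in>orth ?K'. ip u e = 1 \<and> ip (T u) u < \<epsilon> * (1/4) ^ n" for n :: nat
      using \<epsilon> by (intro approx) simp
    then obtain u where u: "\<And>n::nat. u n \<in> orth ?K'" "\<And>n. ip (u n) e = 1"
      and uT: "\<And>n. ip (T (u n)) (u n) < \<epsilon> * (1/4) ^ n" by metis
    have uH [simp]: "u n \<in> H" for n using u orthD by blast
    have "nrm (u (Suc n) - u n) \<le> 2 * (1/2) ^ n" for n
    proof (rule power2_le_imp_le)
      have "\<epsilon> * (nrm (u (Suc n) - u n))\<^sup>2 \<le> ip (T (u (Suc n) - u n)) (u (Suc n) - u n)"
        using u sub eH by (intro coer) (auto simp: subspace_diff ip_simps)
      also have "\<dots> \<le> 2 * ip (T (u (Suc n))) (u (Suc n)) + 2 * ip (T (u n)) (u n)"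
        using T psd by (intro psd_form_add_le) auto
      also have "\<dots> \<le> 2 * (\<epsilon> * (1/4) ^ Suc n) + 2 * (\<epsilon> * (1/4) ^ n)"
        using uT[of n] uT[of "Suc n"] by linarith
      also have "\<dots> \<le> \<epsilon> * (4 * (1/4) ^ n)" using \<epsilon> by simp
      finally have "(nrm (u (Suc n) - u n))\<^sup>2 \<le> 4 * (1/4) ^ n" using \<epsilon> by (simp only: mult_le_cancel_left_pos)
      also have "4 * (1/4) ^ n = (2 * (1/2::real) ^ n)\<^sup>2"
        by (simp add: power_mult_distrib power2_eq_square flip: power_mult_distrib)
      finally show "(nrm (u (Suc n) - u n))\<^sup>2 \<le> (2 * (1/2) ^ n)\<^sup>2" .
    qed simp
    moreover have "summable (\<lambda>n. 2 * (1/2::real) ^ n)" by (intro summable_mult summable_geometric) simp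
    ultimately obtain v where v: "v \<in> H" "(\<lambda>n. nrm (u n - v)) \<longlonglongrightarrow> 0"
      using complete_nrm[of u "\<lambda>n. 2 * (1/2) ^ n"] by (metis uH)
    have lim: "(\<lambda>n. ip (u n) z) \<longlonglongrightarrow> ip v z" if "z \<in> H" for z
      using that v by (intro tendsto_ip nrm_zero_const) auto
    have "ip v e = 1" using lim[OF eH] u by (simp add: LIMSEQ_const_iff)
    have vK: "v \<in> orth ?K'"
    proof -
      have "ip v k = 0" if "k \<in> ?K'" for k
        using lim[OF subsetD[OF K'H that]] orthD(2)[OF u(1) that] by (simp add: LIMSEQ_const_iff)
      then show ?thesis using v by (simp add: orth_def)
    qed
    have "ip (T v) v \<le> 0"
    proof (rule LIMSEQ_le)
      show "(\<lambda>n. ip (T (u n)) (u n)) \<longlonglongrightarrow> ip (T v) v"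
        using v T by (intro tendsto_ip tendsto_symop[OF T]) auto
      have "(\<lambda>n. \<epsilon> * (1/4) ^ n) \<longlonglongrightarrow> \<epsilon> * 0"
        by (intro tendsto_intros LIMSEQ_realpow_zero) auto
      then show "(\<lambda>n. \<epsilon> * (1/4) ^ n) \<longlonglongrightarrow> 0" by simp
      show "\<exists>N. \<forall>n\<ge>N. ip (T (u n)) (u n) \<le> \<epsilon> * (1/4) ^ n" using uT by (metis less_imp_le)
    qed
    then have Tv: "ip (T v) v = 0" using psd[OF v(1)] by simp
    then have "nrm (T v) = 0" using psd_nrm_bound[OF T psd v(1)] by simp
    then have vker: "v \<in> ker T" using v by (simp add: ker_def)
    \<comment> \<open>Subtracting \<open>ip f e\<close> times \<open>v\<close> restores the
      constraint \<open>e\<close>. The form does not change, as \<open>v\<close> is in the kernel,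
      and the norm does not drop below that of \<open>f\<close>, as \<open>f\<close> is orthogonal
      to \<open>v\<close>.\<close>
    have "gap T (L \<union> insert v R) \<epsilon>"
      unfolding gap_def
    proof
      fix f assume f: "f \<in> orth (L \<union> insert v R)"
      then have fK: "f \<in> orth ?K'" and fv: "ip f v = 0" and fH: "f \<in> H" by (auto simp: orth_def)
      define a where "a = ip f e"
      define g where "g = f - a *\<^sub>R v"
      have "ip (T f) v = 0" using kerD(2)[OF vker T(1) fH] T fH v by (metis symopD ip_sym symop_closed)
      then have "ip (T g) g = ip (T f) f"
        using T fH v kerD(2)[OF vker T(1) fH] Tv by (simp add: g_def symop_linear ip_simps)
      moreover have "\<epsilon> * (nrm g)\<^sup>2 \<le> ip (T g) g"
        using sub fK vK \<open>ip v e = 1\<close> fH eH v by (intro coer) (auto simp: g_def subspace_diff subspace_scale ip_simps a_def)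
      moreover have "(nrm g)\<^sup>2 = (nrm f)\<^sup>2 + a\<^sup>2 * (nrm v)\<^sup>2"
        using fH v fv by (simp add: g_def nrm_power2 nrm_mult_self ip_simps ip_sym[of v f] power2_eq_square)
      ultimately show "\<epsilon> * (nrm f)\<^sup>2 \<le> ip (T f) f" using \<epsilon> by (smt (verit) mult_left_mono mult_nonneg_nonneg zero_le_power2)
    qed
    then show ?thesis using insert.IH[of "insert v R" \<epsilon>] LH insert.prems vker by auto
  qed
qed

section \<open>Orthonormal sets, projections and the bottom of the essential spectrum\<close>

definition orthonormal :: "'v set \<Rightarrow> bool" where
  "orthonormal U \<longleftrightarrow> (\<forall>u\<in>U. \<forall>v\<in>U. ip u v = (if u = v then 1 else 0))"

definition proj :: "'v set \<Rightarrow> 'v \<Rightarrow> 'v" where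
  "proj U f = (\<Sum>u\<in>U. ip f u *\<^sub>R u)"

lemma proj_closed: "U \<subseteq> V \<Longrightarrow> subspace V \<Longrightarrow> proj U f \<in> V"
  unfolding proj_def by (intro subspace_sum subspace_scale) auto

lemma proj_H [simp]: "U \<subseteq> H \<Longrightarrow> proj U f \<in> H"
  using proj_closed subspace_H by blast

lemma ip_proj: "U \<subseteq> H \<Longrightarrow> z \<in> H \<Longrightarrow> ip (proj U f) z = (\<Sum>u\<in>U. ip f u * ip u z)"
  unfolding proj_def by (subst ip_sum_left) (auto intro!: sum.cong simp: ip_scale_left subset_iff)

lemma ip_proj_basis:
  assumes "finite U" "U \<subseteq> H" "orthonormal U" "u \<in> U"
  shows "ip (proj U f) u = ip f u"
proof -
  have "ip (proj U f) u = (\<Sum>v\<in>U. ip f v * ip v u)" using assms by (intro ip_proj) auto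
  also have "\<dots> = (\<Sum>v\<in>U. if u = v then ip f u else 0)"
    using assms(3,4) by (intro sum.cong) (auto simp: orthonormal_def)
  finally show ?thesis using assms by simp
qed

lemma diff_proj_orth:
  assumes "finite U" "U \<subseteq> H" "orthonormal U" "f \<in> H"
  shows "f - proj U f \<in> orth U"
proof -
  have "ip (f - proj U f) u = 0" if "u \<in> U" for u
    using assms that ip_proj_basis[OF assms(1-3) that] by (simp add: ip_diff_left subset_iff)
  then show ?thesis using assms by (simp add: orth_def)
qed

text \<open>The construction stays inside a subspace \<open>V\<close> so that, applied to
  \<open>ker T\<close>, it returns kernel vectors. A vector whose remainder is null contributes
  nothing new to the constraints.\<close>

lemma Gram_Schmidt:
  assumes V: "subspace V" "V \<subseteq> H" and K: "finite K" "K \<subseteq> V"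
  obtains U where "finite U" "U \<subseteq> V" "orthonormal U" "orth U \<subseteq> orth K"
proof -
  have "\<exists>U. finite U \<and> U \<subseteq> V \<and> orthonormal U \<and> orth U \<subseteq> orth K"
    using K
  proof (induction K rule: finite_induct)
    case empty
    then show ?case by (intro exI[of _ "{}"]) (auto simp: orthonormal_def)
  next
    case (insert k K)
    then obtain U where U: "finite U" "U \<subseteq> V" "orthonormal U" "orth U \<subseteq> orth K" by auto
    define d where "d = k - proj U k"
    have kV: "k \<in> V" using insert by simp
    have dV: "d \<in> V" using V U kV by (simp add: d_def subspace_diff proj_closed)
    have UH: "U \<subseteq> H" "k \<in> H" "d \<in> H" using U V kV dV by auto
    have dU: "d \<in> orth U" unfolding d_def using U UH by (intro diff_proj_orth) auto
    have fk: "ip f k = ip f d" if f: "f \<in> orth U" for f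
    proof -
      have fH: "f \<in> H" using f orthD by blast
      have "ip f (proj U k) = ip (proj U k) f" using UH fH by (intro ip_sym) auto
      also have "\<dots> = (\<Sum>u\<in>U. ip k u * ip u f)" using UH fH by (intro ip_proj)
      also have "\<dots> = 0"
      proof (rule sum.neutral, rule ballI)
        fix u assume "u \<in> U"
        then have "ip u f = 0" using f fH UH by (metis orthD(2) ip_sym subset_iff)
        then show "ip k u * ip u f = 0" by simp
      qed
      finally show ?thesis using UH fH by (simp add: d_def ip_simps)
    qed
    show ?case
    proof (cases "nrm d = 0")
      case True
      have "ip f k = 0" if "f \<in> orth U" for f
        using fk[OF that] null_ip[OF UH(3) True] orthD(1)[OF that] UH(3) by (metis ip_sym)
      then have "orth U \<subseteq> orth (insert k K)" using U by (auto simp: orth_def)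
      then show ?thesis using U by blast
    next
      case False
      define e where "e = (1 / nrm d) *\<^sub>R d"
      have eV: "e \<in> V" using V dV by (simp add: e_def subspace_scale)
      have ee: "ip e e = 1" using False UH by (simp add: e_def ip_simps nrm_mult_self[symmetric, of d])
      have eU: "ip e u = 0" "ip u e = 0" if "u \<in> U" for u
        using orthD(2)[OF dU that] that UH by (auto simp: e_def ip_simps subset_iff ip_sym[of u d])
      have "e \<notin> U" using eU ee by fastforce
      then have "orthonormal (insert e U)" using U(3) ee eU by (auto simp: orthonormal_def)
      moreover have "orth (insert e U) \<subseteq> orth (insert k K)"
      proof
        fix f assume f: "f \<in> orth (insert e U)"
        then have fU: "f \<in> orth U" "f \<in> H" "ip f e = 0" by (auto simp: orth_def)
        have "ip f k = 0" using fk[OF fU(1)] fU False UH by (simp add: e_def ip_simps)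
        then show "f \<in> orth (insert k K)" using U(4) fU by (auto simp: orth_def)
      qed
      ultimately show ?thesis using U eV by (intro exI[of _ "insert e U"]) auto
    qed
  qed
  then show ?thesis using that by blast
qed

lemma infinite_dim_orth:
  assumes "\<not> fin_dim H" "finite K" "K \<subseteq> H"
  obtains f where "f \<in> orth K" "nrm f \<noteq> 0"
proof -
  obtain U where U: "finite U" "U \<subseteq> H" "orthonormal U" "orth U \<subseteq> orth K"
    using Gram_Schmidt[OF subspace_H order_refl assms(2,3)] by blast
  have "\<exists>f\<in>orth U. nrm f \<noteq> 0"
  proof (rule ccontr)
    assume "\<not> ?thesis"
    then have "nrm (f - proj U f) = 0" if "f \<in> H" for f using diff_proj_orth U that by blast
    then have "fin_dim H" unfolding fin_dim_def proj_def using U by blast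
    then show False using assms by simp
  qed
  then show ?thesis using that U by blast
qed

lemma coercive_imp_regular:
  assumes A: "symop A" "bound_op A L" and m: "m > 0" "\<And>x. x \<in> H \<Longrightarrow> m * (nrm x)\<^sup>2 \<le> ip (A x) x"
  shows "surj_op A" and "f \<in> H \<Longrightarrow> nrm (A f) = 0 \<Longrightarrow> nrm f = 0"
proof -
  show "surj_op A" using assms by (rule coercive_imp_surj)
  show "nrm f = 0" if f: "f \<in> H" "nrm (A f) = 0"
  proof -
    have "m * (nrm f)\<^sup>2 \<le> 0" using m(2)[OF f(1)] null_ip[OF _ f(2) f(1)] A f by simp
    then show ?thesis using m(1) by (simp add: mult_le_0_iff)
  qed
qed

text \<open>Adding \<epsilon> times the projection onto \<open>U\<close> lifts the kernel directions
  to \<epsilon>, so \<open>T'\<close> is coercive everywhere with that constant and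
  \<open>T' - \<theta>\<close> is onto. Since \<open>T\<close> and \<open>T'\<close> differ only
  along \<open>U\<close>, where they act as scalars, a change of the right-hand side along
  \<open>U\<close> transfers the solution.\<close>

lemma kernel_gap_resolvent:
  assumes T: "symop T" "bound_op T L" and psd: "\<And>x. x \<in> H \<Longrightarrow> 0 \<le> ip (T x) x"
    and U: "finite U" "U \<subseteq> ker T" "orthonormal U" and \<epsilon>: "\<epsilon> > 0" "gap T U \<epsilon>"
    and \<theta>: "\<theta> \<noteq> 0" "\<theta> < \<epsilon>"
  shows "surj_op (shift T \<theta>)" and "f \<in> H \<Longrightarrow> nrm (shift T \<theta> f) = 0 \<Longrightarrow> nrm f = 0"
proof -
  have UH: "U \<subseteq> H" using U kerD by blast
  have Tu: "ip (T u) z = 0" "ip (T z) u = 0" if "u \<in> U" "z \<in> H" for u z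
    using kerD(2)[of u T z] that U T by (auto simp: symopD[of T z u] ip_sym[of z "T u"] kerD subset_iff)
  show "nrm f = 0" if f: "f \<in> H" "nrm (shift T \<theta> f) = 0"
  proof -
    have fz: "ip (T f) z = \<theta> * ip f z" if "z \<in> H" for z
      using null_ip[OF _ f(2) that] f that T symop_shift[OF T(1)] by (simp add: ip_shift)
    have "ip f u = 0" if "u \<in> U" for u
      using fz[of u] Tu(2)[OF that f(1)] \<theta> that UH by auto
    then have "f \<in> orth U" using f by (simp add: orth_def)
    then have "\<epsilon> * (nrm f)\<^sup>2 \<le> ip (T f) f" using \<epsilon> by (simp add: gap_def)
    also have "\<dots> = \<theta> * (nrm f)\<^sup>2" using fz[OF f(1)] f by (simp add: nrm_power2)
    finally have "\<epsilon> * (nrm f)\<^sup>2 \<le> \<theta> * (nrm f)\<^sup>2" .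
    then show ?thesis using \<theta> by (metis mult_le_cancel_right not_le order_le_less power2_less_0 zero_less_power2)
  qed
  define T' where "T' x = T x + \<epsilon> *\<^sub>R proj U x" for x
  have T': "symop T'" unfolding symop_def
  proof (intro conjI ballI)
    fix x y assume xy: "x \<in> H" "y \<in> H"
    have "ip (proj U x) y = ip x (proj U y)"
      using xy UH by (simp add: ip_proj ip_sym[of x "proj U y"]) (intro sum.cong; auto simp: ip_sym subset_iff)
    then show "ip (T' x) y = ip x (T' y)" using xy T UH by (simp add: T'_def ip_simps symopD)
  qed (use T UH in \<open>simp add: T'_def\<close>)
  have nproj: "nrm (proj U x) \<le> nrm x" if x: "x \<in> H" for x
  proof -
    have "ip (x - proj U x) (proj U x) = (\<Sum>u\<in>U. ip x u * ip u (x - proj U x))"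
      using x UH ip_proj[OF UH, of "x - proj U x" x] by (simp add: ip_sym)
    also have "\<dots> = 0"
    proof (rule sum.neutral, rule ballI)
      fix u assume "u \<in> U"
      then have "ip u (x - proj U x) = 0"
        using diff_proj_orth[OF U(1) UH U(3) x] UH x by (metis orthD ip_sym subset_iff)
      then show "ip x u * ip u (x - proj U x) = 0" by simp
    qed
    finally have "(nrm (proj U x))\<^sup>2 = ip x (proj U x)" using x UH by (simp add: ip_simps nrm_power2)
    also have "\<dots> \<le> nrm x * nrm (proj U x)" using Cauchy_Schwarz[of x "proj U x"] x UH by simp
    finally show ?thesis using x UH
      by (metis mult_le_cancel_right nrm_nonneg order_le_less power2_eq_square proj_H)
  qed
  have T'b: "bound_op T' (L + \<epsilon>)"
  proof -
    have "nrm (T' x) \<le> (L + \<epsilon>) * nrm x" if x: "x \<in> H" for x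
    proof -
      have "nrm (T' x) \<le> nrm (T x) + \<epsilon> * nrm (proj U x)"
        using nrm_triangle[of "T x" "\<epsilon> *\<^sub>R proj U x"] x UH T \<epsilon> by (simp add: T'_def nrm_scale)
      also have "\<dots> \<le> L * nrm x + \<epsilon> * nrm x"
        using bound_opD[OF T(2) x] nproj[OF x] \<epsilon> by (intro add_mono mult_left_mono) auto
      finally show ?thesis by (simp add: algebra_simps)
    qed
    then show ?thesis using T \<epsilon> by (simp add: bound_op_def)
  qed
  have coer: "(\<epsilon> - \<theta>) * (nrm x)\<^sup>2 \<le> ip (shift T' \<theta> x) x" if x: "x \<in> H" for x
  proof -
    define p where "p = proj U x"
    define y where "y = x - p"
    have y: "y \<in> orth U" unfolding y_def p_def by (rule diff_proj_orth[OF U(1) UH U(3) x])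
    have pH: "p \<in> H" "y \<in> H" using x UH by (simp_all add: p_def y_def)
    have "p \<in> ker T" unfolding p_def using U subspace_ker[OF T(1)] by (intro proj_closed)
    then have Tp: "ip (T p) z = 0" "ip (T z) p = 0" if "z \<in> H" for z
      using kerD(2)[of p T z] that T pH by (auto simp: symopD[of T z p] ip_sym[of z "T p"])
    have py: "ip p y = 0"
      unfolding p_def using UH pH y by (subst ip_proj) (auto intro!: sum.neutral simp: ip_sym[of _ y] orthD subset_iff)
    have xp: "x = p + y" by (simp add: y_def)
    have "ip (T x) x = ip (T y) y" unfolding xp using pH T Tp by (simp add: symop_linear ip_simps)
    moreover have "\<epsilon> * (nrm y)\<^sup>2 \<le> ip (T y) y" using y \<epsilon> by (simp add: gap_def)
    moreover have "(nrm x)\<^sup>2 = (nrm p)\<^sup>2 + (nrm y)\<^sup>2"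
      unfolding xp using pH py ip_sym[of y p] by (simp add: nrm_power2 ip_simps)
    moreover have "ip p x = (nrm p)\<^sup>2" unfolding xp using pH py by (simp add: nrm_power2 ip_simps)
    moreover have "ip (shift T' \<theta> x) x = ip (T x) x + \<epsilon> * ip p x - \<theta> * (nrm x)\<^sup>2"
      using x T UH T' by (simp add: ip_shift T'_def p_def ip_simps nrm_power2)
    ultimately show ?thesis by (simp add: algebra_simps)
  qed
  have surj': "surj_op (shift T' \<theta>)"
    by (rule coercive_imp_surj[OF symop_shift[OF T'] bound_op_shift[OF T' T'b], of "\<epsilon> - \<theta>"]) (use \<theta> coer in auto)
  show "surj_op (shift T \<theta>)"
    unfolding surj_op_def
  proof
    fix g assume g: "g \<in> H"
    \<comment> \<open>Along \<open>U\<close> the operator \<open>T' - \<theta>\<close> acts as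
      \<open>\<epsilon> - \<theta>\<close> but \<open>T - \<theta>\<close> as
      \<open>- \<theta>\<close>; this correction makes the solution have components
      \<open>- ip g u / \<theta>\<close>.\<close>
    define g' where "g' = g - (\<epsilon> / \<theta>) *\<^sub>R proj U g"
    have g'H: "g' \<in> H" using g UH by (simp add: g'_def)
    obtain f where f: "f \<in> H" "nrm (shift T' \<theta> f - g') = 0" using surj' g'H by (auto simp: surj_op_def)
    have fz: "ip (T f) z + \<epsilon> * ip (proj U f) z - \<theta> * ip f z = ip g z - \<epsilon> / \<theta> * ip (proj U g) z" if "z \<in> H" for z
      using null_ip[OF _ f(2) that] f g'H that T' T UH g symop_shift[OF T']
      by (simp add: ip_simps g'_def shift_def T'_def)
    have fu: "ip f u = - (1 / \<theta>) * ip g u" if u: "u \<in> U" for u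
    proof -
      have "(\<epsilon> - \<theta>) * ip f u = (1 - \<epsilon> / \<theta>) * ip g u"
        using fz[of u] Tu(2)[OF u f(1)] ip_proj_basis[OF U(1) UH U(3) u] u UH
        by (simp add: algebra_simps subset_iff)
      also have "\<dots> = (\<epsilon> - \<theta>) * (- (1 / \<theta>) * ip g u)" using \<theta> by (simp add: field_simps)
      finally show ?thesis using \<theta> by (simp only: mult_cancel_left) simp
    qed
    have pf: "ip (proj U f) z = - (1 / \<theta>) * ip (proj U g) z" if "z \<in> H" for z
      using that UH by (simp add: ip_proj fu sum_distrib_left sum_divide_distrib sum_negf)
    have "nrm (shift T \<theta> f) = nrm g \<and> nrm (shift T \<theta> f - g) = nrm 0"
    proof (intro conjI nrm_cong_ip)
      fix z assume z: "z \<in> H"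
      show "ip (shift T \<theta> f) z = ip g z" using fz[OF z] pf[OF z] f z T by (simp add: ip_shift)
      then show "ip (shift T \<theta> f - g) z = ip 0 z" using f z g symop_shift[OF T(1)] by (simp add: ip_simps)
    qed (use f g symop_shift[OF T(1)] in auto)
    then show "\<exists>f\<in>H. nrm (shift T \<theta> f - g) = 0" using f by (auto simp: nrm_def ip_zero)
  qed
qed

text \<open>Once the constraints are kernel vectors, every point below \<open>l + \<delta>\<close>
  other than \<open>l\<close> is regular, and \<open>l\<close> itself is either regular or an
  isolated eigenvalue whose eigenspace is spanned by \<open>U\<close>.\<close>

lemma gap_imp_ess_above:
  assumes P: "symop P" "bound_op P L" and psd: "\<And>x. x \<in> H \<Longrightarrow> 0 \<le> ip (shift P l x) x"
    and K: "finite K" "K \<subseteq> H" "\<epsilon> > 0" "gap (shift P l) K \<epsilon>"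
  obtains \<delta> where "\<delta> > 0" "\<And>m. m \<in> ess P \<Longrightarrow> l + \<delta> \<le> m"
proof -
  let ?T = "shift P l"
  have T: "symop ?T" "bound_op ?T (L + \<bar>l\<bar>)" using P by (simp_all add: symop_shift bound_op_shift)
  obtain K0 \<delta> where K0: "finite K0" "K0 \<subseteq> ker ?T" "\<delta> > 0" "gap ?T K0 \<delta>"
    using gap_imp_kernel_gap[OF T psd K(1,2), of "{}" \<epsilon>] K by auto
  obtain U where U: "finite U" "U \<subseteq> ker ?T" "orthonormal U" "orth U \<subseteq> orth K0"
    using Gram_Schmidt[OF subspace_ker[OF T(1)] _ K0(1,2)] kerD by (metis subsetI)
  have gapU: "gap ?T U \<delta>" using K0(4) U(4) by (auto simp: gap_def)
  have UH: "U \<subseteq> H" using U kerD by blast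
  have reg: "m \<notin> spec P" if "m \<noteq> l" "m < l + \<delta>" for m
    using kernel_gap_resolvent[OF T psd U(1-3) K0(3) gapU, of "m - l"] that
    by (simp add: spec_def shift_shift)
  have "l \<notin> ess P"
  proof (cases "\<exists>f\<in>ker ?T. nrm f \<noteq> 0")
    case True
    have "fin_dim (ker ?T)"
      unfolding fin_dim_def
    proof (intro exI[of _ U] conjI ballI U(1) UH)
      fix f assume f: "f \<in> ker ?T"
      define d where "d = f - proj U f"
      have "d \<in> ker ?T" unfolding d_def
        using f U subspace_ker[OF T(1)] by (intro subspace_diff proj_closed) auto
      moreover have "d \<in> orth U" unfolding d_def using f kerD U UH by (intro diff_proj_orth) auto
      ultimately have "\<delta> * (nrm d)\<^sup>2 \<le> 0" using gapU kerD T by (metis gap_def)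
      then have "nrm d = 0" using K0(3) by (simp add: mult_le_0_iff)
      then show "\<exists>c. nrm (f - (\<Sum>b\<in>U. c b *\<^sub>R b)) = 0" unfolding d_def proj_def by blast
    qed
    moreover have "\<forall>m\<in>spec P. \<bar>m - l\<bar> < \<delta> \<longrightarrow> m = l" using reg by (smt (verit))
    ultimately show ?thesis using True K0(3) unfolding ess_def by blast
  next
    case False
    \<comment> \<open>A trivial kernel contains no vector of norm 1, so the gap holds without
      constraints.\<close>
    then have "U = {}" using U by (force simp: orthonormal_def nrm_def)
    then have "\<delta> * (nrm f)\<^sup>2 \<le> ip (?T f) f" if "f \<in> H" for f using gapU that by (simp add: gap_def orth_def)
    from coercive_imp_regular[OF T K0(3) this] have "l \<notin> spec P" by (auto simp: spec_def)
    then show ?thesis by (simp add: ess_def)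
  qed
  have "l + \<delta> \<le> m" if m: "m \<in> ess P" for m
  proof (rule ccontr)
    assume "\<not> l + \<delta> \<le> m"
    moreover have "m \<noteq> l" using m \<open>l \<notin> ess P\<close> by blast
    ultimately have "m \<notin> spec P" by (intro reg) auto
    then show False using m by (simp add: ess_def)
  qed
  then show ?thesis using that K0 by blast
qed

text \<open>\<open>Inf\<close> of an empty set of reals is unspecified, so this is needed to read
  \<open>lambda_ess_bot\<close>. The witness is \<open>s\<close>, the best lower bound of the form
  on complements of finite sets: just above \<open>s\<close> there are vectors of nearly minimal
  form under any finite set of constraints, and Cauchy-Schwarz makes \<open>P f - s f\<close> small
  for them.\<close>

lemma ess_nonempty:
  assumes P: "symop P" "bound_op P L" and inf: "\<not> fin_dim H"
  shows "ess P \<noteq> {}"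
proof
  assume empty: "ess P = {}"
  define \<Lambda> where "\<Lambda> = {l. \<exists>K \<epsilon>. finite K \<and> K \<subseteq> H \<and> \<epsilon> > 0 \<and> (\<forall>f\<in>orth K. (l + \<epsilon>) * (nrm f)\<^sup>2 \<le> ip (P f) f)}"
  have \<Lambda>I: "l \<in> \<Lambda>" if "finite K" "K \<subseteq> H" "\<epsilon> > 0" "\<forall>f\<in>orth K. (l + \<epsilon>) * (nrm f)\<^sup>2 \<le> ip (P f) f" for K \<epsilon> l
    using that unfolding \<Lambda>_def by blast
  have le: "- L * (nrm f)\<^sup>2 \<le> ip (P f) f" "ip (P f) f \<le> L * (nrm f)\<^sup>2" if "f \<in> H" for f
    using form_bound[OF P that] by auto
  have "- L - 1 \<in> \<Lambda>"
    unfolding \<Lambda>_def using le by (intro CollectI exI[of _ "{}"] exI[of _ 1]) (auto simp: orth_def)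
  then have ne: "\<Lambda> \<noteq> {}" by blast
  have "l \<le> L" if l: "l \<in> \<Lambda>" for l
  proof -
    obtain K \<epsilon> where K: "finite K" "K \<subseteq> H" "\<epsilon> > 0" "\<forall>f\<in>orth K. (l + \<epsilon>) * (nrm f)\<^sup>2 \<le> ip (P f) f"
      using l unfolding \<Lambda>_def by blast
    obtain f where f: "f \<in> orth K" "nrm f \<noteq> 0" using infinite_dim_orth[OF inf K(1,2)] .
    have "(l + \<epsilon>) * (nrm f)\<^sup>2 \<le> L * (nrm f)\<^sup>2" using bspec[OF K(4) f(1)] le(2)[OF orthD(1)[OF f(1)]] by simp
    moreover have "0 < (nrm f)\<^sup>2" using f by simp
    ultimately have "l + \<epsilon> \<le> L" by (simp only: mult_le_cancel_right_pos)
    then show ?thesis using K by simp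
  qed
  then have bdd: "bdd_above \<Lambda>" by (rule bdd_aboveI)
  define s where "s = Sup \<Lambda>"
  obtain KR c where KR: "finite KR" "KR \<subseteq> H" "c > 0" "\<And>f. f \<in> orth KR \<Longrightarrow> c * nrm f \<le> nrm (shift P s f)"
    using not_ess_bounded_below[OF P, of s] empty by blast
  have L: "L > 0" using P by (simp add: bound_op_def)
  define M where "M = L + \<bar>s\<bar> + 1"
  have M: "M > 0" using L by (simp add: M_def)
  \<comment> \<open>Chosen so that \<open>\<eta> * (6 * M + 2) < c\<^sup>2\<close>, the left side
    being the final bound on the squared norm of \<open>shift P s f\<close> relative to
    \<open>f\<close>.\<close>
  define \<eta> where "\<eta> = min 1 (c\<^sup>2 / (6 * M + 3))"
  have \<eta>: "0 < \<eta>" "\<eta> \<le> 1" using M KR by (auto simp: \<eta>_def)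
  have "\<eta> * (6 * M + 2) < c\<^sup>2"
  proof -
    have "\<eta> * (6 * M + 2) < \<eta> * (6 * M + 3)" using \<eta> by (intro mult_strict_left_mono) auto
    also have "\<dots> \<le> c\<^sup>2 / (6 * M + 3) * (6 * M + 3)" using M by (intro mult_right_mono) (auto simp: \<eta>_def)
    also have "\<dots> = c\<^sup>2" using M by simp
    finally show ?thesis .
  qed
  obtain l where "l \<in> \<Lambda>" "s - \<eta> < l" using less_cSupE[of "s - \<eta>" \<Lambda>] \<eta> ne by (auto simp: s_def)
  then obtain K \<epsilon> where K: "finite K" "K \<subseteq> H" "\<epsilon> > 0" "\<forall>f\<in>orth K. (l + \<epsilon>) * (nrm f)\<^sup>2 \<le> ip (P f) f"
    unfolding \<Lambda>_def by blast
  let ?A = "shift P (s - \<eta>)"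
  have A: "symop ?A" "bound_op ?A (L + \<bar>s - \<eta>\<bar>)" using P by (simp_all add: symop_shift bound_op_shift)
  have posA: "0 \<le> ip (?A f) f" if f: "f \<in> orth K" for f
  proof -
    have "(s - \<eta>) * (nrm f)\<^sup>2 \<le> (l + \<epsilon>) * (nrm f)\<^sup>2" using \<open>s - \<eta> < l\<close> K by (intro mult_right_mono) auto
    then show ?thesis using bspec[OF K(4) f] orthD(1)[OF f] P by (simp add: ip_shift nrm_power2)
  qed
  have "s + \<eta> \<notin> \<Lambda>" using cSup_upper[OF _ bdd, of "s + \<eta>"] \<eta> by (auto simp: s_def)
  moreover have "finite (K \<union> P ` K \<union> KR)" "K \<union> P ` K \<union> KR \<subseteq> H" using K KR P by auto
  ultimately have "\<not> (\<forall>f\<in>orth (K \<union> P ` K \<union> KR). (s + \<eta> + \<eta>) * (nrm f)\<^sup>2 \<le> ip (P f) f)"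
    using \<Lambda>I[of "K \<union> P ` K \<union> KR" \<eta> "s + \<eta>"] \<eta>(1) by blast
  then obtain f where f: "f \<in> orth (K \<union> P ` K \<union> KR)" "ip (P f) f < (s + \<eta> + \<eta>) * (nrm f)\<^sup>2"
    by (auto simp: not_le)
  have fH: "f \<in> H" and fK: "f \<in> orth K" "f \<in> orth KR" using f by (auto simp: orth_def)
  have f0: "0 < (nrm f)\<^sup>2" using f(2) le(1)[OF fH] by (cases "nrm f = 0") auto
  define u where "u = ?A f"
  have uH: "u \<in> H" using A fH by (simp add: u_def)
  have "ip u k = 0" if k: "k \<in> K" for k
  proof -
    have "k \<in> H" "ip f k = 0" "ip f (P k) = 0" using k K f by (auto simp: orth_def)
    then show ?thesis using fH P by (simp add: u_def ip_shift symopD)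
  qed
  then have uK: "u \<in> orth K" using uH by (simp add: orth_def)
  have "((nrm u)\<^sup>2)\<^sup>2 \<le> ip (?A f) f * ip (?A u) u"
    unfolding nrm_power2[OF uH] using form_Cauchy_Schwarz[OF A(1) fH uH] posA subspace_orth[OF K(2)] fK uK
    by (simp add: u_def[symmetric] subspace_add subspace_scale)
  also have "\<dots> \<le> (3 * \<eta> * (nrm f)\<^sup>2) * (M * (nrm u)\<^sup>2)"
  proof (rule mult_mono)
    show "ip (?A f) f \<le> 3 * \<eta> * (nrm f)\<^sup>2" using f(2) fH P by (simp add: ip_shift nrm_power2 algebra_simps)
    have "ip (?A u) u \<le> (L + \<bar>s - \<eta>\<bar>) * (nrm u)\<^sup>2" using form_bound[OF A uH] by simp
    also have "\<dots> \<le> M * (nrm u)\<^sup>2" using \<eta> by (intro mult_right_mono) (auto simp: M_def)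
    finally show "ip (?A u) u \<le> M * (nrm u)\<^sup>2" .
  qed (use posA uK \<eta> in auto)
  finally have "(nrm u)\<^sup>2 * (nrm u)\<^sup>2 \<le> (3 * \<eta> * M * (nrm f)\<^sup>2) * (nrm u)\<^sup>2"
    by (simp add: power2_eq_square algebra_simps)
  then have u2: "(nrm u)\<^sup>2 \<le> 3 * \<eta> * M * (nrm f)\<^sup>2"
    by (rule mult_self_le_cancel[rotated 2]) (use \<eta> M in auto)
  have "shift P s f = u + (- \<eta>) *\<^sub>R f" by (simp add: u_def shift_def algebra_simps)
  then have "(nrm (shift P s f))\<^sup>2 \<le> 2 * (nrm u)\<^sup>2 + 2 * (\<eta>\<^sup>2 * (nrm f)\<^sup>2)"
    using nrm_square_add_le[of u "(- \<eta>) *\<^sub>R f"] nrm_scale[OF fH, of "- \<eta>"] uH fH by (simp add: power_mult_distrib)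
  also have "\<dots> \<le> 2 * (3 * \<eta> * M * (nrm f)\<^sup>2) + 2 * (\<eta> * (nrm f)\<^sup>2)"
    using u2 \<eta> by (intro add_mono mult_left_mono mult_right_mono) (auto simp: power2_eq_square mult_le_cancel_left1)
  also have "\<dots> = \<eta> * (6 * M + 2) * (nrm f)\<^sup>2" by (simp add: algebra_simps)
  also have "\<dots> < c\<^sup>2 * (nrm f)\<^sup>2" using \<open>\<eta> * (6 * M + 2) < c\<^sup>2\<close> f0 by (rule mult_strict_right_mono)
  finally have "(nrm (shift P s f))\<^sup>2 < (c * nrm f)\<^sup>2" by (simp add: power_mult_distrib)
  moreover have "(c * nrm f)\<^sup>2 \<le> (nrm (shift P s f))\<^sup>2" using KR(3) KR(4)[OF fK(2)] fH by (intro power_mono) auto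
  ultimately show False by simp
qed

lemma no_gap_orthonormal_family:
  assumes T: "symop T" and nogap: "\<And>K \<epsilon>. finite K \<Longrightarrow> K \<subseteq> H \<Longrightarrow> \<epsilon> > 0 \<Longrightarrow> \<not> gap T K \<epsilon>"
    and psd: "\<And>x. x \<in> H \<Longrightarrow> 0 \<le> ip (T x) x" and \<eta>: "\<eta> > 0"
  shows "\<exists>v. (\<forall>i<N::nat. v i \<in> H \<and> ip (T (v i)) (v i) < \<eta>) \<and>
      (\<forall>i<N. \<forall>j<N. ip (v i) (v j) = (if i = j then 1 else 0))"
proof (induction N)
  case (Suc N)
  then obtain v where v: "\<And>i. i < N \<Longrightarrow> v i \<in> H" "\<And>i. i < N \<Longrightarrow> ip (T (v i)) (v i) < \<eta>"
    "\<And>i j. i < N \<Longrightarrow> j < N \<Longrightarrow> ip (v i) (v j) = (if i = j then 1 else 0)" by auto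
  have "\<not> gap T (v ` {..<N}) \<eta>" using v \<eta> by (intro nogap) auto
  then obtain f where f: "f \<in> orth (v ` {..<N})" "ip (T f) f < \<eta> * (nrm f)\<^sup>2" by (auto simp: gap_def not_le)
  have fH: "f \<in> H" using f orthD by blast
  have f0: "nrm f \<noteq> 0" using f psd[OF fH] by auto
  define u where "u = (1 / nrm f) *\<^sub>R f"
  have u: "u \<in> H" "ip u u = 1" using fH f0 by (auto simp: u_def ip_simps nrm_mult_self[symmetric, of f])
  have "ip (T u) u = ip (T f) f / (nrm f)\<^sup>2"
    using fH T by (simp add: u_def symop_linear ip_simps power2_eq_square)
  also have "\<dots> < \<eta>" using f f0 by (simp add: field_simps)
  finally have uT: "ip (T u) u < \<eta>" .
  have uv: "ip u (v i) = 0" "ip (v i) u = 0" if "i < N" for i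
    using that f fH v by (auto simp: u_def ip_simps orth_def ip_sym[of "v i" f])
  show ?case
    by (rule exI[of _ "v(N := u)"]) (use u uT uv v in \<open>auto simp: less_Suc_eq\<close>)
qed simp

text \<open>The factor \<open>2 ^ n\<close> is crude, but the number of vectors is always fixed
  before their energies are chosen.\<close>

lemma psd_form_sum_le:
  assumes T: "symop T" and psd: "\<And>x. x \<in> H \<Longrightarrow> 0 \<le> ip (T x) x" and x: "\<And>i. i < n \<Longrightarrow> x i \<in> H"
  shows "ip (T (\<Sum>i<n::nat. x i)) (\<Sum>i<n. x i) \<le> 2 ^ n * (\<Sum>i<n. ip (T (x i)) (x i))"
  using x
proof (induction n)
  case 0
  then show ?case using T by (simp add: ip_zero)
next
  case (Suc n)
  let ?S = "\<Sum>i<n. x i"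
  have S: "?S \<in> H" "x n \<in> H" using Suc.prems by auto
  have "ip (T (?S + x n)) (?S + x n) \<le> 2 * ip (T ?S) ?S + 2 * ip (T (x n)) (x n)"
    using T S psd by (intro psd_form_add_le)
  also have "\<dots> \<le> 2 * (2 ^ n * (\<Sum>i<n. ip (T (x i)) (x i))) + 2 * (2 ^ n * ip (T (x n)) (x n))"
    using Suc psd[OF S(2)] by (intro add_mono mult_left_mono) (auto simp: mult_le_cancel_right1)
  finally show ?case by (simp add: algebra_simps)
qed

end

section \<open>The space of square integrable functions\<close>

text \<open>The locales speak of a carrier inside a real vector space; the pointwise structure makes
  \<open>L2 M\<close> such a carrier.\<close>

instantiation "fun" :: (type, real_vector) real_vector
begin

definition scaleR_fun :: "real \<Rightarrow> ('a \<Rightarrow> 'b) \<Rightarrow> 'a \<Rightarrow> 'b" where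
  "scaleR_fun c f = (\<lambda>x. c *\<^sub>R f x)"

instance
  by standard (auto simp: scaleR_fun_def plus_fun_def algebra_simps)

end

lemma scaleR_fun_apply [simp]: "(c *\<^sub>R f) x = c *\<^sub>R f x"
  by (simp add: scaleR_fun_def)

lemma plus_fun_apply [simp]: "(f + g) x = f x + g x"
  by (simp add: plus_fun_def)

lemma zero_fun_apply [simp]: "0 x = 0"
  by (simp add: zero_fun_def)

lemma sum_fun_apply: "(sum f I) x = (\<Sum>i\<in>I. f i x)"
  by (induction I rule: infinite_finite_induct) auto

lemma L2D: "f \<in> L2 M \<Longrightarrow> f \<in> borel_measurable M" "f \<in> L2 M \<Longrightarrow> integrable M (\<lambda>x. (f x)\<^sup>2)"
  by (auto simp: L2_def)

lemma L2_integrable_mult: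
  assumes "f \<in> L2 M" "g \<in> L2 M"
  shows "integrable M (\<lambda>x. f x * g x)"
proof (rule Bochner_Integration.integrable_bound)
  show "integrable M (\<lambda>x. (f x)\<^sup>2 + (g x)\<^sup>2)" using assms by (auto simp: L2_def)
  show "(\<lambda>x. f x * g x) \<in> borel_measurable M" using assms by (auto simp: L2_def)
  have "\<bar>a * b\<bar> \<le> a\<^sup>2 + b\<^sup>2" for a b :: real
    using zero_le_power2[of "a + b"] zero_le_power2[of "a - b"] zero_le_power2[of a] zero_le_power2[of b]
    unfolding power2_sum power2_diff abs_le_iff by linarith
  then show "AE x in M. norm (f x * g x) \<le> norm ((f x)\<^sup>2 + (g x)\<^sup>2)"
    by (metis (mono_tags, lifting) AE_I2 abs_of_nonneg real_norm_def sum_power2_ge_zero)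
qed

lemma subspace_L2: "subspace (L2 M)"
  unfolding subspace_def
proof (intro conjI ballI allI)
  show "0 \<in> L2 M" by (simp add: L2_def zero_fun_def)
  fix f g :: "'a \<Rightarrow> real" and c :: real assume f: "f \<in> L2 M"
  then show "c *\<^sub>R f \<in> L2 M" by (auto simp: L2_def scaleR_fun_def power_mult_distrib)
  assume g: "g \<in> L2 M"
  have "integrable M (\<lambda>x. (f x)\<^sup>2 + 2 * (f x * g x) + (g x)\<^sup>2)"
    using L2_integrable_mult[OF f g] L2D[OF f] L2D[OF g] by auto
  then have "integrable M (\<lambda>x. (f x + g x)\<^sup>2)" by (simp add: power2_sum algebra_simps)
  then show "f + g \<in> L2 M" using f g by (auto simp: L2_def plus_fun_def)
qed

lemma semi_inner_L2: "semi_inner (L2 M) (L2_inner M)"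
proof
  fix f g h :: "'a \<Rightarrow> real" and c :: real
  show "subspace (L2 M)" by (rule subspace_L2)
  show "L2_inner M f g = L2_inner M g f" by (simp add: L2_inner_def mult.commute)
  show "0 \<le> L2_inner M f f" by (simp add: L2_inner_def)
  assume f: "f \<in> L2 M" and h: "h \<in> L2 M"
  show "L2_inner M (c *\<^sub>R f) h = c * L2_inner M f h" by (simp add: L2_inner_def mult.assoc)
  assume g: "g \<in> L2 M"
  show "L2_inner M (f + g) h = L2_inner M f h + L2_inner M g h"
    using L2_integrable_mult[OF f h] L2_integrable_mult[OF g h] by (simp add: L2_inner_def distrib_right)
qed

text \<open>The L^1 norm is at most the L^2 norm because the variance of |f| is nonnegative.\<close>

lemma (in prob_space) expectation_abs_le:
  assumes "f \<in> L2 M"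
  shows "integrable M f" "(\<integral>x. \<bar>f x\<bar> \<partial>M) \<le> sqrt (\<integral>x. f x * f x \<partial>M)"
proof -
  have "(\<lambda>_. 1) \<in> L2 M" by (simp add: L2_def)
  from L2_integrable_mult[OF assms this] show f: "integrable M f" by simp
  have "variance (\<lambda>x. \<bar>f x\<bar>) = expectation (\<lambda>x. \<bar>f x\<bar>\<^sup>2) - (expectation (\<lambda>x. \<bar>f x\<bar>))\<^sup>2"
    using f assms by (intro variance_eq) (auto simp: L2_def)
  then have "(expectation (\<lambda>x. \<bar>f x\<bar>))\<^sup>2 \<le> expectation (\<lambda>x. f x * f x)"
    using variance_positive[of "\<lambda>x. \<bar>f x\<bar>"] by (simp add: power2_eq_square)
  then show "(\<integral>x. \<bar>f x\<bar> \<partial>M) \<le> sqrt (\<integral>x. f x * f x \<partial>M)" by (rule real_le_rsqrt)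
qed

text \<open>Summable L^2 increments are summable in L^1, so the telescoping series converges
  absolutely almost everywhere. Fatou's lemma then bounds the L^2 distance to the pointwise limit by
  the tail of the series.\<close>

lemma (in prob_space) L2_complete:
  assumes X: "\<And>n::nat. X n \<in> L2 M"
    and summ: "summable (\<lambda>n. semi_inner.nrm (L2_inner M) (X (Suc n) - X n))"
  shows "\<exists>f\<in>L2 M. (\<lambda>n. semi_inner.nrm (L2_inner M) (X n - f)) \<longlonglongrightarrow> 0"
proof -
  interpret semi_inner "L2 M" "L2_inner M" by (rule semi_inner_L2)
  have n2: "(nrm g)\<^sup>2 = (\<integral>x. (g x)\<^sup>2 \<partial>M)" if "g \<in> L2 M" for g
    using nrm_power2[OF that] by (simp add: L2_inner_def power2_eq_square)
  define a where "a n = nrm (X (Suc n) - X n)" for n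
  have a: "summable a" using summ by (simp add: a_def[abs_def])
  have a0: "0 \<le> a n" for n using X by (simp add: a_def)
  define d where "d n x = \<bar>X (Suc n) x - X n x\<bar>" for n x
  have Xm [measurable]: "X n \<in> borel_measurable M" for n using X L2D by blast
  have d_int: "integrable M (d n)" "(\<integral>x. d n x \<partial>M) \<le> a n" for n
  proof -
    have "X (Suc n) - X n \<in> L2 M" using X by simp
    from expectation_abs_le[OF this] show "integrable M (d n)" "(\<integral>x. d n x \<partial>M) \<le> a n"
      by (simp_all add: d_def[abs_def] a_def nrm_def L2_inner_def integrable_abs_iff fun_diff_def)
  qed
  have "(\<integral>\<^sup>+x. (\<Sum>n. ennreal (d n x)) \<partial>M) = (\<Sum>n. \<integral>\<^sup>+x. ennreal (d n x) \<partial>M)"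
    by (rule nn_integral_suminf) (simp add: d_def)
  also have "\<dots> = (\<Sum>n. ennreal (\<integral>x. d n x \<partial>M))"
    using d_int by (subst nn_integral_eq_integral) (auto simp: d_def)
  also have "\<dots> \<le> (\<Sum>n. ennreal (a n))" using d_int by (intro suminf_le) (auto intro: ennreal_leI)
  also have "\<dots> = ennreal (suminf a)" using a a0 by (intro suminf_ennreal2) auto
  finally have "(\<integral>\<^sup>+x. (\<Sum>n. ennreal (d n x)) \<partial>M) \<noteq> \<infinity>" by (auto simp: top_unique)
  then have "AE x in M. (\<Sum>n. ennreal (d n x)) \<noteq> \<infinity>"
    by (intro nn_integral_PInf_AE) (simp_all add: d_def)
  \<comment> \<open>Where the sequence diverges \<open>lim\<close> is an arbitrary value, but that
    set is null and \<open>f\<close> is still measurable.\<close>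
  define f where "f x = lim (\<lambda>n. X n x)" for x
  have fm [measurable]: "f \<in> borel_measurable M" unfolding f_def by measurable
  have lim: "AE x in M. (\<lambda>n. X n x) \<longlonglongrightarrow> f x"
    using \<open>AE x in M. (\<Sum>n. ennreal (d n x)) \<noteq> \<infinity>\<close>
  proof eventually_elim
    case (elim x)
    then have "summable (\<lambda>n. d n x)" by (intro summable_suminf_not_top) (auto simp: d_def)
    then have "summable (\<lambda>n. X (Suc n) x - X n x)" unfolding d_def by (rule summable_rabs_cancel)
    then have "convergent (\<lambda>n. \<Sum>i<n. X (Suc i) x - X i x)" by (rule summable_iff_convergent[THEN iffD1])
    moreover have "(\<Sum>i<n. X (Suc i) x - X i x) = X n x - X 0 x" for n by (rule sum_lessThan_telescope)
    ultimately have "convergent (\<lambda>n. X n x - X 0 x)" by simp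
    then have "convergent (\<lambda>n. X n x)" using convergent_add_const_right_iff[of "\<lambda>n. X n x" "- X 0 x"] by simp
    then show ?case by (simp add: f_def convergent_LIMSEQ_iff)
  qed
  define t where "t n = suminf a - sum a {..<n}" for n
  have tail: "nrm (X n - X (n + m)) \<le> sum a {n..<n + m}" for n m :: nat
  proof (induction m)
    case 0
    have "nrm 0 = 0" unfolding nrm_def using ip_zero(2)[OF H_closed(1)] by (simp only: real_sqrt_zero)
    then show ?case by (simp only: add_0_right diff_self) simp
  next
    case (Suc m)
    have "nrm (X n - X (n + Suc m)) \<le> nrm (X n - X (n + m)) + nrm (X (n + m) - X (n + Suc m))"
      by (intro nrm_triangle_mid X)
    moreover have "nrm (X (n + m) - X (n + Suc m)) = a (n + m)"
      unfolding a_def add_Suc_right by (intro nrm_minus_commute X)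
    moreover have "sum a {n..<n + Suc m} = sum a {n..<n + m} + a (n + m)" by simp
    ultimately show ?case using Suc by linarith
  qed
  have tail': "nrm (X n - X k) \<le> t n" if "n \<le> k" for n k
  proof -
    have "nrm (X n - X k) \<le> sum a {n..<k}" using tail[of n "k - n"] that by simp
    also have "\<dots> = sum a {..<k} - sum a {..<n}" using that by (simp add: sum_diff_nat_ivl lessThan_atLeast0)
    also have "\<dots> \<le> t n" using sum_le_suminf[OF a, of "{..<k}"] a0 by (simp add: t_def)
    finally show ?thesis .
  qed
  have t0: "0 \<le> t n" for n using tail'[of n n] nrm_nonneg[of "X n - X n"] X by (smt (verit) H_closed(3) order_refl)
  have fatou: "(\<integral>\<^sup>+x. ennreal ((X n x - f x)\<^sup>2) \<partial>M) \<le> ennreal ((t n)\<^sup>2)" for n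
  proof -
    have "(\<integral>\<^sup>+x. ennreal ((X n x - f x)\<^sup>2) \<partial>M) = (\<integral>\<^sup>+x. liminf (\<lambda>k. ennreal ((X n x - X k x)\<^sup>2)) \<partial>M)"
    proof (rule nn_integral_cong_AE)
      show "AE x in M. ennreal ((X n x - f x)\<^sup>2) = liminf (\<lambda>k. ennreal ((X n x - X k x)\<^sup>2))"
        using lim
      proof eventually_elim
        case (elim x)
        then have "(\<lambda>k. ennreal ((X n x - X k x)\<^sup>2)) \<longlonglongrightarrow> ennreal ((X n x - f x)\<^sup>2)"
          by (intro tendsto_intros)
        then show ?case by (metis lim_imp_Liminf sequentially_bot)
      qed
    qed
    also have "\<dots> \<le> liminf (\<lambda>k. \<integral>\<^sup>+x. ennreal ((X n x - X k x)\<^sup>2) \<partial>M)"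
      by (rule nn_integral_liminf) simp
    also have "\<dots> \<le> limsup (\<lambda>k. \<integral>\<^sup>+x. ennreal ((X n x - X k x)\<^sup>2) \<partial>M)"
      by (rule Liminf_le_Limsup) simp
    also have "\<dots> \<le> ennreal ((t n)\<^sup>2)"
    proof (rule Limsup_bounded, rule eventually_sequentiallyI[of n])
      fix k assume "n \<le> k"
      have H: "X n - X k \<in> L2 M" using X by simp
      have "(\<integral>\<^sup>+x. ennreal ((X n x - X k x)\<^sup>2) \<partial>M) = ennreal (\<integral>x. (X n x - X k x)\<^sup>2 \<partial>M)"
        using L2D(2)[OF H] by (intro nn_integral_eq_integral) (auto simp: fun_diff_def)
      also have "(\<integral>x. (X n x - X k x)\<^sup>2 \<partial>M) = (nrm (X n - X k))\<^sup>2"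
        using n2[OF H] by simp
      finally show "(\<integral>\<^sup>+x. ennreal ((X n x - X k x)\<^sup>2) \<partial>M) \<le> ennreal ((t n)\<^sup>2)"
        using tail'[OF \<open>n \<le> k\<close>] H by (simp add: ennreal_leI power_mono)
    qed
    finally show ?thesis .
  qed
  have diffL2: "X n - f \<in> L2 M" for n
  proof -
    have "integrable M (\<lambda>x. (X n x - f x)\<^sup>2)"
      using fatou[of n] by (intro integrableI_nonneg) (auto simp: top_unique less_top[symmetric])
    then show ?thesis by (auto simp: L2_def fun_diff_def)
  qed
  have nrm_le: "nrm (X n - f) \<le> t n" for n
  proof (rule power2_le_imp_le[OF _ t0])
    have "ennreal ((nrm (X n - f))\<^sup>2) = (\<integral>\<^sup>+x. ennreal ((X n x - f x)\<^sup>2) \<partial>M)"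
      using L2D(2)[OF diffL2[of n]] n2[OF diffL2[of n]] by (subst nn_integral_eq_integral) auto
    then have "ennreal ((nrm (X n - f))\<^sup>2) \<le> ennreal ((t n)\<^sup>2)" using fatou[of n] by simp
    then show "(nrm (X n - f))\<^sup>2 \<le> (t n)\<^sup>2" by (rule ennreal_le_iff[THEN iffD1, rotated]) simp
  qed
  have "f = X 0 - (X 0 - f)" by simp
  then have fL2: "f \<in> L2 M" using diffL2[of 0] X by (metis H_closed(3))
  have "t \<longlonglongrightarrow> suminf a - suminf a"
    unfolding t_def by (intro tendsto_intros summable_LIMSEQ a)
  then have "t \<longlonglongrightarrow> 0" by simp
  then have "(\<lambda>n. nrm (X n - f)) \<longlonglongrightarrow> 0"
    by (rule Lim_null_comparison[rotated]) (use nrm_le diffL2 in simp)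
  then show ?thesis using fL2 by blast
qed

lemma (in prob_space) semi_hilbert_L2: "semi_hilbert (L2 M) (L2_inner M)"
proof -
  interpret semi_inner "L2 M" "L2_inner M" by (rule semi_inner_L2)
  show ?thesis by standard (rule L2_complete)
qed

lemma (in prob_space) bounded_L2:
  assumes "f \<in> borel_measurable M" "\<And>x. x \<in> space M \<Longrightarrow> \<bar>f x\<bar> \<le> C"
  shows "f \<in> L2 M"
proof -
  have "integrable M (\<lambda>x. (f x)\<^sup>2)"
  proof (rule integrable_const_bound[where B = "C\<^sup>2"])
    show "AE x in M. norm ((f x)\<^sup>2) \<le> C\<^sup>2"
      using assms(2) by (intro AE_I2) (auto simp: abs_le_square_iff[symmetric] intro: order_trans[OF _ abs_ge_self])
  qed (use assms in simp)
  then show ?thesis using assms by (simp add: L2_def)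
qed

lemma (in prob_space) simple_bounded:
  fixes f :: "'a \<Rightarrow> real"
  assumes "simple_function M f"
  obtains C where "C \<ge> 0" "\<And>x. x \<in> space M \<Longrightarrow> \<bar>f x\<bar> \<le> C"
proof -
  have fin: "finite ((\<lambda>x. \<bar>f x\<bar>) ` space M)"
    using simple_functionD(1)[OF assms] finite_imageI[of "f ` space M" abs] by (simp add: image_image)
  show ?thesis
    by (rule that[of "max 0 (Max ((\<lambda>x. \<bar>f x\<bar>) ` space M))"]) (use fin in \<open>auto simp: le_max_iff_disj\<close>)
qed

lemma (in prob_space) simple_L2:
  fixes f :: "'a \<Rightarrow> real"
  assumes "simple_function M f"
  shows "f \<in> L2 M"
proof -
  obtain C where "C \<ge> 0" "\<And>x. x \<in> space M \<Longrightarrow> \<bar>f x\<bar> \<le> C" using simple_bounded[OF assms] by blast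
  from bounded_L2[OF borel_measurable_simple_function[OF assms] this(2)] show ?thesis .
qed

lemma (in prob_space) simple_comp_L2: "simple_function M F \<Longrightarrow> (\<lambda>x. \<phi> (F x) :: real) \<in> L2 M"
  by (rule simple_L2) (rule simple_function_compose1)

section \<open>Reversible Markov operators\<close>

locale reversible_markov = prob_space +
  fixes P
  assumes markov: "markov_operator M P" and rev: "reversible M P"

sublocale reversible_markov \<subseteq> semi_hilbert "L2 M" "L2_inner M"
  by (rule semi_hilbert_L2)

context reversible_markov
begin

lemma symop_P: "symop P"
  unfolding symop_def
proof (intro conjI ballI)
  fix f assume f: "f \<in> L2 M"
  then show "P f \<in> L2 M" using markov by (auto simp: markov_operator_def L2_operator_def)
  fix g assume g: "g \<in> L2 M"
  have "L2_inner M (P f) g = L2_inner M g (P f)" by (simp add: L2_inner_def mult.commute)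
  also have "\<dots> = L2_inner M f (P g)" using rev f g by (simp add: reversible_def)
  finally show "L2_inner M (P f) g = L2_inner M f (P g)" .
qed

section \<open>Translation between almost everywhere statements and null vectors\<close>

lemma nrm_zero_iff_AE:
  assumes "f \<in> L2 M"
  shows "nrm f = 0 \<longleftrightarrow> (AE x in M. f x = 0)"
proof -
  have "nrm f = 0 \<longleftrightarrow> (\<integral>x. (f x)\<^sup>2 \<partial>M) = 0" by (simp add: nrm_def L2_inner_def power2_eq_square)
  also have "\<dots> \<longleftrightarrow> (AE x in M. (f x)\<^sup>2 = 0)"
    using L2D[OF assms] by (intro integral_nonneg_eq_0_iff_AE) auto
  finally show ?thesis by simp
qed

lemma L2_spectrum_eq: "L2_spectrum M P = spec P"
proof -
  have "(\<forall>f\<in>L2 M. (AE x in M. P f x - l * f x = 0) \<longrightarrow> (AE x in M. f x = 0)) \<longleftrightarrow>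
      (\<forall>f\<in>L2 M. nrm (shift P l f) = 0 \<longrightarrow> nrm f = 0)" for l
  proof (intro ball_cong refl)
    fix f assume f: "f \<in> L2 M"
    have "nrm (shift P l f) = 0 \<longleftrightarrow> (AE x in M. P f x - l * f x = 0)"
      using nrm_zero_iff_AE[OF symop_closed[OF symop_shift[OF symop_P] f, of l]] by (simp add: shift_def)
    then show "((AE x in M. P f x - l * f x = 0) \<longrightarrow> (AE x in M. f x = 0)) \<longleftrightarrow>
        (nrm (shift P l f) = 0 \<longrightarrow> nrm f = 0)" using nrm_zero_iff_AE[OF f] by simp
  qed
  moreover have "(\<forall>g\<in>L2 M. \<exists>f\<in>L2 M. AE x in M. P f x - l * f x = g x) \<longleftrightarrow> surj_op (shift P l)" for l
  proof -
    have "nrm (shift P l f - g) = 0 \<longleftrightarrow> (AE x in M. P f x - l * f x = g x)" if "f \<in> L2 M" "g \<in> L2 M" for f g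
      using nrm_zero_iff_AE[OF H_closed(3)[OF symop_closed[OF symop_shift[OF symop_P] that(1), of l] that(2)]]
      by (simp add: shift_def)
    then show ?thesis by (auto simp: surj_op_def)
  qed
  ultimately show ?thesis by (simp add: L2_spectrum_def spec_def)
qed

lemma L2_eigenspace_eq: "L2_eigenspace M P l = ker (shift P l)"
proof -
  have "nrm (shift P l f) = 0 \<longleftrightarrow> (AE x in M. P f x = l * f x)" if "f \<in> L2 M" for f
    using nrm_zero_iff_AE[OF symop_closed[OF symop_shift[OF symop_P] that, of l]] by (simp add: shift_def)
  then show ?thesis by (auto simp: L2_eigenspace_def ker_def)
qed

lemma L2_fin_dim_eq:
  assumes "E \<subseteq> L2 M"
  shows "L2_fin_dim M E \<longleftrightarrow> fin_dim E"
proof -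
  have "(AE x in M. f x = (\<Sum>b\<in>B. c b * b x)) \<longleftrightarrow> nrm (f - (\<Sum>b\<in>B. c b *\<^sub>R b)) = 0"
    if "f \<in> E" "B \<subseteq> L2 M" for f B c
    using that assms by (subst nrm_zero_iff_AE) (auto simp: sum_fun_apply subset_iff)
  then have "(\<forall>f\<in>E. \<exists>c. AE x in M. f x = (\<Sum>b\<in>B. c b * b x)) \<longleftrightarrow>
      (\<forall>f\<in>E. \<exists>c. nrm (f - (\<Sum>b\<in>B. c b *\<^sub>R b)) = 0)" if "B \<subseteq> L2 M" for B
    using that by simp
  then show ?thesis unfolding L2_fin_dim_def fin_dim_def by (intro ex_cong1 conj_cong refl) auto
qed

lemma L2_ess_spectrum_eq: "L2_ess_spectrum M P = ess P"
proof -
  have "(\<exists>f\<in>L2_eigenspace M P l. \<not> (AE x in M. f x = 0)) \<longleftrightarrow> (\<exists>f\<in>ker (shift P l). nrm f \<noteq> 0)" for l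
    unfolding L2_eigenspace_eq using nrm_zero_iff_AE kerD(1) by metis
  moreover have "L2_fin_dim M (L2_eigenspace M P l) \<longleftrightarrow> fin_dim (ker (shift P l))" for l
    unfolding L2_eigenspace_eq by (rule L2_fin_dim_eq) (auto simp: ker_def)
  ultimately show ?thesis
    unfolding L2_ess_spectrum_def L2_discrete_spectrum_def ess_def L2_spectrum_eq by simp
qed

section \<open>Integration of kernels over the values of a simple function\<close>

definition cell :: "('a \<Rightarrow> 'b) \<Rightarrow> 'b \<Rightarrow> 'a \<Rightarrow> real" where
  "cell F u = indicator (F -` {u} \<inter> space M)"

text \<open>\<open>W F \<Phi>\<close> plays the role of the integral of \<open>\<Phi> (F x) (F y)\<close> against \<open>\<mu>(dx) P(x, dy)\<close>; for a
  simple \<open>F\<close> it makes sense although \<open>P\<close> need not have a kernel.\<close>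

definition W :: "('a \<Rightarrow> 'b) \<Rightarrow> ('b \<Rightarrow> 'b \<Rightarrow> real) \<Rightarrow> real" where
  "W F \<Phi> = (\<Sum>u\<in>F ` space M. \<Sum>v\<in>F ` space M. \<Phi> u v * L2_inner M (cell F u) (P (cell F v)))"

definition energy :: "('a \<Rightarrow> real) \<Rightarrow> real" where
  "energy f = L2_inner M (shift P (-1) f) f"

lemma P_L2 [simp]: "f \<in> L2 M \<Longrightarrow> P f \<in> L2 M"
  using symop_P by simp

lemma energy_eq: "f \<in> L2 M \<Longrightarrow> energy f = L2_inner M f f + L2_inner M f (P f)"
  using ip_shift[OF symop_P, of f f "-1"] by (simp add: energy_def symopD[OF symop_P])

lemma ip_eqI: "f \<in> L2 M \<Longrightarrow> g \<in> L2 M \<Longrightarrow> (\<And>x. x \<in> space M \<Longrightarrow> f x = f' x) \<Longrightarrow>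
    (\<And>x. x \<in> space M \<Longrightarrow> g x = g' x) \<Longrightarrow> L2_inner M f g = L2_inner M f' g'"
  unfolding L2_inner_def by (intro Bochner_Integration.integral_cong) auto

text \<open>The arguments agree only on \<open>space M\<close>; symmetry moves \<open>P\<close> off
  the argument that is being replaced.\<close>

lemma ip_P_eqI:
  assumes "f \<in> L2 M" "g \<in> L2 M" "f' \<in> L2 M" "g' \<in> L2 M"
    and "\<And>x. x \<in> space M \<Longrightarrow> f x = f' x" "\<And>x. x \<in> space M \<Longrightarrow> g x = g' x"
  shows "L2_inner M f (P g) = L2_inner M f' (P g')"
proof -
  have "L2_inner M f (P g) = L2_inner M f' (P g)" using assms by (intro ip_eqI) auto
  also have "\<dots> = L2_inner M (P f') g" using assms by (simp add: symopD[OF symop_P])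
  also have "\<dots> = L2_inner M (P f') g'" using assms by (intro ip_eqI) auto
  also have "\<dots> = L2_inner M f' (P g')" using assms by (simp add: symopD[OF symop_P])
  finally show ?thesis .
qed

lemma indicator_L2 [simp]: "A \<in> sets M \<Longrightarrow> (indicator A :: 'a \<Rightarrow> real) \<in> L2 M"
  by (rule bounded_L2[where C = 1]) (auto simp: indicator_def)

lemma cell_L2 [simp]: "simple_function M F \<Longrightarrow> cell F u \<in> L2 M"
  unfolding cell_def by (simp add: simple_functionD(2))

lemma simple_eq_sum_cells:
  assumes "simple_function M F" "x \<in> space M"
  shows "\<phi> (F x) = (\<Sum>u\<in>F ` space M. \<phi> u *\<^sub>R cell F u) x"
proof -
  have "(\<Sum>u\<in>F ` space M. \<phi> u *\<^sub>R cell F u) x = (\<Sum>u\<in>F ` space M. if u = F x then \<phi> u else 0)"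
    unfolding sum_fun_apply using assms by (intro sum.cong) (auto simp: cell_def indicator_def)
  then show ?thesis using assms simple_functionD(1)[OF assms(1)] by simp
qed

lemma ip_P_simple:
  assumes F: "simple_function M F"
  shows "L2_inner M (\<lambda>x. \<phi> (F x)) (P (\<lambda>x. \<psi> (F x))) = W F (\<lambda>u v. \<phi> u * \<psi> v)"
proof -
  let ?V = "F ` space M"
  let ?f = "\<Sum>u\<in>?V. \<phi> u *\<^sub>R cell F u" and ?g = "\<Sum>v\<in>?V. \<psi> v *\<^sub>R cell F v"
  have H: "?f \<in> L2 M" "?g \<in> L2 M" using F by auto
  have "L2_inner M (\<lambda>x. \<phi> (F x)) (P (\<lambda>x. \<psi> (F x))) = L2_inner M ?f (P ?g)"
    by (rule ip_P_eqI[OF simple_comp_L2[OF F] simple_comp_L2[OF F] H]) (auto intro!: simple_eq_sum_cells[OF F])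
  also have "\<dots> = (\<Sum>u\<in>?V. L2_inner M (\<phi> u *\<^sub>R cell F u) (P ?g))"
    using F H by (intro ip_sum_left) auto
  also have "\<dots> = (\<Sum>u\<in>?V. \<phi> u * L2_inner M (P (cell F u)) ?g)"
    using F H by (intro sum.cong) (auto simp: ip_simps symopD[OF symop_P])
  also have "\<dots> = (\<Sum>u\<in>?V. \<phi> u * (\<Sum>v\<in>?V. L2_inner M (P (cell F u)) (\<psi> v *\<^sub>R cell F v)))"
    using F H by (intro sum.cong arg_cong2[where f = "(*)"] refl ip_sum_right) auto
  also have "\<dots> = W F (\<lambda>u v. \<phi> u * \<psi> v)"
    unfolding W_def using F by (auto simp: sum_distrib_left ip_simps symopD[OF symop_P] mult.assoc intro!: sum.cong)
  finally show ?thesis .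
qed

lemma ip_P_nonneg:
  assumes "f \<in> L2 M" "g \<in> L2 M" "\<And>x. 0 \<le> f x" "\<And>x. 0 \<le> g x"
  shows "0 \<le> L2_inner M f (P g)"
proof -
  have "AE x in M. 0 \<le> P g x" using markov assms by (simp add: markov_operator_def)
  then have "AE x in M. 0 \<le> f x * P g x" using assms(3) by (auto elim!: eventually_mono)
  then show ?thesis unfolding L2_inner_def by (rule integral_nonneg_AE)
qed

lemma W_weight_nonneg:
  assumes "simple_function M F"
  shows "0 \<le> L2_inner M (cell F u) (P (cell F v))"
  using assms by (intro ip_P_nonneg) (auto simp: cell_def)

text \<open>The weights are nonnegative because \<open>P\<close> preserves positivity; all energy
  estimates below go through this lemma.\<close>

lemma W_mono:
  assumes "simple_function M F"
    and "\<And>u v. u \<in> F ` space M \<Longrightarrow> v \<in> F ` space M \<Longrightarrow> \<Phi> u v \<le> \<Psi> u v"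
  shows "W F \<Phi> \<le> W F \<Psi>"
  unfolding W_def using assms W_weight_nonneg by (intro sum_mono mult_right_mono) auto

lemma W_add: "W F (\<lambda>u v. \<Phi> u v + \<Psi> u v) = W F \<Phi> + W F \<Psi>"
  by (simp add: W_def sum.distrib distrib_right)

lemma W_diff: "W F (\<lambda>u v. \<Phi> u v - \<Psi> u v) = W F \<Phi> - W F \<Psi>"
  by (simp add: W_def sum_subtractf left_diff_distrib)

lemma W_scale: "W F (\<lambda>u v. c * \<Phi> u v) = c * W F \<Phi>"
  by (simp add: W_def sum_distrib_left mult.assoc)

lemma W_swap:
  assumes F: "simple_function M F"
  shows "W F (\<lambda>u v. \<Phi> v u) = W F \<Phi>"
proof -
  have "L2_inner M (cell F u) (P (cell F v)) = L2_inner M (cell F v) (P (cell F u))" for u v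
    using F ip_sym[of "P (cell F u)" "cell F v"] by (simp flip: symopD[OF symop_P])
  then show ?thesis unfolding W_def by (subst sum.swap) simp
qed

text \<open>By \<open>P 1 = 1\<close> the first marginal of the weights is the measure
  itself.\<close>

lemma ip_simple:
  assumes F: "simple_function M F"
  shows "L2_inner M (\<lambda>x. \<phi> (F x)) (\<lambda>x. \<psi> (F x)) = W F (\<lambda>u v. \<phi> u * \<psi> u)"
proof -
  have 1: "AE x in M. P (\<lambda>_. 1) x = 1" using markov by (simp add: markov_operator_def)
  have one: "(\<lambda>_. 1) \<in> L2 M" using simple_comp_L2[OF F, of "\<lambda>_. 1"] .
  have "L2_inner M (\<lambda>x. \<phi> (F x)) (\<lambda>x. \<psi> (F x)) = L2_inner M (\<lambda>x. \<phi> (F x) * \<psi> (F x)) (P (\<lambda>_. 1))"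
    unfolding L2_inner_def
  proof (rule integral_cong_AE)
    show "AE x in M. \<phi> (F x) * \<psi> (F x) = \<phi> (F x) * \<psi> (F x) * P (\<lambda>_. 1) x" using 1 by auto
  qed (use L2D(1)[OF simple_comp_L2[OF F]] L2D(1)[OF P_L2[OF one]] in measurable)
  also have "\<dots> = W F (\<lambda>u v. \<phi> u * \<psi> u * 1)"
    using ip_P_simple[OF F, of "\<lambda>u. \<phi> u * \<psi> u" "\<lambda>_. 1"] by simp
  finally show ?thesis by simp
qed

text \<open>Expanding the square, the two diagonal terms agree by reversibility and together give
  (f, f); the cross term gives (f, P f).\<close>

lemma energy_simple:
  assumes F: "simple_function M F"
  shows "energy (\<lambda>x. \<phi> (F x)) = W F (\<lambda>u v. (\<phi> u + \<phi> v)\<^sup>2 / 2)"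
proof -
  have "W F (\<lambda>u v. (\<phi> u + \<phi> v)\<^sup>2 / 2) =
      W F (\<lambda>u v. 1/2 * (\<phi> u * \<phi> u) + 1/2 * (\<phi> v * \<phi> v) + \<phi> u * \<phi> v)"
    by (simp add: power2_eq_square field_simps)
  also have "\<dots> = W F (\<lambda>u v. \<phi> u * \<phi> u) + W F (\<lambda>u v. \<phi> u * \<phi> v)"
    unfolding W_add W_scale using W_swap[OF F, of "\<lambda>u v. \<phi> u * \<phi> u"] by simp
  finally show ?thesis
    using F by (simp add: energy_eq simple_comp_L2 ip_simple ip_P_simple)
qed

lemma nrm_simple: "simple_function M F \<Longrightarrow> (nrm (\<lambda>x. \<phi> (F x)))\<^sup>2 = W F (\<lambda>u v. (\<phi> u)\<^sup>2)"
  using nrm_power2[OF simple_comp_L2, of F \<phi>] ip_simple[of F \<phi> \<phi>] by (simp add: power2_eq_square)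

lemma measure_simple:
  assumes F: "simple_function M F"
  shows "measure M {x \<in> space M. Q (F x)} = W F (\<lambda>u v. of_bool (Q u))"
proof -
  have meas: "{x \<in> space M. Q (F x)} \<in> sets M"
    using simple_functionD(2)[OF F, of "Collect Q"] by (simp add: vimage_def Int_def conj_commute)
  have "measure M {x \<in> space M. Q (F x)} = L2_inner M (\<lambda>x. of_bool (Q (F x))) (\<lambda>x. 1)"
  proof -
    have "(\<integral>x. indicator {x \<in> space M. Q (F x)} x \<partial>M) = (\<integral>x. of_bool (Q (F x)) * (1::real) \<partial>M)"
      by (intro Bochner_Integration.integral_cong) (auto split: split_indicator)
    then show ?thesis using meas by (simp add: L2_inner_def Int_absorb2)
  qed
  also have "\<dots> = W F (\<lambda>u v. of_bool (Q u) * 1)"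
    using ip_simple[OF F, of "\<lambda>u. of_bool (Q u)" "\<lambda>_. 1"] by simp
  finally show ?thesis by simp
qed

lemma ip_P_indicator_simple:
  assumes F: "simple_function M F"
    and A: "A \<in> sets M" "\<And>x. x \<in> space M \<Longrightarrow> x \<in> A \<longleftrightarrow> Q (F x)"
    and B: "B \<in> sets M" "\<And>x. x \<in> space M \<Longrightarrow> x \<in> B \<longleftrightarrow> R (F x)"
  shows "L2_inner M (indicator A) (P (indicator B)) = W F (\<lambda>u v. of_bool (Q u) * of_bool (R v))"
proof -
  have "L2_inner M (indicator A) (P (indicator B)) =
      L2_inner M (\<lambda>x. of_bool (Q (F x))) (P (\<lambda>x. of_bool (R (F x))))"
    by (rule ip_P_eqI[OF _ _ simple_comp_L2[OF F] simple_comp_L2[OF F]]) (use A B in auto)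
  then show ?thesis using ip_P_simple[OF F, of "\<lambda>u. of_bool (Q u)" "\<lambda>v. of_bool (R v)"] by simp
qed

lemma simple_dense:
  assumes f: "f \<in> L2 M"
  obtains s where "\<And>n. simple_function M (s n)" "(\<lambda>n. nrm (s n - f)) \<longlonglongrightarrow> 0"
proof -
  have fm: "f \<in> borel_measurable M" using f L2D by blast
  obtain s where s: "\<And>i. simple_function M (s i)" "\<And>x. x \<in> space M \<Longrightarrow> (\<lambda>i. s i x) \<longlonglongrightarrow> f x"
    "\<And>i x. x \<in> space M \<Longrightarrow> dist (s i x) 0 \<le> 2 * dist (f x) 0"
    using borel_measurable_implies_sequence_metric[OF fm, of 0] by blast
  have sm: "s i \<in> borel_measurable M" for i using s(1) by (rule borel_measurable_simple_function)
  have "(\<lambda>n. \<integral>x. (s n x - f x)\<^sup>2 \<partial>M) \<longlonglongrightarrow> (\<integral>x. 0 \<partial>M)"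
  \<comment> \<open>The approximants satisfy
    \<open>\<bar>s n x\<bar> \<le> 2 * \<bar>f x\<bar>\<close>, so the difference is at most
    \<open>3 * \<bar>f x\<bar>\<close>.\<close>
  proof (rule integral_dominated_convergence[where w = "\<lambda>x. 9 * (f x)\<^sup>2"])
    show "integrable M (\<lambda>x. 9 * (f x)\<^sup>2)" using L2D(2)[OF f] by simp
    show "AE x in M. (\<lambda>n. (s n x - f x)\<^sup>2) \<longlonglongrightarrow> 0"
    proof (rule AE_I2)
      fix x assume "x \<in> space M"
      then have "(\<lambda>n. (s n x - f x)\<^sup>2) \<longlonglongrightarrow> (f x - f x)\<^sup>2" by (intro tendsto_intros s)
      then show "(\<lambda>n. (s n x - f x)\<^sup>2) \<longlonglongrightarrow> 0" by simp
    qed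
    show "AE x in M. norm ((s n x - f x)\<^sup>2) \<le> 9 * (f x)\<^sup>2" for n
    proof (rule AE_I2)
      fix x assume "x \<in> space M"
      then have "\<bar>s n x - f x\<bar> \<le> \<bar>3 * f x\<bar>" using s(3)[of x n] by (simp add: dist_real_def)
      then have "(s n x - f x)\<^sup>2 \<le> (3 * f x)\<^sup>2" by (simp only: abs_le_square_iff)
      then show "norm ((s n x - f x)\<^sup>2) \<le> 9 * (f x)\<^sup>2" by (simp add: power_mult_distrib)
    qed
  qed (use sm fm in auto)
  then have "(\<lambda>n. sqrt (\<integral>x. (s n x - f x)\<^sup>2 \<partial>M)) \<longlonglongrightarrow> sqrt 0"
    by (intro tendsto_real_sqrt) simp
  then have "(\<lambda>n. nrm (s n - f)) \<longlonglongrightarrow> 0"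
    by (simp add: nrm_def L2_inner_def power2_eq_square fun_diff_def)
  then show ?thesis using that s(1) by blast
qed

text \<open>For simple functions this is AM-GM under \<open>W\<close>. Continuity of
  \<open>P\<close> is not yet known here, so density is used one argument at a time: symmetry keeps
  \<open>P\<close> on a fixed function in each of the two limits.\<close>

lemma ip_P_le:
  assumes "f \<in> L2 M" "g \<in> L2 M"
  shows "L2_inner M f (P g) \<le> (L2_inner M f f + L2_inner M g g) / 2"
proof -
  have simple: "L2_inner M f (P g) \<le> (L2_inner M f f + L2_inner M g g) / 2"
    if f: "simple_function M f" and g: "simple_function M g" for f g :: "'a \<Rightarrow> real"
  proof -
    define F where "F x = (f x, g x)" for x
    have F: "simple_function M F" unfolding F_def using f g by (rule simple_function_Pair)
    have "L2_inner M f (P g) = W F (\<lambda>u v. fst u * snd v)"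
      using ip_P_simple[OF F, of fst snd] by (simp add: F_def)
    also have "\<dots> \<le> W F (\<lambda>u v. 1/2 * (fst u * fst u) + 1/2 * (snd v * snd v))"
    proof (rule W_mono[OF F])
      fix u v :: "real \<times> real"
      show "fst u * snd v \<le> 1/2 * (fst u * fst u) + 1/2 * (snd v * snd v)"
        using sum_squares_bound[of "fst u" "snd v"] by (simp add: power2_eq_square)
    qed
    also have "\<dots> = (L2_inner M f f + L2_inner M g g) / 2"
      unfolding W_add W_scale using W_swap[OF F, of "\<lambda>u v. snd u * snd u"]
        ip_simple[OF F, of fst fst] ip_simple[OF F, of snd snd] by (simp add: F_def)
    finally show ?thesis .
  qed
  obtain s where s: "\<And>n. simple_function M (s n)" "(\<lambda>n. nrm (s n - f)) \<longlonglongrightarrow> 0" using simple_dense[OF assms(1)] by blast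
  obtain r where r: "\<And>n. simple_function M (r n)" "(\<lambda>n. nrm (r n - g)) \<longlonglongrightarrow> 0" using simple_dense[OF assms(2)] by blast
  have H: "s n \<in> L2 M" "r n \<in> L2 M" for n using s r simple_L2 by auto
  have half: "L2_inner M (s n) (P g) \<le> (L2_inner M (s n) (s n) + L2_inner M g g) / 2" for n
  proof (rule LIMSEQ_le)
    have "(\<lambda>m. L2_inner M (P (s n)) (r m)) \<longlonglongrightarrow> L2_inner M (P (s n)) g"
      using H assms r by (intro tendsto_ip nrm_zero_const) auto
    then show "(\<lambda>m. L2_inner M (s n) (P (r m))) \<longlonglongrightarrow> L2_inner M (s n) (P g)"
      using H assms by (simp add: symopD[OF symop_P])
    show "(\<lambda>m. (L2_inner M (s n) (s n) + L2_inner M (r m) (r m)) / 2) \<longlonglongrightarrow>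
        (L2_inner M (s n) (s n) + L2_inner M g g) / 2"
      using H assms r by (intro tendsto_intros tendsto_ip) auto
  qed (use simple s r in blast)
  show ?thesis
  proof (rule LIMSEQ_le)
    show "(\<lambda>n. L2_inner M (s n) (P g)) \<longlonglongrightarrow> L2_inner M f (P g)"
      using H assms s by (intro tendsto_ip nrm_zero_const) auto
    show "(\<lambda>n. (L2_inner M (s n) (s n) + L2_inner M g g) / 2) \<longlonglongrightarrow> (L2_inner M f f + L2_inner M g g) / 2"
      using H assms s by (intro tendsto_intros tendsto_ip) auto
  qed (use half in blast)
qed

text \<open>Taking \<open>P f\<close> and \<open>f\<close> in \<open>ip_P_le\<close>, half of the
  squared norm of \<open>P f\<close> is absorbed.\<close>

lemma bound_op_P: "bound_op P 1"
proof -
  have "nrm (P f) \<le> nrm f" if f: "f \<in> L2 M" for f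
    using ip_P_le[of "P f" f] f by (auto simp: nrm_def)
  then show ?thesis by (simp add: bound_op_def)
qed

lemma energy_nonneg: "f \<in> L2 M \<Longrightarrow> 0 \<le> energy f"
  using form_bound[OF symop_P bound_op_P, of f] by (simp add: energy_eq nrm_power2 symopD[OF symop_P])

lemma energy_le: "f \<in> L2 M \<Longrightarrow> energy f \<le> 2 * (nrm f)\<^sup>2"
  using form_bound[OF symop_P bound_op_P, of f] by (simp add: energy_eq nrm_power2 symopD[OF symop_P])

section \<open>Level sets and a dual Cheeger inequality\<close>

definition good_pair :: "real \<Rightarrow> 'a set \<Rightarrow> 'a set \<Rightarrow> bool" where
  "good_pair \<kappa> A B \<longleftrightarrow> A \<in> sets M \<and> B \<in> sets M \<and> A \<inter> B = {} \<and> 0 < measure M (A \<union> B) \<and>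
      (1 - \<kappa>) * measure M (A \<union> B) < 2 * L2_inner M (indicator A) (P (indicator B))"

text \<open>The candidates are the sets where f > 0, respectively f < 0, and f^2 > t. If none is
  good, the failed inequalities are integrated over t, where the layer cake formula produces
  \<open>u\<^sup>2\<close> and \<open>min (u\<^sup>2) (v\<^sup>2)\<close>, and
  \<open>level_set_kernel_bound\<close> bounds the energy from below.\<close>

lemma dual_Cheeger_level_sets:
  assumes f: "simple_function M f" and \<kappa>: "\<kappa> > 0" and small: "energy f < \<kappa>\<^sup>2 / 2 * (nrm f)\<^sup>2"
  shows "\<exists>A B. good_pair \<kappa> A B \<and> A \<union> B \<subseteq> {x \<in> space M. f x \<noteq> 0}"
proof (rule ccontr)
  assume none: "\<not> ?thesis"
  let ?J = "\<lambda>u v. L2_inner M (cell f u) (P (cell f v))"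
  define V where "V = f ` space M"
  have fm: "f \<in> borel_measurable M" using f by (rule borel_measurable_simple_function)
  have level: "0 \<le> W f (\<lambda>u v. (1 - \<kappa>) * of_bool (t < u\<^sup>2) - 2 * (of_bool (0 < u \<and> t < u\<^sup>2) * of_bool (v < 0 \<and> t < v\<^sup>2)))"
    if "0 \<le> t" for t
  proof -
    define A where "A = {x \<in> space M. 0 < f x \<and> t < (f x)\<^sup>2}"
    define B where "B = {x \<in> space M. f x < 0 \<and> t < (f x)\<^sup>2}"
    have AB: "A \<in> sets M" "B \<in> sets M" unfolding A_def B_def using fm by measurable
    have sub: "A \<union> B \<subseteq> {x \<in> space M. f x \<noteq> 0}" "A \<inter> B = {}" by (auto simp: A_def B_def)
    have eq: "A \<union> B = {x \<in> space M. t < (f x)\<^sup>2}"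
      using that by (auto simp: A_def B_def) (metis linorder_neqE_linordered_idom not_less power_zero_numeral)
    have mS: "measure M (A \<union> B) = W f (\<lambda>u v. of_bool (t < u\<^sup>2))"
      unfolding eq by (rule measure_simple[OF f])
    have mJ: "L2_inner M (indicator A) (P (indicator B)) =
        W f (\<lambda>u v. of_bool (0 < u \<and> t < u\<^sup>2) * of_bool (v < 0 \<and> t < v\<^sup>2))"
      using AB by (intro ip_P_indicator_simple[OF f]) (auto simp: A_def B_def)
    have "\<not> good_pair \<kappa> A B" using none sub by blast
    then have "2 * L2_inner M (indicator A) (P (indicator B)) \<le> (1 - \<kappa>) * measure M (A \<union> B)"
    proof (cases "0 < measure M (A \<union> B)")
      \<comment> \<open>A null union is not a candidate, but then the pairing vanishes as well and
        the inequality is trivial.\<close>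
      case False
      then have 0: "measure M (A \<union> B) = 0" using measure_nonneg[of M "A \<union> B"] by linarith
      have "L2_inner M (indicator A) (P (indicator B)) \<le> measure M (A \<union> B)"
        unfolding mS mJ by (rule W_mono[OF f]) auto
      then show ?thesis using 0 by simp
    qed (use AB sub in \<open>auto simp: good_pair_def\<close>)
    then show ?thesis by (simp add: W_diff W_scale mS mJ)
  qed
  define G where "G t = (\<Sum>u\<in>V. \<Sum>v\<in>V. ((1 - \<kappa>) * indicator {0..<u\<^sup>2} t -
      2 * (of_bool (0 < u \<and> v < 0) * indicator {0..<min (u\<^sup>2) (v\<^sup>2)} t)) * ?J u v)" for t :: real
  have G0: "0 \<le> G t" for t
  proof (cases "0 \<le> t")
    case True
    have "G t = W f (\<lambda>u v. (1 - \<kappa>) * of_bool (t < u\<^sup>2) - 2 * (of_bool (0 < u \<and> t < u\<^sup>2) * of_bool (v < 0 \<and> t < v\<^sup>2)))"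
      unfolding G_def W_def V_def using True
      by (intro sum.cong arg_cong2[where f = "(*)"] refl) (auto simp: indicator_def)
    then show ?thesis using level[OF True] by simp
  qed (simp add: G_def)
  have int: "integrable lborel (\<lambda>t::real. indicator {0..<c} t :: real)" for c
    by (cases "0 \<le> c") (auto intro!: integrable_real_indicator simp: emeasure_lborel_Ico)
  have val: "(\<integral>t. indicator {0..<c} t \<partial>lborel) = c" if "0 \<le> c" for c :: real
    using that by simp
  have "0 \<le> (\<integral>t. G t \<partial>lborel)" using G0 by (intro Bochner_Integration.integral_nonneg) auto
  also have "(\<integral>t. G t \<partial>lborel) = W f (\<lambda>u v. (1 - \<kappa>) * u\<^sup>2 - 2 * (of_bool (0 < u \<and> v < 0) * min (u\<^sup>2) (v\<^sup>2)))"
    unfolding G_def W_def V_def using int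
    by (subst Bochner_Integration.integral_sum; (intro Bochner_Integration.integrable_sum)?; simp add: val)+
  \<comment> \<open>Only \<open>u\<close> positive with \<open>v\<close> negative is counted so far;
    averaging with the transpose produces the symmetric event of
    \<open>level_set_kernel_bound\<close>.\<close>
  also have "\<dots> = (W f (\<lambda>u v. (1 - \<kappa>) * u\<^sup>2 - 2 * (of_bool (0 < u \<and> v < 0) * min (u\<^sup>2) (v\<^sup>2))) +
      W f (\<lambda>u v. (1 - \<kappa>) * v\<^sup>2 - 2 * (of_bool (0 < v \<and> u < 0) * min (v\<^sup>2) (u\<^sup>2)))) / 2"
    using W_swap[OF f, of "\<lambda>u v. (1 - \<kappa>) * u\<^sup>2 - 2 * (of_bool (0 < u \<and> v < 0) * min (u\<^sup>2) (v\<^sup>2))"] by simp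
  also have "\<dots> \<le> W f (\<lambda>u v. 2 / \<kappa> * ((u + v)\<^sup>2 / 2) - \<kappa> / 2 * (u\<^sup>2) - \<kappa> / 2 * (v\<^sup>2)) / 2"
    unfolding W_add[symmetric]
  proof (intro divide_right_mono W_mono[OF f])
    fix u v :: real
    show "(1 - \<kappa>) * u\<^sup>2 - 2 * (of_bool (0 < u \<and> v < 0) * min (u\<^sup>2) (v\<^sup>2)) +
        ((1 - \<kappa>) * v\<^sup>2 - 2 * (of_bool (0 < v \<and> u < 0) * min (v\<^sup>2) (u\<^sup>2)))
        \<le> 2 / \<kappa> * ((u + v)\<^sup>2 / 2) - \<kappa> / 2 * (u\<^sup>2) - \<kappa> / 2 * (v\<^sup>2)"
      using level_set_kernel_bound[OF \<kappa>, of u v] by (cases "0 < u \<and> v < 0"; cases "0 < v \<and> u < 0") (auto simp: algebra_simps min.commute)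
  qed simp
  also have "\<dots> = (2 / \<kappa> * energy f - \<kappa> * (nrm f)\<^sup>2) / 2"
    unfolding W_diff W_scale using energy_simple[OF f, of "\<lambda>u. u"] nrm_simple[OF f, of "\<lambda>u. u"]
      W_swap[OF f, of "\<lambda>u v. u\<^sup>2"] by simp
  finally have "\<kappa> * (nrm f)\<^sup>2 \<le> 2 / \<kappa> * energy f" by simp
  then have "\<kappa>\<^sup>2 / 2 * (nrm f)\<^sup>2 \<le> energy f" using \<kappa> by (simp add: field_simps power2_eq_square)
  then show False using small by simp
qed

section \<open>Energy of functions cut along a pair of sets\<close>

definition defect :: "'a set \<Rightarrow> 'a set \<Rightarrow> real" where
  "defect A B = measure M (A \<union> B) - 2 * L2_inner M (indicator A) (P (indicator B))"

text \<open>The labels are a simple function, so \<open>x \<mapsto> (f x, lab A B x)\<close> is one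
  too, and a single \<open>W\<close> sees the values of \<open>f\<close> and the position relative
  to the pair.\<close>

definition lab :: "'a set \<Rightarrow> 'a set \<Rightarrow> 'a \<Rightarrow> nat" where
  "lab A B x = (if x \<in> A then 1 else if x \<in> B then 2 else 0)"

lemma simple_lab:
  assumes "A \<in> sets M" "B \<in> sets M"
  shows "simple_function M (lab A B)"
proof -
  have "simple_function M (\<lambda>x. if x \<in> A then 1 else if x \<in> B then 2 else (0::nat))"
    using assms by (intro simple_function_If_set simple_function_const) (auto simp: sets.sets_into_space Int_absorb2)
  then show ?thesis by (simp add: lab_def[abs_def])
qed

text \<open>The defect is the \<open>W\<close>-mass of the pairs of points that are not separated by the bipartition,
  counted with weight 1 inside \<open>A\<close> or \<open>B\<close> and with weight 1/2 across the boundary of \<open>A \<union> B\<close>.\<close>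

definition defect_kernel :: "nat \<Rightarrow> nat \<Rightarrow> real" where
  "defect_kernel i j = (of_bool (i \<noteq> 0) + of_bool (j \<noteq> 0)) / 2 - of_bool (i = 1 \<and> j = 2) - of_bool (i = 2 \<and> j = 1)"

text \<open>Reduces cutting along a pair to finitely many label cases: the new kernel may exceed the
  old one only where \<open>defect_kernel\<close> is positive, and \<open>K\<close> is the price
  paid there.\<close>

lemma energy_compare:
  assumes f: "simple_function M f" and C: "\<And>x. x \<in> space M \<Longrightarrow> \<bar>f x\<bar> \<le> C"
    and AB: "A \<in> sets M" "B \<in> sets M" "A \<inter> B = {}"
    and \<phi>: "\<And>a b i j. \<bar>a\<bar> \<le> C \<Longrightarrow> \<bar>b\<bar> \<le> C \<Longrightarrow> i \<in> {0,1,2} \<Longrightarrow> j \<in> {0,1,2} \<Longrightarrow>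
        (\<phi> a i + \<phi> b j)\<^sup>2 / 2 \<le> (a + b)\<^sup>2 / 2 + K * defect_kernel i j"
  shows "energy (\<lambda>x. \<phi> (f x) (lab A B x)) \<le> energy f + K * defect A B"
proof -
  define F where "F x = (f x, lab A B x)" for x
  have F: "simple_function M F" unfolding F_def using f AB by (intro simple_function_Pair simple_lab)
  have "energy (\<lambda>x. \<phi> (f x) (lab A B x)) = W F (\<lambda>u v. (\<phi> (fst u) (snd u) + \<phi> (fst v) (snd v))\<^sup>2 / 2)"
    using energy_simple[OF F, of "\<lambda>u. \<phi> (fst u) (snd u)"] by (simp add: F_def)
  also have "\<dots> \<le> W F (\<lambda>u v. (fst u + fst v)\<^sup>2 / 2 + K * defect_kernel (snd u) (snd v))"
  proof (rule W_mono[OF F])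
    fix u v assume "u \<in> F ` space M" "v \<in> F ` space M"
    then have "\<bar>fst u\<bar> \<le> C" "\<bar>fst v\<bar> \<le> C" "snd u \<in> {0,1,2}" "snd v \<in> {0,1,2}"
      using C by (auto simp: F_def lab_def split: if_splits)
    then show "(\<phi> (fst u) (snd u) + \<phi> (fst v) (snd v))\<^sup>2 / 2
        \<le> (fst u + fst v)\<^sup>2 / 2 + K * defect_kernel (snd u) (snd v)" by (rule \<phi>)
  qed
  also have "\<dots> = energy f + K * W F (\<lambda>u v. defect_kernel (snd u) (snd v))"
    unfolding W_add W_scale using energy_simple[OF F, of fst] by (simp add: F_def)
  also have "W F (\<lambda>u v. defect_kernel (snd u) (snd v)) = defect A B"
  proof -
    have "W F (\<lambda>u v. defect_kernel (snd u) (snd v)) = W F (\<lambda>u v. 1/2 * of_bool (snd u \<noteq> 0) + 1/2 * of_bool (snd v \<noteq> 0)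
        - of_bool (snd u = 1) * of_bool (snd v = 2) - of_bool (snd u = 2) * of_bool (snd v = 1))"
      unfolding defect_kernel_def of_bool_conj by (simp only: add_divide_distrib) (simp add: mult.commute)
    also have "\<dots> = W F (\<lambda>u v. of_bool (snd u \<noteq> 0)) - 2 * W F (\<lambda>u v. of_bool (snd u = 1) * of_bool (snd v = 2))"
      unfolding W_add W_diff W_scale
      using W_swap[OF F, of "\<lambda>u v. of_bool (snd u \<noteq> 0)"]
        W_swap[OF F, of "\<lambda>u v. of_bool (snd u = 1) * of_bool (snd v = 2)"] by (simp add: mult.commute)
    also have "W F (\<lambda>u v. of_bool (snd u = 1) * of_bool (snd v = 2)) = L2_inner M (indicator A) (P (indicator B))"
      using AB by (intro ip_P_indicator_simple[OF F, symmetric]) (auto simp: F_def lab_def)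
    also have "W F (\<lambda>u v. of_bool (snd u \<noteq> 0)) = measure M {x \<in> space M. snd (F x) \<noteq> 0}"
      by (rule measure_simple[OF F, symmetric])
    also have "{x \<in> space M. snd (F x) \<noteq> 0} = A \<union> B"
      using AB sets.sets_into_space by (auto simp: F_def lab_def)
    finally show ?thesis by (simp add: defect_def)
  qed
  finally show ?thesis .
qed

lemma energy_zero: "energy (\<lambda>x. 0) = 0"
  by (simp add: energy_def L2_inner_def)

lemma defect_nonneg:
  assumes "A \<in> sets M" "B \<in> sets M" "A \<inter> B = {}"
  shows "0 \<le> defect A B"
  using energy_compare[of "\<lambda>x. 0" 0 A B "\<lambda>_ _. 0" 1] assms energy_zero by (auto simp: defect_kernel_def)

definition sgn_pair :: "'a set \<Rightarrow> 'a set \<Rightarrow> 'a \<Rightarrow> real" where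
  "sgn_pair A B x = indicator A x - indicator B x"

lemma sgn_pair_L2: "A \<in> sets M \<Longrightarrow> B \<in> sets M \<Longrightarrow> sgn_pair A B \<in> L2 M"
  unfolding sgn_pair_def using H_closed(3)[of "indicator A" "indicator B"] by (simp add: fun_diff_def)

lemma energy_sgn_pair:
  assumes "A \<in> sets M" "B \<in> sets M" "A \<inter> B = {}"
  shows "energy (sgn_pair A B) \<le> 2 * defect A B"
proof -
  have "energy (\<lambda>x. if lab A B x = 1 then 1 else if lab A B x = 2 then - 1 else 0) \<le> energy (\<lambda>x. 0) + 2 * defect A B"
    using assms by (intro energy_compare[of "\<lambda>x. 0" 0 A B "\<lambda>a i. if i = 1 then 1 else if i = 2 then - 1 else 0" 2])
      (auto simp: defect_kernel_def)
  moreover have "(\<lambda>x. if lab A B x = 1 then 1 else if lab A B x = 2 then - 1 else 0) = sgn_pair A B"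
    using assms by (auto simp: lab_def sgn_pair_def fun_eq_iff indicator_def)
  ultimately show ?thesis by (simp add: energy_zero)
qed

text \<open>Setting \<open>f\<close> to zero on the pair raises the kernel only across its boundary.
  The factor 8 is the one that \<open>upper_compare\<close> uses, so that both kinds of cut are
  charged alike.\<close>

lemma energy_outside:
  assumes f: "simple_function M f" and C: "\<And>x. x \<in> space M \<Longrightarrow> \<bar>f x\<bar> \<le> C"
    and AB: "A \<in> sets M" "B \<in> sets M" "A \<inter> B = {}"
  shows "energy (\<lambda>x. if x \<in> A \<union> B then 0 else f x) \<le> energy f + 8 * C\<^sup>2 * defect A B"
proof -
  have "energy (\<lambda>x. if lab A B x = 0 then f x else 0) \<le> energy f + 8 * C\<^sup>2 * defect A B"
  proof (rule energy_compare[OF f C AB, where \<phi> = "\<lambda>a i. if i = 0 then a else 0"])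
    fix a b :: real and i j :: nat
    assume a: "\<bar>a\<bar> \<le> C" "\<bar>b\<bar> \<le> C" "i \<in> {0,1,2}" "j \<in> {0,1,2}"
    have "a\<^sup>2 \<le> C\<^sup>2" "b\<^sup>2 \<le> C\<^sup>2" using a by (auto simp: abs_le_square_iff[symmetric])
    then have "a\<^sup>2 \<le> (a + b)\<^sup>2 + 8 * C\<^sup>2" "b\<^sup>2 \<le> (a + b)\<^sup>2 + 8 * C\<^sup>2"
      using zero_le_power2[of "a + b"] zero_le_power2[of C] by linarith+
    then show "((if i = 0 then a else 0) + (if j = 0 then b else 0))\<^sup>2 / 2
        \<le> (a + b)\<^sup>2 / 2 + 8 * C\<^sup>2 * defect_kernel i j"
      using a by (auto simp: defect_kernel_def)
  qed
  moreover have "(\<lambda>x. if lab A B x = 0 then f x else 0) = (\<lambda>x. if x \<in> A \<union> B then 0 else f x)"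
    by (auto simp: lab_def fun_eq_iff)
  ultimately show ?thesis by simp
qed

text \<open>With the sign s = 1 on A and s = -1 on B, \<open>upper\<close> is s times the positive
  part of s f - c, and \<open>lower\<close> is s times the positive part of c - s f.\<close>

definition upper :: "real \<Rightarrow> real \<Rightarrow> nat \<Rightarrow> real" where
  "upper c a i = (if i = 1 then max (a - c) 0 else if i = 2 then - max (- a - c) 0 else 0)"

definition lower :: "real \<Rightarrow> real \<Rightarrow> nat \<Rightarrow> real" where
  "lower c a i = (if i = 1 then max (c - a) 0 else if i = 2 then - max (c + a) 0 else 0)"

lemma lower_eq_upper: "lower c a i = upper (- c) (- a) i"
  by (simp add: lower_def upper_def add.commute)

text \<open>Between A and B the sum of the two values is a difference of positive parts of
  \<open>a - c\<close> and \<open>- b - c\<close>, and the positive part is 1-Lipschitz. In the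
  other cases the values are at most \<open>2 * C\<close> and the defect pays: two points on the
  same side give \<open>(4 * C)\<^sup>2 / 2 = 8 * C\<^sup>2\<close>.\<close>

lemma upper_compare:
  assumes "\<bar>a\<bar> \<le> C" "\<bar>b\<bar> \<le> C" "\<bar>c\<bar> \<le> C" "i \<in> {0,1,2}" "j \<in> {0,1,2}"
  shows "(upper c a i + upper c b j)\<^sup>2 / 2 \<le> (a + b)\<^sup>2 / 2 + 8 * C\<^sup>2 * defect_kernel i j"
proof (cases "(i = 1 \<and> j = 2) \<or> (i = 2 \<and> j = 1)")
  case True
  have "\<bar>max x 0 - max y 0\<bar> \<le> \<bar>x - y\<bar>" for x y :: real
    by (cases "x \<le> 0"; cases "y \<le> 0") (auto simp: max_def)
  note lip = this[of "a - c" "- b - c"] this[of "b - c" "- a - c"]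
  from True have "\<bar>upper c a i + upper c b j\<bar> \<le> \<bar>a + b\<bar>"
  proof
    assume "i = 1 \<and> j = 2"
    then have "upper c a i + upper c b j = max (a - c) 0 - max (- b - c) 0" by (simp add: upper_def)
    then show ?thesis using lip(1) by simp
  next
    assume "i = 2 \<and> j = 1"
    then have "upper c a i + upper c b j = max (b - c) 0 - max (- a - c) 0" by (simp add: upper_def)
    then show ?thesis using lip(2) by (simp add: add.commute)
  qed
  then have "(upper c a i + upper c b j)\<^sup>2 \<le> (a + b)\<^sup>2" by (simp only: abs_le_square_iff)
  moreover have "defect_kernel i j = 0" using True by (auto simp: defect_kernel_def)
  ultimately show ?thesis by simp
next
  case False
  have u: "\<bar>upper c a i\<bar> \<le> 2 * C" "\<bar>upper c b j\<bar> \<le> 2 * C" using assms by (auto simp: upper_def max_def)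
  consider "i = 0" "j = 0" | "i = 0" "j \<noteq> 0" | "i \<noteq> 0" "j = 0" | "i \<noteq> 0" "j \<noteq> 0" by blast
  then show ?thesis
  proof cases
    case 1
    then show ?thesis by (simp add: upper_def defect_kernel_def)
  next
    case 2
    have "\<bar>upper c b j\<bar> \<le> \<bar>2 * C\<bar>" using u by linarith
    then have "(upper c b j)\<^sup>2 \<le> (2 * C)\<^sup>2" by (simp only: abs_le_square_iff)
    moreover have "(2 * C)\<^sup>2 = 4 * C\<^sup>2" by (simp add: power_mult_distrib)
    ultimately have "(upper c b j)\<^sup>2 \<le> (a + b)\<^sup>2 + 8 * C\<^sup>2"
      using zero_le_power2[of "a + b"] zero_le_power2[of C] by linarith
    then show ?thesis using 2 assms by (auto simp: upper_def[of c a] defect_kernel_def)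
  next
    case 3
    have "\<bar>upper c a i\<bar> \<le> \<bar>2 * C\<bar>" using u by linarith
    then have "(upper c a i)\<^sup>2 \<le> (2 * C)\<^sup>2" by (simp only: abs_le_square_iff)
    moreover have "(2 * C)\<^sup>2 = 4 * C\<^sup>2" by (simp add: power_mult_distrib)
    ultimately have "(upper c a i)\<^sup>2 \<le> (a + b)\<^sup>2 + 8 * C\<^sup>2"
      using zero_le_power2[of "a + b"] zero_le_power2[of C] by linarith
    then show ?thesis using 3 assms by (auto simp: upper_def[of c b] defect_kernel_def)
  next
    case 4
    have "\<bar>upper c a i + upper c b j\<bar> \<le> \<bar>4 * C\<bar>" using u by linarith
    then have "(upper c a i + upper c b j)\<^sup>2 \<le> (4 * C)\<^sup>2" by (simp only: abs_le_square_iff)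
    moreover have "(4 * C)\<^sup>2 = 16 * C\<^sup>2" by (simp add: power_mult_distrib)
    moreover have "defect_kernel i j = 1" using 4 False assms by (auto simp: defect_kernel_def)
    ultimately show ?thesis using zero_le_power2[of "a + b"] unfolding \<open>defect_kernel i j = 1\<close> by linarith
  qed
qed

text \<open>The cut level \<open>c\<close> equalises the two halves; orthogonality to \<open>sgn_pair A B\<close> says that \<open>f\<close>,
  multiplied by the sign, has mean zero on \<open>A \<union> B\<close>, so the halves carry all of its norm there.\<close>

lemma split_pair:
  assumes f: "simple_function M f" and C: "0 \<le> C" "\<And>x. x \<in> space M \<Longrightarrow> \<bar>f x\<bar> \<le> C"
    and AB: "A \<in> sets M" "B \<in> sets M" "A \<inter> B = {}"
    and orth: "L2_inner M f (sgn_pair A B) = 0" and \<kappa>: "\<kappa> > 0"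
    and small: "energy f + 8 * C\<^sup>2 * defect A B < \<kappa>\<^sup>2 / 4 * (nrm (\<lambda>x. if x \<in> A \<union> B then f x else 0))\<^sup>2"
  shows "\<exists>A1 B1 A2 B2. good_pair \<kappa> A1 B1 \<and> good_pair \<kappa> A2 B2 \<and> A1 \<union> B1 \<subseteq> A \<union> B \<and> A2 \<union> B2 \<subseteq> A \<union> B \<and>
      (A1 \<union> B1) \<inter> (A2 \<union> B2) = {}"
proof -
  define F where "F x = (f x, lab A B x)" for x
  have F: "simple_function M F" unfolding F_def using f AB by (intro simple_function_Pair simple_lab)
  define \<rho> where "\<rho> c u = (upper c (fst u) (snd u))\<^sup>2 - (lower c (fst u) (snd u))\<^sup>2" for c u
  define g where "g c = W F (\<lambda>u v. \<rho> c u)" for c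
  have cont: "continuous_on {-C..C} g"
  proof -
    have "continuous_on {-C..C} (\<lambda>c. \<rho> c u)" for u
      unfolding \<rho>_def upper_def lower_def
      by (cases "snd u = 1"; cases "snd u = 2") (auto intro!: continuous_intros)
    then show ?thesis unfolding g_def W_def by (intro continuous_intros)
  qed
  have W0: "W F (\<lambda>u v. 0) = 0" by (simp add: W_def)
  \<comment> \<open>As \<open>\<bar>f x\<bar> \<le> C\<close>, the lower half vanishes at level
    \<open>-C\<close> and the upper half at level \<open>C\<close>, so \<open>g\<close> has a zero
    in between.\<close>
  have "W F (\<lambda>u v. 0) \<le> g (-C)"
    unfolding g_def by (rule W_mono[OF F]) (use C(2) in \<open>force simp: F_def \<rho>_def lower_def upper_def abs_le_iff max_def\<close>)
  moreover have "g C \<le> W F (\<lambda>u v. 0)"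
    unfolding g_def by (rule W_mono[OF F]) (use C(2) in \<open>force simp: F_def \<rho>_def lower_def upper_def abs_le_iff max_def\<close>)
  ultimately obtain c where c: "-C \<le> c" "c \<le> C" "g c = 0"
    using IVT2'[of g C 0 "-C"] C(1) cont W0 by auto
  define p where "p x = upper c (f x) (lab A B x)" for x
  define q where "q x = lower c (f x) (lab A B x)" for x
  have simp_pq: "simple_function M p" "simple_function M q"
    using simple_function_compose1[OF F, of "\<lambda>u. upper c (fst u) (snd u)"]
      simple_function_compose1[OF F, of "\<lambda>u. lower c (fst u) (snd u)"] by (simp_all add: p_def[abs_def] q_def[abs_def] F_def)
  have np: "(nrm p)\<^sup>2 = W F (\<lambda>u v. (upper c (fst u) (snd u))\<^sup>2)"
    using nrm_simple[OF F, of "\<lambda>u. upper c (fst u) (snd u)"] by (simp add: p_def[abs_def] F_def)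
  have nq: "(nrm q)\<^sup>2 = W F (\<lambda>u v. (lower c (fst u) (snd u))\<^sup>2)"
    using nrm_simple[OF F, of "\<lambda>u. lower c (fst u) (snd u)"] by (simp add: q_def[abs_def] F_def)
  have eq: "(nrm p)\<^sup>2 = (nrm q)\<^sup>2" using c(3) by (simp add: g_def \<rho>_def W_diff np nq)
  define N where "N = (nrm (\<lambda>x. if x \<in> A \<union> B then f x else 0))\<^sup>2"
  have labAB: "lab A B x \<noteq> 0 \<longleftrightarrow> x \<in> A \<union> B" for x by (auto simp: lab_def)
  have N: "N = W F (\<lambda>u v. (if snd u \<noteq> 0 then fst u else 0)\<^sup>2)"
    using nrm_simple[OF F, of "\<lambda>u. if snd u \<noteq> 0 then fst u else 0"] by (simp only: N_def F_def fst_conv snd_conv labAB)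
  have sg: "sgn_pair A B = (\<lambda>x. if lab A B x = 1 then 1 else if lab A B x = 2 then - 1 else 0)"
    using AB by (auto simp: lab_def sgn_pair_def fun_eq_iff indicator_def)
  have orthW: "W F (\<lambda>u v. fst u * (if snd u = 1 then 1 else if snd u = 2 then - 1 else 0)) = 0"
    using ip_simple[OF F, of fst "\<lambda>u. if snd u = 1 then 1 else if snd u = 2 then - 1 else 0"] orth
    by (simp only: F_def fst_conv snd_conv sg)
  have Wn: "0 \<le> W F (\<lambda>u v. of_bool (snd u \<noteq> 0))"
    unfolding measure_simple[OF F, of "\<lambda>u. snd u \<noteq> 0", symmetric] by (rule measure_nonneg)
  have split: "(max x 0)\<^sup>2 + (max (- x) 0)\<^sup>2 = x\<^sup>2" for x :: real by (simp add: max_def)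
  \<comment> \<open>This expands the integral of (s f - c)^2 over the pair; the cross term is zero
    by orthogonality.\<close>
  have "N \<le> N - (2 * c) * W F (\<lambda>u v. fst u * (if snd u = 1 then 1 else if snd u = 2 then - 1 else 0)) +
      c\<^sup>2 * W F (\<lambda>u v. of_bool (snd u \<noteq> 0))"
    unfolding orthW using mult_nonneg_nonneg[OF zero_le_power2[of c] Wn] by simp
  also have "\<dots> = W F (\<lambda>u v. (if snd u \<noteq> 0 then fst u else 0)\<^sup>2 -
      2 * c * (fst u * (if snd u = 1 then 1 else if snd u = 2 then - 1 else 0)) + c\<^sup>2 * of_bool (snd u \<noteq> 0))"
    by (simp only: W_add W_diff W_scale N)
  also have "\<dots> \<le> W F (\<lambda>u v. (upper c (fst u) (snd u))\<^sup>2 + (lower c (fst u) (snd u))\<^sup>2)"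
  proof (rule W_mono[OF F])
    fix u v assume "u \<in> F ` space M"
    then have "snd u \<in> {0,1,2}" by (auto simp: F_def lab_def split: if_splits)
    then show "(if snd u \<noteq> 0 then fst u else 0)\<^sup>2 -
        2 * c * (fst u * (if snd u = 1 then 1 else if snd u = 2 then - 1 else 0)) + c\<^sup>2 * of_bool (snd u \<noteq> 0)
        \<le> (upper c (fst u) (snd u))\<^sup>2 + (lower c (fst u) (snd u))\<^sup>2"
      using split[of "fst u - c"] split[of "- fst u - c"]
      by (auto simp: upper_def lower_def power2_eq_square algebra_simps)
  qed
  also have "\<dots> = (nrm p)\<^sup>2 + (nrm q)\<^sup>2" by (simp add: W_add np nq)
  finally have Np: "N / 2 \<le> (nrm p)\<^sup>2" "N / 2 \<le> (nrm q)\<^sup>2" using eq by auto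
  have Ep: "energy p \<le> energy f + 8 * C\<^sup>2 * defect A B"
    unfolding p_def by (rule energy_compare[OF f C(2) AB]) (use c upper_compare in auto)
  have Eq: "energy q \<le> energy f + 8 * C\<^sup>2 * defect A B"
    unfolding q_def
  proof (rule energy_compare[OF f C(2) AB])
    fix a b :: real and i j :: nat
    assume "\<bar>a\<bar> \<le> C" "\<bar>b\<bar> \<le> C" "i \<in> {0,1,2}" "j \<in> {0,1,2}"
    then show "(lower c a i + lower c b j)\<^sup>2 / 2 \<le> (a + b)\<^sup>2 / 2 + 8 * C\<^sup>2 * defect_kernel i j"
      using upper_compare[of "- a" C "- b" "- c" i j] c by (simp add: lower_eq_upper power2_commute add.commute)
  qed
  have half: "\<kappa>\<^sup>2 / 4 * N \<le> \<kappa>\<^sup>2 / 2 * y" if "N / 2 \<le> y" for y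
    using mult_left_mono[OF that, of "\<kappa>\<^sup>2 / 2"] by simp
  have "energy p < \<kappa>\<^sup>2 / 2 * (nrm p)\<^sup>2" "energy q < \<kappa>\<^sup>2 / 2 * (nrm q)\<^sup>2"
    using Ep Eq small half[OF Np(1)] half[OF Np(2)] unfolding N_def[symmetric] by linarith+
  from dual_Cheeger_level_sets[OF simp_pq(1) \<kappa> this(1)] dual_Cheeger_level_sets[OF simp_pq(2) \<kappa> this(2)]
  obtain A1 B1 A2 B2 where g: "good_pair \<kappa> A1 B1" "good_pair \<kappa> A2 B2"
    and s: "A1 \<union> B1 \<subseteq> {x \<in> space M. p x \<noteq> 0}" "A2 \<union> B2 \<subseteq> {x \<in> space M. q x \<noteq> 0}" by blast
  have "p x \<noteq> 0 \<Longrightarrow> x \<in> A \<union> B" "q x \<noteq> 0 \<Longrightarrow> x \<in> A \<union> B" "p x \<noteq> 0 \<Longrightarrow> q x = 0" for x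
    by (auto simp: p_def q_def upper_def lower_def lab_def max_def split: if_splits)
  then have "A1 \<union> B1 \<subseteq> A \<union> B" "A2 \<union> B2 \<subseteq> A \<union> B" "(A1 \<union> B1) \<inter> (A2 \<union> B2) = {}" using s by fast+
  then show ?thesis using g by blast
qed

section \<open>Families of pairs and the spectral gap\<close>

definition pair_family :: "nat \<Rightarrow> real \<Rightarrow> (nat \<Rightarrow> 'a set) \<Rightarrow> (nat \<Rightarrow> 'a set) \<Rightarrow> bool" where
  "pair_family k \<delta> A B \<longleftrightarrow> (\<forall>i<k. good_pair \<delta> (A i) (B i)) \<and>
      (\<forall>i<k. \<forall>j<k. i \<noteq> j \<longrightarrow> (A i \<union> B i) \<inter> (A j \<union> B j) = {})"

lemma pair_familyD:
  assumes "pair_family k \<delta> A B" "i < k"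
  shows "good_pair \<delta> (A i) (B i)" "A i \<in> sets M" "B i \<in> sets M" "A i \<inter> B i = {}"
  using assms by (auto simp: pair_family_def good_pair_def)

lemma pair_family_disjoint:
  "pair_family k \<delta> A B \<Longrightarrow> i < k \<Longrightarrow> j < k \<Longrightarrow> i \<noteq> j \<Longrightarrow> (A i \<union> B i) \<inter> (A j \<union> B j) = {}"
  by (auto simp: pair_family_def)

lemma good_pair_mono: "good_pair \<delta> A B \<Longrightarrow> \<delta> \<le> \<kappa> \<Longrightarrow> good_pair \<kappa> A B"
  unfolding good_pair_def by (smt (verit) mult_right_mono)

lemma good_pair_defect:
  assumes "good_pair \<delta> A B" "\<delta> > 0"
  shows "defect A B \<le> \<delta> * measure M (A \<union> B)" "defect A B \<le> \<delta>"
proof -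
  show "defect A B \<le> \<delta> * measure M (A \<union> B)"
    using assms by (simp add: good_pair_def defect_def algebra_simps)
  also have "\<dots> \<le> \<delta>" using assms(2) by (simp add: mult_left_le)
  finally show "defect A B \<le> \<delta>" .
qed

lemma pair_family_add:
  assumes "pair_family k \<delta> A B" "\<delta> \<le> \<kappa>" "good_pair \<kappa> A' B'"
    and "\<And>i. i < k \<Longrightarrow> (A i \<union> B i) \<inter> (A' \<union> B') = {}"
  shows "pair_family (Suc k) \<kappa> (A(k := A')) (B(k := B'))"
proof -
  have "good_pair \<kappa> (A i) (B i)" if "i < k" for i
    using pair_familyD(1)[OF assms(1) that] assms(2) by (rule good_pair_mono)
  then show ?thesis
    using assms(3,4) pair_family_disjoint[OF assms(1)] unfolding pair_family_def less_Suc_eq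
    by (auto simp: Int_commute)
qed

lemma pair_family_replace:
  assumes "pair_family k \<delta> A B" "\<delta> \<le> \<kappa>" "i < k" "good_pair \<kappa> A' B'" "A' \<union> B' \<subseteq> A i \<union> B i"
  shows "pair_family k \<kappa> (A(i := A')) (B(i := B'))"
proof -
  have "good_pair \<kappa> (A j) (B j)" if "j < k" for j
    using pair_familyD(1)[OF assms(1) that] assms(2) by (rule good_pair_mono)
  moreover have "(A' \<union> B') \<inter> (A j \<union> B j) = {}" if "j < k" "j \<noteq> i" for j
    using pair_family_disjoint[OF assms(1) assms(3) that(1)] that(2) assms(5) by blast
  ultimately show ?thesis
    using assms(4) pair_family_disjoint[OF assms(1)] unfolding pair_family_def
    by (auto simp: Int_commute)
qed

text \<open>The pairs are removed one after the other, each at the price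
  \<open>8 * C\<^sup>2 * \<delta>\<close>; disjoint supports give the Pythagorean identity.\<close>

lemma energy_outside_family:
  assumes f: "simple_function M f" and C: "\<And>x. x \<in> space M \<Longrightarrow> \<bar>f x\<bar> \<le> C"
    and AB: "pair_family k \<delta> A B" "\<delta> > 0" and m: "m \<le> k"
  defines "g \<equiv> \<lambda>m x. if x \<in> (\<Union>i<m. A i \<union> B i) then 0 else f x"
  shows "simple_function M (g m)" "energy (g m) \<le> energy f + real m * (8 * C\<^sup>2 * \<delta>)"
    "(nrm f)\<^sup>2 = (nrm (g m))\<^sup>2 + (\<Sum>i<m. (nrm (\<lambda>x. if x \<in> A i \<union> B i then f x else 0))\<^sup>2)"
proof -
  have "simple_function M (g m) \<and> energy (g m) \<le> energy f + real m * (8 * C\<^sup>2 * \<delta>) \<and>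
    (nrm f)\<^sup>2 = (nrm (g m))\<^sup>2 + (\<Sum>i<m. (nrm (\<lambda>x. if x \<in> A i \<union> B i then f x else 0))\<^sup>2)"
    using m
  proof (induction m)
    case 0
    then show ?case using f by (simp add: g_def)
  next
    case (Suc m)
    note AB' = pair_familyD[OF AB(1), of m]
    have mk: "m < k" using Suc.prems by simp
    have IH: "simple_function M (g m)" "energy (g m) \<le> energy f + real m * (8 * C\<^sup>2 * \<delta>)"
      "(nrm f)\<^sup>2 = (nrm (g m))\<^sup>2 + (\<Sum>i<m. (nrm (\<lambda>x. if x \<in> A i \<union> B i then f x else 0))\<^sup>2)"
      using Suc by auto
    have gS: "g (Suc m) = (\<lambda>x. if x \<in> A m \<union> B m then 0 else g m x)"
      by (auto simp: g_def less_Suc_eq fun_eq_iff)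
    have Cm: "\<bar>g m x\<bar> \<le> C" if "x \<in> space M" for x
      using C[OF that] by (auto simp: g_def)
    have S: "A m \<union> B m \<in> sets M" using AB'(2,3)[OF mk] by blast
    then have Ssp: "(A m \<union> B m) \<inter> space M \<in> sets M" by auto
    have simple: "simple_function M (g (Suc m))"
      unfolding gS using IH(1) Ssp by (intro simple_function_If_set simple_function_const) auto
    have simple': "simple_function M (\<lambda>x. if x \<in> A m \<union> B m then g m x else 0)"
      using IH(1) Ssp by (intro simple_function_If_set simple_function_const) auto
    have "energy (g (Suc m)) \<le> energy (g m) + 8 * C\<^sup>2 * defect (A m) (B m)"
      unfolding gS by (rule energy_outside[OF IH(1) Cm AB'(2-4)[OF mk]])
    also have "8 * C\<^sup>2 * defect (A m) (B m) \<le> 8 * C\<^sup>2 * \<delta>"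
      using good_pair_defect(2)[OF AB'(1)[OF mk] AB(2)] by (intro mult_left_mono) auto
    finally have E: "energy (g (Suc m)) \<le> energy f + real (Suc m) * (8 * C\<^sup>2 * \<delta>)"
      using IH(2) by (simp add: algebra_simps)
    \<comment> \<open>Taking the piece from \<open>g m\<close> makes the splitting exact; the piece
      is also one of \<open>f\<close>, since the earlier pairs are disjoint from this one.\<close>
    define u where "u x = (if x \<in> A m \<union> B m then g m x else 0)" for x
    have uS: "simple_function M u" using simple' by (simp add: u_def[abs_def])
    have L2s: "g m \<in> L2 M" "g (Suc m) \<in> L2 M" "u \<in> L2 M"
      using simple_L2[OF IH(1)] simple_L2[OF simple] simple_L2[OF uS] by auto
    have "L2_inner M (g m) (g m) = (\<integral>x. g (Suc m) x * g (Suc m) x + u x * u x \<partial>M)"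
      unfolding L2_inner_def gS u_def by (intro Bochner_Integration.integral_cong) auto
    also have "\<dots> = L2_inner M (g (Suc m)) (g (Suc m)) + L2_inner M u u"
      using L2_integrable_mult[OF L2s(2,2)] L2_integrable_mult[OF L2s(3,3)] by (simp add: L2_inner_def)
    finally have "(nrm (g m))\<^sup>2 = (nrm (g (Suc m)))\<^sup>2 + (nrm u)\<^sup>2"
      using L2s by (simp only: nrm_power2)
    moreover have "u = (\<lambda>x. if x \<in> A m \<union> B m then f x else 0)"
    proof
      fix x
      have "x \<notin> (\<Union>i<m. A i \<union> B i)" if "x \<in> A m \<union> B m"
      proof
        assume "x \<in> (\<Union>i<m. A i \<union> B i)"
        then obtain i where i: "i < m" "x \<in> A i \<union> B i" by blast
        then have "(A i \<union> B i) \<inter> (A m \<union> B m) = {}" using mk by (intro pair_family_disjoint[OF AB(1)]) auto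
        then show False using i that by blast
      qed
      then show "u x = (if x \<in> A m \<union> B m then f x else 0)"
        by (cases "x \<in> A m \<union> B m") (simp_all only: u_def g_def if_False if_True simp_thms)
    qed
    ultimately have "(nrm f)\<^sup>2 = (nrm (g (Suc m)))\<^sup>2 +
        (\<Sum>i<Suc m. (nrm (\<lambda>x. if x \<in> A i \<union> B i then f x else 0))\<^sup>2)"
      using IH(3) by simp
    then show ?case using simple E by blast
  qed
  then show "simple_function M (g m)" "energy (g m) \<le> energy f + real m * (8 * C\<^sup>2 * \<delta>)"
    "(nrm f)\<^sup>2 = (nrm (g m))\<^sup>2 + (\<Sum>i<m. (nrm (\<lambda>x. if x \<in> A i \<union> B i then f x else 0))\<^sup>2)" by auto
qed

lemma nrm_sum_le:
  assumes "\<And>i. i < n \<Longrightarrow> x i \<in> L2 M"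
  shows "nrm (\<Sum>i<n::nat. x i) \<le> (\<Sum>i<n. nrm (x i))"
  using assms
proof (induction n)
  case 0
  have "nrm 0 = 0" unfolding nrm_def using ip_zero(2)[OF H_closed(1)] by (simp only: real_sqrt_zero)
  then show ?case by (simp only: lessThan_0 sum.empty)
next
  case (Suc n)
  have "nrm ((\<Sum>i<n. x i) + x n) \<le> nrm (\<Sum>i<n. x i) + nrm (x n)"
    using Suc.prems by (intro nrm_triangle H_sum) auto
  moreover have "nrm (\<Sum>i<n. x i) \<le> (\<Sum>i<n. nrm (x i))" using Suc by simp
  ultimately show ?case unfolding sum.lessThan_Suc by linarith
qed

lemma symop_T: "symop (shift P (-1))" and bound_op_T: "bound_op (shift P (-1)) 2"
  using symop_shift[OF symop_P] bound_op_shift[OF symop_P bound_op_P, of "-1"] by auto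

lemma energy_scale: "f \<in> L2 M \<Longrightarrow> energy (c *\<^sub>R f) = c\<^sup>2 * energy f"
  unfolding energy_def using symop_T by (simp add: symop_linear ip_simps power2_eq_square)

lemma energy_combination_le:
  assumes "\<And>l. l < n \<Longrightarrow> x l \<in> L2 M"
  shows "energy (\<Sum>l<n. a l *\<^sub>R x l) \<le> 2 ^ n * (\<Sum>l<n. (a l)\<^sup>2 * energy (x l))"
proof -
  have "energy (\<Sum>l<n. a l *\<^sub>R x l) \<le> 2 ^ n * (\<Sum>l<n. energy (a l *\<^sub>R x l))"
    unfolding energy_def
    by (rule psd_form_sum_le[OF symop_T]) (use energy_nonneg assms in \<open>auto simp: energy_def\<close>)
  also have "(\<Sum>l<n. energy (a l *\<^sub>R x l)) = (\<Sum>l<n. (a l)\<^sup>2 * energy (x l))"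
    using assms by (intro sum.cong) (auto simp: energy_scale)
  finally show ?thesis .
qed

lemma extend_pair_family:
  assumes nogap: "\<And>K \<epsilon>. finite K \<Longrightarrow> K \<subseteq> L2 M \<Longrightarrow> \<epsilon> > 0 \<Longrightarrow> \<not> gap (shift P (-1)) K \<epsilon>"
    and fam: "\<And>\<delta>. \<delta> > 0 \<Longrightarrow> \<exists>A B. pair_family j \<delta> A B" and \<kappa>: "\<kappa> > 0"
  shows "\<exists>A B. pair_family (Suc j) \<kappa> A B"
proof -
  \<comment> \<open>\<open>n\<close> counts the \<open>j\<close> pairs and their common complement,
    and it exceeds by one the number of orthogonality conditions. One of the \<open>n\<close>
    regions carries at least \<open>1 / (4 * n)\<close> of the squared norm.\<close>
  define n where "n = Suc j"
  have n: "real n > 0" by (simp add: n_def)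
  \<comment> \<open>This is \<open>\<kappa>\<^sup>2 / 4\<close> times the guaranteed mass
    \<open>1 / (4 * n)\<close>, the energy budget in \<open>split_pair\<close>.\<close>
  define \<theta> where "\<theta> = \<kappa>\<^sup>2 / (16 * n)"
  have \<theta>: "\<theta> > 0" using \<kappa> n by (simp add: \<theta>_def)
  \<comment> \<open>Each approximating function has energy at most \<open>4 * \<eta>\<close> and a
    combination costs a factor \<open>2 ^ n\<close>, which spends half of \<theta>.\<close>
  define \<eta> where "\<eta> = \<theta> / (8 * 2 ^ n)"
  have \<eta>: "\<eta> > 0" using \<theta> by (simp add: \<eta>_def)
  \<comment> \<open>The first term controls the energy lost by passing to simple functions, the
    second keeps a normalised combination within 1/2 of a unit vector.\<close>
  define \<tau> where "\<tau> = min (sqrt (\<eta> / 2)) (1 / (2 * n))"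
  have \<tau>: "\<tau> > 0" "real n * \<tau> \<le> 1/2" "\<tau>\<^sup>2 \<le> \<eta> / 2"
  proof -
    show \<tau>0: "\<tau> > 0" using \<eta> n by (simp add: \<tau>_def)
    have "real n * \<tau> \<le> real n * (1 / (2 * n))" by (intro mult_left_mono) (auto simp: \<tau>_def)
    then show "real n * \<tau> \<le> 1/2" using n by simp
    have "\<tau>\<^sup>2 \<le> (sqrt (\<eta> / 2))\<^sup>2" using \<tau>0 by (intro power_mono) (auto simp: \<tau>_def)
    then show "\<tau>\<^sup>2 \<le> \<eta> / 2" using \<eta> by simp
  qed
  have psd: "0 \<le> L2_inner M (shift P (-1) x) x" if "x \<in> L2 M" for x
    using energy_nonneg[OF that] by (simp add: energy_def)
  have "\<exists>v. (\<forall>i<n. v i \<in> L2 M \<and> L2_inner M (shift P (-1) (v i)) (v i) < \<eta>) \<and>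
      (\<forall>i<n. \<forall>k<n. L2_inner M (v i) (v k) = (if i = k then 1 else 0))"
    by (rule no_gap_orthonormal_family[OF symop_T nogap psd \<eta>])
  then obtain v where v: "\<And>i. i < n \<Longrightarrow> v i \<in> L2 M" "\<And>i. i < n \<Longrightarrow> energy (v i) < \<eta>"
    "\<And>i k. i < n \<Longrightarrow> k < n \<Longrightarrow> L2_inner M (v i) (v k) = (if i = k then 1 else 0)"
    by (auto simp: energy_def)
  have "\<exists>w c. simple_function M w \<and> nrm (w - v i) < \<tau> \<and> c \<ge> 0 \<and> (\<forall>x\<in>space M. \<bar>w x\<bar> \<le> c)" if i: "i < n" for i
  proof -
    obtain s where s: "\<And>m. simple_function M (s m)" "(\<lambda>m. nrm (s m - v i)) \<longlonglongrightarrow> 0"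
      using simple_dense[OF v(1)[OF i]] by blast
    obtain m where m: "nrm (s m - v i) < \<tau>"
      using order_tendstoD(2)[OF s(2) \<tau>(1)] by (auto simp: eventually_sequentially)
    obtain c where "c \<ge> 0" "\<And>x. x \<in> space M \<Longrightarrow> \<bar>s m x\<bar> \<le> c" using simple_bounded[OF s(1)] by blast
    then show ?thesis using s(1) m by blast
  qed
  then obtain w c where w: "\<And>i. i < n \<Longrightarrow> simple_function M (w i)" "\<And>i. i < n \<Longrightarrow> nrm (w i - v i) < \<tau>"
    and c: "\<And>i. i < n \<Longrightarrow> c i \<ge> 0" "\<And>i x. i < n \<Longrightarrow> x \<in> space M \<Longrightarrow> \<bar>w i x\<bar> \<le> c i" by metis
  have wL2: "w i \<in> L2 M" if "i < n" for i using simple_L2[OF w(1)[OF that]] .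
  have Ew: "energy (w i) \<le> 4 * \<eta>" if i: "i < n" for i
  proof -
    have d: "w i - v i \<in> L2 M" using wL2[OF i] v(1)[OF i] by blast
    have "w i = v i + (w i - v i)" by simp
    then have "energy (w i) \<le> 2 * energy (v i) + 2 * energy (w i - v i)"
      using psd_form_add_le(1)[OF symop_T v(1)[OF i] d psd] by (simp only: energy_def)
    also have "\<dots> \<le> 2 * \<eta> + 2 * (2 * (nrm (w i - v i))\<^sup>2)"
      using v(2)[OF i] energy_le[OF d] by linarith
    also have "(nrm (w i - v i))\<^sup>2 \<le> \<tau>\<^sup>2" using w(2)[OF i] d by (intro power_mono) auto
    finally show ?thesis using \<tau>(3) by linarith
  qed
  define C where "C = (\<Sum>i<n. c i)"
  have C0: "0 \<le> C" unfolding C_def using c(1) by (intro sum_nonneg) auto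
  \<comment> \<open>Fixed only now, as it depends on the sup bound \<open>C\<close>; the cuts along
    all pairs then cost at most \<open>\<theta> / 4\<close>.\<close>
  define \<delta> where "\<delta> = min \<kappa> (\<theta> / (32 * (C\<^sup>2 + 1) * n))"
  have C1: "0 < 32 * (C\<^sup>2 + 1) * real n" using n by (intro mult_pos_pos) (auto intro: add_nonneg_pos)
  have \<delta>: "\<delta> > 0" "\<delta> \<le> \<kappa>" using \<kappa> \<theta> C1 by (auto simp: \<delta>_def)
  have C\<delta>: "real n * (8 * C\<^sup>2 * \<delta>) \<le> \<theta> / 4"
  proof -
    have "real n * (8 * C\<^sup>2 * \<delta>) \<le> (8 * (C\<^sup>2 + 1) * n) * \<delta>" using n \<delta> by (simp add: algebra_simps)
    also have "\<dots> \<le> (8 * (C\<^sup>2 + 1) * n) * (\<theta> / (32 * (C\<^sup>2 + 1) * n))"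
      using n by (intro mult_left_mono) (auto simp: \<delta>_def)
    also have "\<dots> = \<theta> / 4" using C1 by (simp add: field_simps)
    finally show ?thesis .
  qed
  obtain A B where AB: "pair_family j \<delta> A B" using fam[OF \<delta>(1)] by blast
  define s where "s i = sgn_pair (A i) (B i)" for i
  have sL2: "s i \<in> L2 M" if "i < j" for i
    using pair_familyD[OF AB that] by (simp add: s_def sgn_pair_L2)
  obtain b where b: "\<exists>l\<in>{..<n}. b l \<noteq> 0" "\<forall>i\<in>{..<j}. (\<Sum>l<n. b l * L2_inner M (w l) (s i)) = 0"
    using homogeneous_system_nontrivial[of "{..<j}" "{..<n}" "\<lambda>i l. L2_inner M (w l) (s i)"] by (auto simp: n_def)
  define r where "r = (\<Sum>l<n. (b l)\<^sup>2)"
  have r: "r > 0" using b(1) unfolding r_def by (auto intro!: sum_pos2)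
  define a where "a l = b l / sqrt r" for l
  have a1: "(\<Sum>l<n. (a l)\<^sup>2) = 1"
    using r by (simp add: a_def power_divide sum_divide_distrib[symmetric] r_def[symmetric])
  have al: "\<bar>a l\<bar> \<le> 1" if "l < n" for l
  proof -
    have "(a l)\<^sup>2 \<le> (\<Sum>l<n. (a l)\<^sup>2)" using that by (intro member_le_sum) auto
    then show ?thesis using a1 by (simp add: abs_square_le_1)
  qed
  define f where "f = (\<Sum>l<n. a l *\<^sub>R w l)"
  have f_apply: "f x = (\<Sum>l<n. a l * w l x)" for x by (simp add: f_def sum_fun_apply)
  have fs: "simple_function M f"
  proof -
    have "simple_function M (\<lambda>x. \<Sum>l<n. a l * w l x)"
      using w(1) by (intro simple_function_sum simple_function_mult simple_function_const) auto
    then show ?thesis by (simp add: f_apply[abs_def, symmetric])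
  qed
  have fL2: "f \<in> L2 M" using fs by (rule simple_L2)
  have fC: "\<bar>f x\<bar> \<le> C" if x: "x \<in> space M" for x
  proof -
    have "\<bar>f x\<bar> \<le> (\<Sum>l<n. \<bar>a l * w l x\<bar>)" unfolding f_apply by (rule sum_abs)
    also have "\<dots> \<le> (\<Sum>l<n. 1 * c l)"
      unfolding abs_mult using al c x by (intro sum_mono mult_mono) auto
    finally show ?thesis by (simp add: C_def)
  qed
  have fs0: "L2_inner M f (s i) = 0" if i: "i < j" for i
  proof -
    have "L2_inner M f (s i) = (\<Sum>l<n. L2_inner M (a l *\<^sub>R w l) (s i))"
      unfolding f_def using wL2 sL2[OF i] by (intro ip_sum_left) auto
    also have "\<dots> = (\<Sum>l<n. b l * L2_inner M (w l) (s i)) / sqrt r"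
      using wL2 sL2[OF i] by (simp add: ip_simps a_def sum_divide_distrib)
    finally show ?thesis using b(2) i by simp
  qed
  have Ef: "energy f \<le> \<theta> / 2"
  proof -
    have "energy f \<le> 2 ^ n * (\<Sum>l<n. (a l)\<^sup>2 * energy (w l))"
      unfolding f_def by (rule energy_combination_le) (rule wL2)
    also have "\<dots> \<le> 2 ^ n * (\<Sum>l<n. (a l)\<^sup>2 * (4 * \<eta>))"
      using Ew by (intro mult_left_mono sum_mono) auto
    also have "\<dots> = 2 ^ n * (4 * \<eta>)" unfolding sum_distrib_right[symmetric] a1 by simp
    also have "\<dots> = \<theta> / 2" by (simp add: \<eta>_def)
    finally show ?thesis .
  qed
  have f2: "1/4 \<le> (nrm f)\<^sup>2"
  proof -
    define g where "g = (\<Sum>l<n. a l *\<^sub>R v l)"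
    have gL2: "g \<in> L2 M" unfolding g_def using v(1) by auto
    have "L2_inner M g g = (\<Sum>l<n. L2_inner M (a l *\<^sub>R v l) g)"
      unfolding g_def using v(1) by (intro ip_sum_left) auto
    also have "\<dots> = (\<Sum>l<n. (a l)\<^sup>2)"
    proof (intro sum.cong refl)
      fix l assume l: "l \<in> {..<n}"
      have "L2_inner M (v l) g = (\<Sum>k<n. L2_inner M (v l) (a k *\<^sub>R v k))"
        unfolding g_def using v(1) l by (intro ip_sum_right) auto
      also have "\<dots> = (\<Sum>k<n. if k = l then a l else 0)"
        using v l by (intro sum.cong) (auto simp: ip_simps)
      also have "\<dots> = a l" using l by simp
      finally show "L2_inner M (a l *\<^sub>R v l) g = (a l)\<^sup>2"
        using v(1) l gL2 by (simp add: ip_simps power2_eq_square)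
    qed
    finally have g1: "nrm g = 1" using a1 by (simp add: nrm_def)
    have "f - g = (\<Sum>l<n. a l *\<^sub>R (w l - v l))"
      by (simp add: f_def g_def scaleR_diff_right sum_subtractf)
    then have "nrm (f - g) \<le> (\<Sum>l<n. nrm (a l *\<^sub>R (w l - v l)))"
      using nrm_sum_le[of n "\<lambda>l. a l *\<^sub>R (w l - v l)"] wL2 v(1) by simp
    also have "\<dots> \<le> (\<Sum>l<n. 1 * \<tau>)"
    proof (rule sum_mono)
      fix l assume "l \<in> {..<n}"
      then have l: "l < n" by simp
      have d: "w l - v l \<in> L2 M" using wL2[OF l] v(1)[OF l] by blast
      show "nrm (a l *\<^sub>R (w l - v l)) \<le> 1 * \<tau>"
        unfolding nrm_scale[OF d] using al[OF l] w(2)[OF l] d by (intro mult_mono) auto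
    qed
    also have "\<dots> \<le> 1/2" using \<tau>(2) by simp
    finally have "1/2 \<le> nrm f"
      using nrm_le_diff[OF gL2 fL2] nrm_minus_commute[OF gL2 fL2] g1 by simp
    then have "(1/2)\<^sup>2 \<le> (nrm f)\<^sup>2" by (intro power_mono) auto
    then show ?thesis by (simp add: power2_eq_square)
  qed
  define g where "g = (\<lambda>x. if x \<in> (\<Union>i<j. A i \<union> B i) then 0 else f x)"
  define h where "h i = (\<lambda>x. if x \<in> A i \<union> B i then f x else 0)" for i
  note out = energy_outside_family[OF fs fC AB \<delta>(1) order_refl, folded g_def h_def]
  have sum4: "1/4 \<le> (nrm g)\<^sup>2 + (\<Sum>i<j. (nrm (h i))\<^sup>2)" using f2 out(3) by simp
  have j8: "real j * (8 * C\<^sup>2 * \<delta>) \<le> \<theta> / 4"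
  proof -
    have "real j * (8 * C\<^sup>2 * \<delta>) \<le> real n * (8 * C\<^sup>2 * \<delta>)" using \<delta> by (intro mult_right_mono) (auto simp: n_def)
    then show ?thesis using C\<delta> by simp
  qed
  show ?thesis
  proof (cases "1 / (4 * n) \<le> (nrm g)\<^sup>2")
    case True
    have "energy g \<le> \<theta> / 2 + \<theta> / 4" using out(2) Ef j8 by simp
    also have "\<dots> < 2 * \<theta>" using \<theta> by simp
    also have "\<dots> = \<kappa>\<^sup>2 / 2 * (1 / (4 * n))" by (simp add: \<theta>_def)
    also have "\<dots> \<le> \<kappa>\<^sup>2 / 2 * (nrm g)\<^sup>2" using True by (intro mult_left_mono) auto
    finally have "energy g < \<kappa>\<^sup>2 / 2 * (nrm g)\<^sup>2" .
    from dual_Cheeger_level_sets[OF out(1) \<kappa> this]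
    obtain A' B' where A': "good_pair \<kappa> A' B'" "A' \<union> B' \<subseteq> {x \<in> space M. g x \<noteq> 0}" by blast
    have "(A i \<union> B i) \<inter> (A' \<union> B') = {}" if "i < j" for i
    proof -
      have "g x = 0" if "x \<in> A i \<union> B i" for x using that \<open>i < j\<close> by (auto simp: g_def)
      then show ?thesis using A'(2) by blast
    qed
    from pair_family_add[OF AB \<delta>(2) A'(1) this] show ?thesis by blast
  next
    case False
    have "\<exists>i<j. 1 / (4 * n) \<le> (nrm (h i))\<^sup>2"
    proof (rule ccontr)
      assume "\<not> ?thesis"
      then have "(\<Sum>i<j. (nrm (h i))\<^sup>2) \<le> (\<Sum>i<j. 1 / (4 * n))" by (intro sum_mono) (auto simp: not_le less_imp_le)
      then have "1/4 < 1 / (4 * n) + real j * (1 / (4 * n))" using sum4 False by simp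
      also have "\<dots> = 1/4" using n by (simp add: n_def field_simps)
      finally show False by simp
    qed
    then obtain i where i: "i < j" "1 / (4 * n) \<le> (nrm (h i))\<^sup>2" by blast
    note ABi = pair_familyD[OF AB i(1)]
    have "8 * C\<^sup>2 * defect (A i) (B i) \<le> 8 * C\<^sup>2 * \<delta>"
      using good_pair_defect(2)[OF ABi(1) \<delta>(1)] by (intro mult_left_mono) auto
    also have "\<dots> \<le> real n * (8 * C\<^sup>2 * \<delta>)"
      using mult_right_mono[of 1 "real n" "8 * C\<^sup>2 * \<delta>"] \<delta> by (simp add: n_def)
    finally have "energy f + 8 * C\<^sup>2 * defect (A i) (B i) < \<theta>" using Ef C\<delta> \<theta> by linarith
    also have "\<theta> = \<kappa>\<^sup>2 / 4 * (1 / (4 * n))" by (simp add: \<theta>_def)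
    also have "\<dots> \<le> \<kappa>\<^sup>2 / 4 * (nrm (h i))\<^sup>2" using i(2) by (intro mult_left_mono) auto
    finally have small: "energy f + 8 * C\<^sup>2 * defect (A i) (B i) < \<kappa>\<^sup>2 / 4 * (nrm (h i))\<^sup>2" .
    obtain A1 B1 A2 B2 where s: "good_pair \<kappa> A1 B1" "good_pair \<kappa> A2 B2" "A1 \<union> B1 \<subseteq> A i \<union> B i"
      "A2 \<union> B2 \<subseteq> A i \<union> B i" "(A1 \<union> B1) \<inter> (A2 \<union> B2) = {}"
      using split_pair[OF fs C0 fC ABi(2-4) fs0[OF i(1), unfolded s_def] \<kappa> small[unfolded h_def]] by blast
    have "((A(i := A1)) k \<union> (B(i := B1)) k) \<inter> (A2 \<union> B2) = {}" if "k < j" for k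
      using s(4,5) pair_family_disjoint[OF AB that i(1)] by (cases "k = i") auto
    from pair_family_add[OF pair_family_replace[OF AB \<delta>(2) i(1) s(1,3)] order_refl s(2) this]
    show ?thesis by blast
  qed
qed

lemma gap_imp_no_pair_family:
  assumes K: "finite K" "K \<subseteq> L2 M" "\<epsilon> > 0" "gap (shift P (-1)) K \<epsilon>"
  shows "\<exists>k \<delta>. \<delta> > 0 \<and> (\<forall>A B. \<not> pair_family k \<delta> A B)"
proof (rule ccontr)
  \<comment> \<open>One more sign function than there are constraints, so some nontrivial
    combination lies in \<open>orth K\<close>.\<close>
  define k where "k = Suc (card K)"
  \<comment> \<open>A sign function has energy at most \<open>2 * \<delta>\<close> times its squared
    norm and a combination costs \<open>2 ^ k\<close>; orthogonality of the sign functions then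
    gives \<open>\<epsilon> / 2\<close> overall, below the gap.\<close>
  define \<delta> where "\<delta> = \<epsilon> / (4 * 2 ^ k)"
  have \<delta>: "\<delta> > 0" using K by (simp add: \<delta>_def)
  assume "\<not> ?thesis"
  then obtain A B where AB: "pair_family k \<delta> A B" using \<delta> by blast
  define s where "s i = sgn_pair (A i) (B i)" for i
  define \<mu> where "\<mu> i = measure M (A i \<union> B i)" for i
  have sL2: "s i \<in> L2 M" if "i < k" for i
    using pair_familyD[OF AB that] by (simp add: s_def sgn_pair_L2)
  have \<mu>: "\<mu> i > 0" if "i < k" for i
    using pair_familyD(1)[OF AB that] by (simp add: \<mu>_def good_pair_def)
  obtain a where a: "\<exists>l\<in>{..<k}. a l \<noteq> 0" "\<forall>z\<in>K. (\<Sum>l<k. a l * L2_inner M (s l) z) = 0"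
    using homogeneous_system_nontrivial[of K "{..<k}" "\<lambda>z l. L2_inner M (s l) z"] K by (auto simp: k_def)
  define f where "f = (\<Sum>l<k. a l *\<^sub>R s l)"
  have fL2: "f \<in> L2 M" unfolding f_def using sL2 by auto
  have "L2_inner M f z = 0" if "z \<in> K" for z
  proof -
    have zL2: "z \<in> L2 M" using that K by blast
    have "L2_inner M f z = (\<Sum>l<k. L2_inner M (a l *\<^sub>R s l) z)"
      unfolding f_def using sL2 zL2 by (intro ip_sum_left) auto
    also have "\<dots> = (\<Sum>l<k. a l * L2_inner M (s l) z)" using sL2 zL2 by (intro sum.cong) (auto simp: ip_simps)
    finally show ?thesis using a(2) that by simp
  qed
  then have fK: "f \<in> orth K" using fL2 by (simp add: orth_def)
  have ss: "L2_inner M (s l) (s m) = (if l = m then \<mu> l else 0)" if "l < k" "m < k" for l m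
  proof (cases "l = m")
    case True
    have "L2_inner M (s l) (s l) = (\<integral>x. indicator (A l \<union> B l) x \<partial>M)"
      unfolding L2_inner_def s_def sgn_pair_def using pair_familyD(4)[OF AB that(1)]
      by (intro Bochner_Integration.integral_cong) (auto simp: indicator_def)
    also have "\<dots> = \<mu> l" unfolding \<mu>_def
      using pair_familyD(2,3)[OF AB that(1)] sets.sets_into_space by (simp add: Int_absorb2)
    finally show ?thesis using True by simp
  next
    case False
    have "s l x * s m x = 0" for x
      using pair_family_disjoint[OF AB that False] by (auto simp: s_def sgn_pair_def indicator_def)
    then show ?thesis using False by (simp only: L2_inner_def integral_zero) simp
  qed
  have nf: "(nrm f)\<^sup>2 = (\<Sum>l<k. (a l)\<^sup>2 * \<mu> l)"
  proof -
    have "L2_inner M f f = (\<Sum>l<k. L2_inner M (a l *\<^sub>R s l) f)"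
      unfolding f_def using sL2 by (intro ip_sum_left) auto
    also have "\<dots> = (\<Sum>l<k. (a l)\<^sup>2 * \<mu> l)"
    proof (intro sum.cong refl)
      fix l assume l: "l \<in> {..<k}"
      have "L2_inner M (s l) f = (\<Sum>m<k. L2_inner M (s l) (a m *\<^sub>R s m))"
        unfolding f_def using sL2 l by (intro ip_sum_right) auto
      also have "\<dots> = (\<Sum>m<k. if m = l then a l * \<mu> l else 0)"
        using sL2 ss l by (intro sum.cong) (auto simp: ip_simps)
      also have "\<dots> = a l * \<mu> l" using l by simp
      finally show "L2_inner M (a l *\<^sub>R s l) f = (a l)\<^sup>2 * \<mu> l"
        using sL2 l fL2 by (simp add: ip_simps power2_eq_square)
    qed
    finally show ?thesis using fL2 by (simp add: nrm_power2)
  qed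
  have pos: "0 < (nrm f)\<^sup>2"
  proof -
    obtain l where "l < k" "a l \<noteq> 0" using a(1) by blast
    then show ?thesis unfolding nf using \<mu> by (intro sum_pos2[of _ l]) (auto simp: less_imp_le)
  qed
  have "energy f \<le> 2 ^ k * (\<Sum>l<k. (a l)\<^sup>2 * energy (s l))"
    unfolding f_def by (rule energy_combination_le) (rule sL2)
  also have "\<dots> \<le> 2 ^ k * (\<Sum>l<k. (a l)\<^sup>2 * (2 * (\<delta> * \<mu> l)))"
  proof (intro mult_left_mono sum_mono)
    fix l assume "l \<in> {..<k}"
    then have l: "l < k" by simp
    have "energy (s l) \<le> 2 * defect (A l) (B l)"
      unfolding s_def by (rule energy_sgn_pair[OF pair_familyD(2-4)[OF AB l]])
    also have "\<dots> \<le> 2 * (\<delta> * \<mu> l)"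
      using good_pair_defect(1)[OF pair_familyD(1)[OF AB l] \<delta>] by (simp add: \<mu>_def)
    finally show "energy (s l) \<le> 2 * (\<delta> * \<mu> l)" .
  qed auto
  also have "\<dots> = \<epsilon> / 2 * (nrm f)\<^sup>2"
    unfolding nf by (simp add: sum_distrib_left \<delta>_def algebra_simps)
  also have "\<dots> < \<epsilon> * (nrm f)\<^sup>2" using pos K by simp
  also have "\<dots> \<le> energy f" using K(4) fK by (simp add: gap_def energy_def)
  finally show False by simp
qed

section \<open>The dual Cheeger constants\<close>

text \<open>Makes the suprema range over nonempty sets. If nothing of positive measure is left over,
  a nonzero function orthogonal to all indicators is nonzero on some \<open>D i\<close> with mean
  zero there, so its positive and negative parts split \<open>D i\<close>.\<close>

lemma disjoint_positive_sets:
  fixes k :: nat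
  assumes inf: "\<not> fin_dim (L2 M)"
  shows "\<exists>D. (\<forall>i<k. D i \<in> sets M \<and> 0 < measure M (D i)) \<and> (\<forall>i<k. \<forall>j<k. i \<noteq> j \<longrightarrow> D i \<inter> D j = {})"
proof (induction k)
  case (Suc k)
  then obtain D where D0: "\<forall>i<k. D i \<in> sets M \<and> 0 < measure M (D i)"
    "\<forall>i<k. \<forall>j<k. i \<noteq> j \<longrightarrow> D i \<inter> D j = {}" by (elim exE conjE)
  have D: "D i \<in> sets M" "0 < measure M (D i)" if "i < k" for i using D0(1) that by auto
  have Ddisj: "D i \<inter> D j = {}" if "i < k" "j < k" "i \<noteq> j" for i j using D0(2) that by blast
  define R where "R = space M - (\<Union>i<k. D i)"
  have R: "R \<in> sets M" unfolding R_def using D(1) by (intro sets.Diff sets.finite_UN) auto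
  show ?case
  proof (cases "0 < measure M R")
    case True
    have "R \<inter> D i = {}" if "i < k" for i using that by (auto simp: R_def)
    then show ?thesis using D Ddisj R True
      by (intro exI[of _ "D(k := R)"]) (auto simp: less_Suc_eq Int_commute)
  next
    case False
    have "AE x in M. x \<notin> R" using R False by (intro AE_not_in) (auto simp: null_sets_def emeasure_eq_measure not_less measure_le_0_iff)
    have "(\<lambda>i. indicator (D i) :: 'a \<Rightarrow> real) ` {..<k} \<subseteq> L2 M" using D(1) by auto
    from infinite_dim_orth[OF inf _ this] obtain f
      where f: "f \<in> orth ((\<lambda>i. indicator (D i)) ` {..<k})" "nrm f \<noteq> 0" by blast
    have fL2: "f \<in> L2 M" using f(1) by (rule orthD)
    have fm [measurable]: "f \<in> borel_measurable M" using fL2 by (rule L2D)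
    have int0: "(\<integral>x. f x * indicator (D i) x \<partial>M) = 0" if "i < k" for i
      using f(1) that by (auto simp: orth_def L2_inner_def)
    have fint: "integrable M (\<lambda>x. f x * indicator (D i) x)" if "i < k" for i
      using D(1)[OF that] by (intro L2_integrable_mult fL2 indicator_L2)
    have "\<exists>i<k. \<not> (AE x in M. f x * indicator (D i) x = 0)"
    proof (rule ccontr)
      assume "\<not> ?thesis"
      then have "AE x in M. \<forall>i\<in>{..<k}. f x * indicator (D i) x = 0" by (intro AE_finite_allI) auto
      then have "AE x in M. f x = 0" using \<open>AE x in M. x \<notin> R\<close> AE_space
        by eventually_elim (auto simp: R_def indicator_def split: if_splits)
      then show False using f(2) nrm_zero_iff_AE[OF fL2] by simp
    qed
    then obtain i where i: "i < k" "\<not> (AE x in M. f x * indicator (D i) x = 0)" by blast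
    define U where "U = {x \<in> space M. 0 < f x} \<inter> D i"
    define V where "V = {x \<in> space M. f x < 0} \<inter> D i"
    have UV: "U \<in> sets M" "V \<in> sets M" unfolding U_def V_def using D(1)[OF i(1)] by measurable
    have "0 < measure M U"
    proof (rule ccontr)
      assume "\<not> 0 < measure M U"
      then have "AE x in M. x \<notin> U" using UV by (intro AE_not_in) (auto simp: null_sets_def emeasure_eq_measure not_less measure_le_0_iff)
      then have "AE x in M. 0 \<le> - (f x * indicator (D i) x)" using AE_space
        by eventually_elim (auto simp: U_def indicator_def not_less)
      moreover have "(\<integral>x. - (f x * indicator (D i) x) \<partial>M) = 0" using int0[OF i(1)] by simp
      ultimately have "AE x in M. - (f x * indicator (D i) x) = 0"
        using integral_nonneg_eq_0_iff_AE[of M "\<lambda>x. - (f x * indicator (D i) x)"] fint[OF i(1)] by simp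
      then show False using i(2) by simp
    qed
    moreover have "0 < measure M V"
    proof (rule ccontr)
      assume "\<not> 0 < measure M V"
      then have "AE x in M. x \<notin> V" using UV by (intro AE_not_in) (auto simp: null_sets_def emeasure_eq_measure not_less measure_le_0_iff)
      then have "AE x in M. 0 \<le> f x * indicator (D i) x" using AE_space
        by eventually_elim (auto simp: V_def indicator_def not_less)
      then have "AE x in M. f x * indicator (D i) x = 0"
        using integral_nonneg_eq_0_iff_AE[of M "\<lambda>x. f x * indicator (D i) x"] fint[OF i(1)] int0[OF i(1)] by simp
      then show False using i(2) by simp
    qed
    moreover have "U \<inter> V = {}" "U \<subseteq> D i" "V \<subseteq> D i" by (auto simp: U_def V_def)
    moreover have "D l \<inter> U = {}" "D l \<inter> V = {}" if "l < k" "l \<noteq> i" for l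
      using Ddisj[OF that(1) i(1) that(2)] \<open>U \<subseteq> D i\<close> \<open>V \<subseteq> D i\<close> by blast+
    ultimately show ?thesis using D Ddisj UV i(1)
      by (intro exI[of _ "D(i := U, k := V)"]) (auto simp: less_Suc_eq Int_commute)
  qed
qed simp

abbreviation ratio :: "'a set \<Rightarrow> 'a set \<Rightarrow> real" where
  "ratio A B \<equiv> 2 * L2_inner M (indicator A) (P (indicator B)) / measure M (A \<union> B)"

definition cheeger_values :: "nat \<Rightarrow> real set" where
  "cheeger_values k = {Min ((\<lambda>i. ratio (A (2*i-1)) (A (2*i))) ` {1..k}) | A.
      (\<forall>p\<in>{1..2*k}. A p \<in> sets M) \<and>
      (\<forall>p\<in>{1..2*k}. \<forall>q\<in>{1..2*k}. p \<noteq> q \<longrightarrow> A p \<inter> A q = {}) \<and>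
      (\<forall>i\<in>{1..k}. measure M (A (2*i-1) \<union> A (2*i)) > 0)}"

lemma dual_cheeger_eq: "dual_cheeger M P k = Sup (cheeger_values k)"
  by (simp add: dual_cheeger_def cheeger_values_def)

text \<open>Reindexes sets numbered 1 to 2k as two sequences numbered from 0, the form used by
  \<open>pair_family\<close>.\<close>

lemma cheeger_values_iff:
  assumes k: "k \<ge> 1"
  shows "m \<in> cheeger_values k \<longleftrightarrow> (\<exists>A B. (\<forall>i<k. A i \<in> sets M \<and> B i \<in> sets M \<and> A i \<inter> B i = {} \<and> 0 < measure M (A i \<union> B i)) \<and>
      (\<forall>i<k. \<forall>j<k. i \<noteq> j \<longrightarrow> (A i \<union> B i) \<inter> (A j \<union> B j) = {}) \<and>
      m = Min ((\<lambda>i. ratio (A i) (B i)) ` {..<k}))"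
    (is "_ \<longleftrightarrow> ?R")
proof
  assume "m \<in> cheeger_values k"
  then obtain A where A: "\<And>p. p \<in> {1..2*k} \<Longrightarrow> A p \<in> sets M"
    "\<And>p q. p \<in> {1..2*k} \<Longrightarrow> q \<in> {1..2*k} \<Longrightarrow> p \<noteq> q \<Longrightarrow> A p \<inter> A q = {}"
    "\<And>i. i \<in> {1..k} \<Longrightarrow> measure M (A (2*i-1) \<union> A (2*i)) > 0"
    "m = Min ((\<lambda>i. ratio (A (2*i-1)) (A (2*i))) ` {1..k})"
    unfolding cheeger_values_def mem_Collect_eq by (elim exE conjE) (rule that; simp)
  have im: "{1..k} = Suc ` {..<k}" by (simp add: image_Suc_lessThan)
  show ?R
  proof (rule exI[of _ "\<lambda>i. A (2*i+1)"], rule exI[of _ "\<lambda>i. A (2*i+2)"], intro conjI allI impI)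
    fix i assume i: "i < k"
    then show "A (2*i+1) \<in> sets M" "A (2*i+2) \<in> sets M" by (auto intro!: A(1))
    show "A (2*i+1) \<inter> A (2*i+2) = {}" using i by (intro A(2)) auto
    show "0 < measure M (A (2*i+1) \<union> A (2*i+2))" using A(3)[of "Suc i"] i by simp
    fix j assume j: "j < k" "i \<noteq> j"
    have "A (2*i+1) \<inter> A (2*j+1) = {}" "A (2*i+1) \<inter> A (2*j+2) = {}" "A (2*i+2) \<inter> A (2*j+1) = {}" "A (2*i+2) \<inter> A (2*j+2) = {}"
      using i j by (intro A(2); simp; presburger)+
    then show "(A (2*i+1) \<union> A (2*i+2)) \<inter> (A (2*j+1) \<union> A (2*j+2)) = {}" by blast
  next
    show "m = Min ((\<lambda>i. ratio (A (2*i+1)) (A (2*i+2))) ` {..<k})"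
      unfolding A(4) im image_image by simp
  qed
next
  assume ?R
  then obtain A B where AB: "\<And>i. i < k \<Longrightarrow> A i \<in> sets M" "\<And>i. i < k \<Longrightarrow> B i \<in> sets M" "\<And>i. i < k \<Longrightarrow> A i \<inter> B i = {}"
    "\<And>i. i < k \<Longrightarrow> 0 < measure M (A i \<union> B i)"
    "\<And>i j. i < k \<Longrightarrow> j < k \<Longrightarrow> i \<noteq> j \<Longrightarrow> (A i \<union> B i) \<inter> (A j \<union> B j) = {}"
    "m = Min ((\<lambda>i. ratio (A i) (B i)) ` {..<k})"
    by (elim exE conjE) (rule that; simp)
  \<comment> \<open>The inverse numbering: pair \<open>i\<close> occupies the positions
    \<open>2 * i + 1\<close> and \<open>2 * i + 2\<close>.\<close>
  define C where "C p = (if odd p then A (p div 2) else B (p div 2 - 1))" for p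
  have C1: "C (2*i-1) = A (i-1)" "C (2*i) = B (i-1)" if i: "i \<ge> 1" for i
  proof -
    obtain l where l: "i = Suc l" using i by (cases i) auto
    have "2 * i - 1 = Suc (2 * l)" "2 * i = 2 * l + 2" using l by auto
    then show "C (2*i-1) = A (i-1)" "C (2*i) = B (i-1)" using l by (simp_all add: C_def)
  qed
  have im: "{..<k} = (\<lambda>i. i - 1) ` {1..k}" by (force simp: image_iff)
  show "m \<in> cheeger_values k"
    unfolding cheeger_values_def
  proof (intro CollectI exI[of _ C] conjI ballI impI)
    show "m = Min ((\<lambda>i. ratio (C (2*i-1)) (C (2*i))) ` {1..k})"
      unfolding AB(6) im image_image by (intro arg_cong[where f = Min] image_cong refl) (simp only: C1 atLeastAtMost_iff)
  next
    fix p assume p: "p \<in> {1..2*k}"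
    have lt: "q div 2 < k" if "q \<in> {1..2*k}" "odd q" for q using that by (auto elim!: oddE)
    have lt': "q div 2 - 1 < k" "q div 2 \<ge> 1" if "q \<in> {1..2*k}" "even q" for q using that by (auto elim!: evenE)
    show "C p \<in> sets M" using AB(1,2) lt[OF p] lt'[OF p] by (auto simp: C_def)
    fix q assume q: "q \<in> {1..2*k}" "p \<noteq> q"
    show "C p \<inter> C q = {}"
    proof -
      define ip where "ip = (if odd p then p div 2 else p div 2 - 1)"
      define iq where "iq = (if odd q then q div 2 else q div 2 - 1)"
      have k: "ip < k" "iq < k" using lt[OF p] lt'[OF p] lt[OF q(1)] lt'[OF q(1)] by (auto simp: ip_def iq_def)
      have C: "C p = (if odd p then A ip else B ip)" "C q = (if odd q then A iq else B iq)" by (auto simp: C_def ip_def iq_def)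
      show ?thesis
      proof (cases "ip = iq")
        case True
        have "odd p \<noteq> odd q"
        proof
          assume eq: "odd p = odd q"
          then have "p div 2 = q div 2"
            using True lt'(2)[OF p] lt'(2)[OF q(1)] by (cases "odd p") (auto simp: ip_def iq_def)
          then show False using eq q(2) by presburger
        qed
        then show ?thesis using AB(3)[OF k(1)] True C by (auto split: if_splits)
      next
        case False
        then show ?thesis using AB(5)[OF k] C by (auto split: if_splits)
      qed
    qed
  next
    fix i assume "i \<in> {1..k}"
    then have i: "i \<ge> 1" "i - 1 < k" by auto
    show "0 < measure M (C (2*i-1) \<union> C (2*i))" unfolding C1[OF i(1)] by (rule AB(4)[OF i(2)])
  qed
qed

text \<open>\<open>Sup\<close> and \<open>INF\<close> over the reals can be handled only for bounded
  sets; the upper bound is nonnegativity of the defect.\<close>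

lemma cheeger_values_bounds:
  assumes k: "k \<ge> 1" and m: "m \<in> cheeger_values k"
  shows "0 \<le> m" "m \<le> 1"
proof -
  obtain A B where AB: "\<And>i. i < k \<Longrightarrow> A i \<in> sets M" "\<And>i. i < k \<Longrightarrow> B i \<in> sets M" "\<And>i. i < k \<Longrightarrow> A i \<inter> B i = {}"
    "\<And>i. i < k \<Longrightarrow> 0 < measure M (A i \<union> B i)"
    and m: "m = Min ((\<lambda>i. ratio (A i) (B i)) ` {..<k})"
    using m[unfolded cheeger_values_iff[OF k]] by (elim exE conjE) (rule that; simp)
  have "m \<in> (\<lambda>i. ratio (A i) (B i)) ` {..<k}"
    unfolding m using k by (intro Min_in) (auto simp: lessThan_empty_iff)
  then obtain i where i: "i < k" "m = ratio (A i) (B i)" by auto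
  show "0 \<le> m" unfolding i(2) using AB[OF i(1)] by (intro divide_nonneg_pos mult_nonneg_nonneg ip_P_nonneg) auto
  show "m \<le> 1" unfolding i(2) using defect_nonneg[OF AB(1-3)[OF i(1)]] AB(4)[OF i(1)] by (simp add: defect_def divide_le_eq)
qed

lemma cheeger_value_gt_iff:
  assumes k: "k \<ge> 1"
  shows "(\<exists>m\<in>cheeger_values k. 1 - \<delta> < m) \<longleftrightarrow> (\<exists>A B. pair_family k \<delta> A B)"
proof -
  have gt: "1 - \<delta> < Min ((\<lambda>i. ratio (A i) (B i)) ` {..<k}) \<longleftrightarrow>
      (\<forall>i<k. (1 - \<delta>) * measure M (A i \<union> B i) < 2 * L2_inner M (indicator (A i)) (P (indicator (B i))))"
    if "\<And>i. i < k \<Longrightarrow> 0 < measure M (A i \<union> B i)" for A B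
    using k that by (subst Min_gr_iff) (auto simp: lessThan_empty_iff pos_less_divide_eq)
  show ?thesis
  proof
    assume "\<exists>m\<in>cheeger_values k. 1 - \<delta> < m"
    then obtain m where "m \<in> cheeger_values k" "1 - \<delta> < m" by blast
    then obtain A B where "\<forall>i<k. A i \<in> sets M \<and> B i \<in> sets M \<and> A i \<inter> B i = {} \<and> 0 < measure M (A i \<union> B i)"
      "\<forall>i<k. \<forall>j<k. i \<noteq> j \<longrightarrow> (A i \<union> B i) \<inter> (A j \<union> B j) = {}"
      "1 - \<delta> < Min ((\<lambda>i. ratio (A i) (B i)) ` {..<k})"
      unfolding cheeger_values_iff[OF k] by (elim exE conjE) (rule that; simp)
    then have "pair_family k \<delta> A B" using gt[of A B] by (simp add: pair_family_def good_pair_def)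
    then show "\<exists>A B. pair_family k \<delta> A B" by blast
  next
    assume "\<exists>A B. pair_family k \<delta> A B"
    then obtain A B where AB: "pair_family k \<delta> A B" by blast
    let ?m = "Min ((\<lambda>i. ratio (A i) (B i)) ` {..<k})"
    have "?m \<in> cheeger_values k"
      unfolding cheeger_values_iff[OF k] using AB unfolding pair_family_def good_pair_def by blast
    moreover have "1 - \<delta> < ?m" using AB gt[of A B] by (simp add: pair_family_def good_pair_def)
    ultimately show "\<exists>m\<in>cheeger_values k. 1 - \<delta> < m" by blast
  qed
qed

lemma cheeger_values_nonempty:
  assumes "\<not> fin_dim (L2 M)" "k \<ge> 1"
  shows "cheeger_values k \<noteq> {}"
proof -
  obtain D where D: "\<forall>i<k. D i \<in> sets M \<and> 0 < measure M (D i)" "\<forall>i<k. \<forall>j<k. i \<noteq> j \<longrightarrow> D i \<inter> D j = {}"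
    using disjoint_positive_sets[OF assms(1), of k] by (elim exE conjE)
  \<comment> \<open>The second set of an admissible pair may be empty.\<close>
  have "Min ((\<lambda>i. ratio (D i) {}) ` {..<k}) \<in> cheeger_values k"
    unfolding cheeger_values_iff[OF assms(2)] by (rule exI[of _ D], rule exI[of _ "\<lambda>_. {}"]) (use D in auto)
  then show ?thesis by blast
qed

lemma gap_iff_INF_dual_cheeger:
  assumes inf: "\<not> fin_dim (L2 M)"
  shows "(INF k\<in>{1..}. dual_cheeger M P k) < 1 \<longleftrightarrow>
      (\<exists>K \<epsilon>. finite K \<and> K \<subseteq> L2 M \<and> \<epsilon> > 0 \<and> gap (shift P (-1)) K \<epsilon>)"
proof
  assume less: "(INF k\<in>{1..}. dual_cheeger M P k) < 1"
  show "\<exists>K \<epsilon>. finite K \<and> K \<subseteq> L2 M \<and> \<epsilon> > 0 \<and> gap (shift P (-1)) K \<epsilon>"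
  proof (rule ccontr)
    assume nogap: "\<not> ?thesis"
    \<comment> \<open>Starting from the empty family, the tolerance is left arbitrary in the
      induction since each extension calls for a smaller one.\<close>
    have fam: "\<exists>A B. pair_family k \<delta> A B" if "\<delta> > 0" for k \<delta>
      using that
    proof (induction k arbitrary: \<delta>)
      case 0
      then show ?case by (simp add: pair_family_def)
    next
      case (Suc k)
      show ?case by (rule extend_pair_family) (use nogap Suc in blast)+
    qed
    have "1 \<le> dual_cheeger M P k" if k: "k \<ge> 1" for k
    proof (rule field_le_epsilon)
      fix \<delta> :: real assume "\<delta> > 0"
      then obtain m where m: "m \<in> cheeger_values k" "1 - \<delta> < m" using cheeger_value_gt_iff[OF k] fam by blast
      have "bdd_above (cheeger_values k)" using cheeger_values_bounds(2)[OF k] by (rule bdd_aboveI)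
      then have "m \<le> dual_cheeger M P k" unfolding dual_cheeger_eq using m(1) by (intro cSup_upper)
      then show "1 \<le> dual_cheeger M P k + \<delta>" using m(2) by simp
    qed
    then have "1 \<le> (INF k\<in>{1..}. dual_cheeger M P k)" by (intro cINF_greatest) auto
    then show False using less by simp
  qed
next
  assume "\<exists>K \<epsilon>. finite K \<and> K \<subseteq> L2 M \<and> \<epsilon> > 0 \<and> gap (shift P (-1)) K \<epsilon>"
  then obtain K \<epsilon> where K: "finite K" "K \<subseteq> L2 M" "\<epsilon> > 0" "gap (shift P (-1)) K \<epsilon>" by blast
  obtain k \<delta> where k\<delta>: "\<delta> > 0" "\<forall>A B. \<not> pair_family k \<delta> A B"
    using gap_imp_no_pair_family[OF K] by blast
  \<comment> \<open>The empty family always exists, so a number of pairs that cannot be reached is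
    positive.\<close>
  have k: "k \<ge> 1"
  proof (rule ccontr)
    assume "\<not> k \<ge> 1"
    then have "pair_family k \<delta> (\<lambda>_. {}) (\<lambda>_. {})" by (simp add: pair_family_def)
    then show False using k\<delta> by blast
  qed
  have "dual_cheeger M P k \<le> 1 - \<delta>"
    unfolding dual_cheeger_eq
  proof (rule cSup_least[OF cheeger_values_nonempty[OF inf k]])
    fix m assume "m \<in> cheeger_values k"
    then show "m \<le> 1 - \<delta>" using cheeger_value_gt_iff[OF k, of \<delta>] k\<delta>(2) by (meson not_le)
  qed
  moreover have "(INF k\<in>{1..}. dual_cheeger M P k) \<le> dual_cheeger M P k"
  proof (rule cINF_lower)
    show "bdd_below (dual_cheeger M P ` {1..})"
    proof (rule bdd_belowI2)
      fix j :: nat assume "j \<in> {1..}"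
      then have j: "j \<ge> 1" by simp
      obtain m where m: "m \<in> cheeger_values j" using cheeger_values_nonempty[OF inf j] by blast
      have "bdd_above (cheeger_values j)" using cheeger_values_bounds(2)[OF j] by (rule bdd_aboveI)
      then have "m \<le> dual_cheeger M P j" unfolding dual_cheeger_eq using m by (intro cSup_upper)
      then show "0 \<le> dual_cheeger M P j" using cheeger_values_bounds(1)[OF j m] by simp
    qed
  qed (use k in simp)
  ultimately show "(INF k\<in>{1..}. dual_cheeger M P k) < 1" using k\<delta>(1) by linarith
qed

text \<open>Below -1 the shifted operator is coercive because energies are nonnegative. This bounds
  the essential spectrum from below, so that its \<open>Inf\<close> can be compared with its
  elements.\<close>

lemma ess_ge: "m \<in> ess P \<Longrightarrow> - 1 \<le> m"
proof (rule ccontr)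
  assume m: "m \<in> ess P" "\<not> - 1 \<le> m"
  have coer: "(- 1 - m) * (nrm f)\<^sup>2 \<le> L2_inner M (shift P m f) f" if f: "f \<in> L2 M" for f
    using energy_nonneg[OF f] ip_shift[OF symop_P f f, of m] f
    by (simp add: energy_eq nrm_power2 symopD[OF symop_P] algebra_simps)
  have "0 < - 1 - m" using m(2) by simp
  note reg = coercive_imp_regular[OF symop_shift[OF symop_P] bound_op_shift[OF symop_P bound_op_P] this coer]
  have "m \<notin> spec P" unfolding spec_def mem_Collect_eq not_not
    by (intro conjI ballI impI) (use reg in \<open>simp_all only:\<close>)
  then show False using m(1) by (simp add: ess_def)
qed

lemma gap_iff_lambda_ess:
  assumes inf: "\<not> fin_dim (L2 M)"
  shows "lambda_ess_bot M P > - 1 \<longleftrightarrow>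
      (\<exists>K \<epsilon>. finite K \<and> K \<subseteq> L2 M \<and> \<epsilon> > 0 \<and> gap (shift P (-1)) K \<epsilon>)"
proof
  have psd: "0 \<le> L2_inner M (shift P (-1) x) x" if "x \<in> L2 M" for x
    using energy_nonneg[OF that] by (simp add: energy_def)
  {
    assume less: "lambda_ess_bot M P > - 1"
    have "- 1 \<notin> ess P"
    proof
      assume "- 1 \<in> ess P"
      moreover have "bdd_below (ess P)" using ess_ge by (rule bdd_belowI)
      ultimately have "Inf (ess P) \<le> - 1" by (rule cInf_lower)
      then show False using less by (simp add: lambda_ess_bot_def L2_ess_spectrum_eq)
    qed
    then obtain K c where K: "finite K" "K \<subseteq> L2 M" "c > 0"
      and low: "\<And>f. f \<in> orth K \<Longrightarrow> c * nrm f \<le> nrm (shift P (-1) f)"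
      using not_ess_bounded_below[OF symop_P bound_op_P] by blast
    \<comment> \<open>The divisor 2 is the operator bound of \<open>P\<close> + 1, through which
      \<open>psd_nrm_bound\<close> passes from norms to the form.\<close>
    have "gap (shift P (-1)) K (c\<^sup>2 / 2)"
      unfolding gap_def
    proof
      fix f assume f: "f \<in> orth K"
      then have fL2: "f \<in> L2 M" by (rule orthD)
      have "(c * nrm f)\<^sup>2 \<le> (nrm (shift P (-1) f))\<^sup>2" using low[OF f] K(3) fL2 by (intro power_mono) auto
      also have "\<dots> \<le> 2 * L2_inner M (shift P (-1) f) f" by (rule psd_nrm_bound[OF symop_T bound_op_T psd fL2])
      finally show "c\<^sup>2 / 2 * (nrm f)\<^sup>2 \<le> L2_inner M (shift P (-1) f) f" by (simp add: power_mult_distrib)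
    qed
    then show "\<exists>K \<epsilon>. finite K \<and> K \<subseteq> L2 M \<and> \<epsilon> > 0 \<and> gap (shift P (-1)) K \<epsilon>"
      using K by (intro exI[of _ K] exI[of _ "c\<^sup>2 / 2"]) auto
  next
    assume "\<exists>K \<epsilon>. finite K \<and> K \<subseteq> L2 M \<and> \<epsilon> > 0 \<and> gap (shift P (-1)) K \<epsilon>"
    then obtain \<delta> where \<delta>: "\<delta> > 0" "\<And>m. m \<in> ess P \<Longrightarrow> - 1 + \<delta> \<le> m"
      using gap_imp_ess_above[OF symop_P bound_op_P psd] by blast
    have "- 1 + \<delta> \<le> Inf (ess P)"
      using ess_nonempty[OF symop_P bound_op_P inf] \<delta>(2) by (rule cInf_greatest)
    then show "lambda_ess_bot M P > - 1" using \<delta>(1) by (simp add: lambda_ess_bot_def L2_ess_spectrum_eq)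
  }
qed

end

theorem theorem8p4:
  fixes M :: "'a measure" and P :: "('a \<Rightarrow> real) \<Rightarrow> ('a \<Rightarrow> real)"
  assumes "prob_space M"
    and "\<not> L2_fin_dim M (L2 M)"
    and "markov_operator M P"
    and "reversible M P"
  shows "lambda_ess_bot M P > -1 \<longleftrightarrow> (INF k\<in>{1..}. dual_cheeger M P k) < 1"
proof -
  interpret reversible_markov M P
    using assms by (simp add: reversible_markov_def reversible_markov_axioms_def)
  have "\<not> fin_dim (L2 M)" using assms(2) L2_fin_dim_eq[OF order_refl] by simp
  then show ?thesis using gap_iff_lambda_ess gap_iff_INF_dual_cheeger by simp
qed

end
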